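(* Let $\mathbb{K}$ be a field and let $\mathcal{F}:\mathbb{P}^1_{\mathbb{K}}\times\mathbb{P}^1_{\mathbb{K}}\dashrightarrow\mathbb{P}^2_{\mathbb{K}}$ be a dominant rational map defined by bi-homogeneous polynomials $f_0,f_1,f_2\in R$ of the same bi-degree $\mathbf{d}=(d_1,d_2)$, with base ideal $I=(f_0,f_1,f_2)$ and base locus $\mathcal{B}=V(I)\subset\mathbb{P}^1\times\mathbb{P}^1$ such that $\dim(\mathcal{B})=0$. Then $$\deg(\mathcal{F})\le1+(d_1-1)(d_2-1)+\dim_{\mathbb{K}}\Big(\big[I^{\mathrm{sat}}/I\big]_{\mathbf{d}}\Big).$$
   Context: $R=\mathbb{K}[x_{1,0},x_{1,1}]\otimes_{\mathbb{K}}\mathbb{K}[x_{2,0},x_{2,1}]$ is the bigraded coordinate ring of $\mathbb{P}^1\times\mathbb{P}^1$, $\mathfrak{N}=\bigoplus_{j_1>0,j_2>0}R_{j_1,j_2}$, $I^{\mathrm{sat}}=(I:\mathfrak{N}^\infty)$, and $[M]_{\mathbf c}$ is the component of bi-degree $\mathbf c$. $\deg(\mathcal{F})=[K(\mathbb{P}^1\times\mathbb{P}^1):K(\mathbb{P}^2)]$. $\dim(\mathcal{B})=0$ means that $\mathcal{B}$ is finite over $\mathbb{K}$. *)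

theory Defs
  imports
    Complex_Main
    "HOL-Library.Poly_Mapping"
    "HOL-Computational_Algebra.Fraction_Field"
begin

interpretation ideal: module "(*) :: 'a::comm_ring_1 \<Rightarrow> 'a \<Rightarrow> 'a"
  by standard (simp_all add: algebra_simps)

text \<open>
  Through this interpretation, \<open>ideal.span S\<close> is the ideal generated by \<open>S\<close> and
  \<open>ideal.subspace P\<close> says that \<open>P\<close> is an ideal.
\<close>


section \<open>The coordinate rings\<close>

text \<open>
  The variable \<open>Xij\<close> stands for \<open>x\<^sub>i\<^sub>,\<^sub>j\<close>. The linear order on the variables has no
  mathematical meaning here; it is what makes the polynomial ring an instance of \<open>idom\<close>.
\<close>

datatype xvar = X10 | X11 | X20 | X21

datatype yvar = Y0 | Y1 | Y2

primrec xvar_index :: "xvar \<Rightarrow> nat" where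
  "xvar_index X10 = 0"
| "xvar_index X11 = 1"
| "xvar_index X20 = 2"
| "xvar_index X21 = 3"

instantiation xvar :: linorder
begin

definition less_eq_xvar :: "xvar \<Rightarrow> xvar \<Rightarrow> bool" where
  "x \<le> y \<longleftrightarrow> xvar_index x \<le> xvar_index y"

definition less_xvar :: "xvar \<Rightarrow> xvar \<Rightarrow> bool" where
  "x < y \<longleftrightarrow> xvar_index x < xvar_index y"

instance
proof
  fix x y :: xvar
  show "x \<le> y \<Longrightarrow> y \<le> x \<Longrightarrow> x = y"
    by (cases x; cases y) (simp_all add: less_eq_xvar_def)
qed (auto simp: less_eq_xvar_def less_xvar_def)

end

type_synonym 'k xpoly = "(xvar \<Rightarrow>\<^sub>0 nat) \<Rightarrow>\<^sub>0 'k"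

type_synonym 'k ypoly = "(yvar \<Rightarrow>\<^sub>0 nat) \<Rightarrow>\<^sub>0 'k"

definition Const :: "'k::field \<Rightarrow> 'k xpoly" where
  "Const c = Poly_Mapping.single 0 c"

definition Var :: "xvar \<Rightarrow> 'k::field xpoly" where
  "Var x = Poly_Mapping.single (Poly_Mapping.single x 1) 1"

definition deg1 :: "(xvar \<Rightarrow>\<^sub>0 nat) \<Rightarrow> nat" where
  "deg1 m = Poly_Mapping.lookup m X10 + Poly_Mapping.lookup m X11"

definition deg2 :: "(xvar \<Rightarrow>\<^sub>0 nat) \<Rightarrow> nat" where
  "deg2 m = Poly_Mapping.lookup m X20 + Poly_Mapping.lookup m X21"

text \<open>The graded pieces \<open>R\<^sub>a\<^sub>,\<^sub>b\<close> and \<open>K[y\<^sub>0,y\<^sub>1,y\<^sub>2]\<^sub>n\<close>; both contain \<open>0\<close>.\<close>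

definition bihomogeneous :: "nat \<Rightarrow> nat \<Rightarrow> 'k::field xpoly \<Rightarrow> bool" where
  "bihomogeneous a b p \<longleftrightarrow> (\<forall>m\<in>Poly_Mapping.keys p. deg1 m = a \<and> deg2 m = b)"

definition homogeneous :: "nat \<Rightarrow> 'k::field ypoly \<Rightarrow> bool" where
  "homogeneous n g \<longleftrightarrow>
    (\<forall>m\<in>Poly_Mapping.keys g.
      Poly_Mapping.lookup m Y0 + Poly_Mapping.lookup m Y1 + Poly_Mapping.lookup m Y2 = n)"

text \<open>The polynomial \<open>g(f\<^sub>0,f\<^sub>1,f\<^sub>2)\<close>.\<close>

definition subst3 :: "'k::field xpoly \<Rightarrow> 'k xpoly \<Rightarrow> 'k xpoly \<Rightarrow> 'k ypoly \<Rightarrow> 'k xpoly" where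
  "subst3 f0 f1 f2 g =
    (\<Sum>m\<in>Poly_Mapping.keys g. Const (Poly_Mapping.lookup g m)
      * f0 ^ Poly_Mapping.lookup m Y0 * f1 ^ Poly_Mapping.lookup m Y1 * f2 ^ Poly_Mapping.lookup m Y2)"


section \<open>Irrelevant ideal, saturation, points\<close>

definition irrelevant :: "'k::field xpoly set" where
  "irrelevant = {p. \<forall>m\<in>Poly_Mapping.keys p. deg1 m > 0 \<and> deg2 m > 0}"

primrec ideal_power :: "'a::comm_ring_1 set \<Rightarrow> nat \<Rightarrow> 'a set" where
  "ideal_power J 0 = UNIV"
| "ideal_power J (Suc n) = ideal.span {a * b | a b. a \<in> J \<and> b \<in> ideal_power J n}"

text \<open>\<open>(I : N\<^sup>\<infinity>)\<close>, the union over \<open>n\<close> of the ideal quotients \<open>(I : N\<^sup>n)\<close>.\<close>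

definition saturation :: "'k::field xpoly set \<Rightarrow> 'k xpoly set" where
  "saturation I = {p. \<exists>n. \<forall>q\<in>ideal_power irrelevant n. p * q \<in> I}"

text \<open>
  The points of the scheme \<open>P\<^sup>1 \<times> P\<^sup>1 = BiProj R\<close>: bihomogeneous prime ideals that do not
  contain the irrelevant ideal.
\<close>

definition biproj_points :: "'k::field xpoly set set" where
  "biproj_points = {P. ideal.subspace P \<and> 1 \<notin> P \<and> (\<forall>p q. p * q \<in> P \<longrightarrow> p \<in> P \<or> q \<in> P)
     \<and> P = ideal.span {p \<in> P. \<exists>a b. bihomogeneous a b p} \<and> \<not> irrelevant \<subseteq> P}"

text \<open>
  The map sends a point \<open>P\<close> outside the base locus to the point of \<open>P\<^sup>2 = Proj K[y\<^sub>0,y\<^sub>1,y\<^sub>2]\<close>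
  whose homogeneous elements are the \<open>g\<close> with \<open>g(f\<^sub>0,f\<^sub>1,f\<^sub>2) \<in> P\<close>. Dominant means that the
  image is dense, i.e. it meets every nonempty basic open subset \<open>g \<noteq> 0\<close> of \<open>P\<^sup>2\<close>.
\<close>

definition dominant :: "'k::field xpoly \<Rightarrow> 'k xpoly \<Rightarrow> 'k xpoly \<Rightarrow> bool" where
  "dominant f0 f1 f2 \<longleftrightarrow>
    (\<forall>n g. homogeneous n g \<and> g \<noteq> 0 \<longrightarrow>
      (\<exists>P\<in>biproj_points. \<not> {f0, f1, f2} \<subseteq> P \<and> subst3 f0 f1 f2 g \<notin> P))"


section \<open>Dimensions of quotient spaces\<close>

text \<open>
  The classes of the elements of \<open>B\<close> form a finite basis of the quotient space \<open>V / W\<close>; the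
  field of scalars \<open>F\<close> is given as a set, acting by \<open>scale\<close>.
\<close>

definition quotient_basis ::
    "'s::zero set \<Rightarrow> ('s \<Rightarrow> 'v::ab_group_add \<Rightarrow> 'v) \<Rightarrow> 'v set \<Rightarrow> 'v set \<Rightarrow> 'v set \<Rightarrow> bool" where
  "quotient_basis F scale V W B \<longleftrightarrow> finite B \<and> B \<subseteq> V \<and>
    (\<forall>v\<in>V. \<exists>c. c ` B \<subseteq> F \<and> v - (\<Sum>b\<in>B. scale (c b) b) \<in> W) \<and>
    (\<forall>c. c ` B \<subseteq> F \<and> (\<Sum>b\<in>B. scale (c b) b) \<in> W \<longrightarrow> (\<forall>b\<in>B. c b = 0))"

definition quotient_finite_dim ::
    "'s::zero set \<Rightarrow> ('s \<Rightarrow> 'v::ab_group_add \<Rightarrow> 'v) \<Rightarrow> 'v set \<Rightarrow> 'v set \<Rightarrow> bool" where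
  "quotient_finite_dim F scale V W \<longleftrightarrow> (\<exists>B. quotient_basis F scale V W B)"

text \<open>Only meaningful if \<open>V / W\<close> has finite dimension.\<close>

definition quotient_dim ::
    "'s::zero set \<Rightarrow> ('s \<Rightarrow> 'v::ab_group_add \<Rightarrow> 'v) \<Rightarrow> 'v set \<Rightarrow> 'v set \<Rightarrow> nat" where
  "quotient_dim F scale V W = card (SOME B. quotient_basis F scale V W B)"

text \<open>\<open>[J/I]\<^sub>a\<^sub>,\<^sub>b = J\<^sub>a\<^sub>,\<^sub>b / I\<^sub>a\<^sub>,\<^sub>b\<close> for bihomogeneous ideals \<open>I \<subseteq> J\<close>.\<close>

definition graded_quotient_dim :: "nat \<Rightarrow> nat \<Rightarrow> 'k::field xpoly set \<Rightarrow> 'k xpoly set \<Rightarrow> nat" where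
  "graded_quotient_dim a b J I =
    quotient_dim (UNIV :: 'k set) (\<lambda>c p. Const c * p)
      {p \<in> J. bihomogeneous a b p} {p \<in> I. bihomogeneous a b p}"


section \<open>The base locus\<close>

text \<open>
  For an ideal \<open>J\<close>, the part of bidegree \<open>(0,0)\<close> of the localisation of \<open>J\<close> at
  \<open>x\<^sub>1\<^sub>,\<^sub>i x\<^sub>2\<^sub>,\<^sub>j\<close>, inside the fraction field of \<open>R\<close>; here \<open>x = x\<^sub>1\<^sub>,\<^sub>i\<close> and \<open>y = x\<^sub>2\<^sub>,\<^sub>j\<close>.
  For \<open>J = R\<close> this is the coordinate ring of a standard affine chart of \<open>P\<^sup>1 \<times> P\<^sup>1\<close>.
\<close>

definition chart :: "xvar \<Rightarrow> xvar \<Rightarrow> 'k::field xpoly set \<Rightarrow> 'k xpoly fract set" where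
  "chart x y J = {Fract p (Var x ^ a * Var y ^ b) | p a b. p \<in> J \<and> bihomogeneous a b p}"

text \<open>
  The closed subscheme \<open>V(I)\<close> of \<open>P\<^sup>1 \<times> P\<^sup>1\<close> is finite over \<open>K\<close>: its four standard affine
  charts, with coordinate rings \<open>chart x y UNIV / chart x y I\<close>, are spectra of
  finite-dimensional \<open>K\<close>-algebras. The empty scheme is included.
\<close>

definition finite_base_locus :: "'k::field xpoly set \<Rightarrow> bool" where
  "finite_base_locus I \<longleftrightarrow>
    (\<forall>x\<in>{X10, X11}. \<forall>y\<in>{X20, X21}.
      quotient_finite_dim (UNIV :: 'k set) (\<lambda>c z. Fract (Const c) 1 * z)
        (chart x y UNIV) (chart x y I))"


section \<open>Function fields and the degree of the map\<close>

definition function_field :: "'k::field xpoly fract set" where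
  "function_field = {Fract p q | p q a b. bihomogeneous a b p \<and> bihomogeneous a b q \<and> q \<noteq> 0}"

text \<open>
  The function field of \<open>P\<^sup>2\<close>, embedded into the one of \<open>P\<^sup>1 \<times> P\<^sup>1\<close> by pulling back along a
  dominant map; dominance gives \<open>h(f\<^sub>0,f\<^sub>1,f\<^sub>2) \<noteq> 0\<close> for the denominators.
\<close>

definition pullback_field :: "'k::field xpoly \<Rightarrow> 'k xpoly \<Rightarrow> 'k xpoly \<Rightarrow> 'k xpoly fract set" where
  "pullback_field f0 f1 f2 =
    {Fract (subst3 f0 f1 f2 g) (subst3 f0 f1 f2 h) | g h n.
      homogeneous n g \<and> homogeneous n h \<and> h \<noteq> 0}"

definition generically_finite :: "'k::field xpoly \<Rightarrow> 'k xpoly \<Rightarrow> 'k xpoly \<Rightarrow> bool" where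
  "generically_finite f0 f1 f2 \<longleftrightarrow>
    quotient_finite_dim (pullback_field f0 f1 f2) (*) function_field {0}"

definition map_degree :: "'k::field xpoly \<Rightarrow> 'k xpoly \<Rightarrow> 'k xpoly \<Rightarrow> nat" where
  "map_degree f0 f1 f2 = quotient_dim (pullback_field f0 f1 f2) (*) function_field {0}"

end

theory Submission
  imports Defs "Berlekamp_Zassenhaus.Unique_Factorization_Poly"
begin

text \<open>
  Let \<open>L\<close> be the function field of \<open>P\<^sup>1 \<times> P\<^sup>1\<close> and \<open>M \<subseteq> L\<close> the pulled back function field of \<open>P\<^sup>2\<close>. It
  contains \<open>\<lambda> = f\<^sub>1/f\<^sub>0\<close> and \<open>\<mu> = f\<^sub>2/f\<^sub>0\<close>, the affine coordinates of the generic point of \<open>P\<^sup>2\<close>. Over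
  \<open>M\<close>, the curves \<open>h\<^sub>1 = f\<^sub>1 - \<lambda> f\<^sub>0\<close> and \<open>h\<^sub>2 = f\<^sub>2 - \<mu> f\<^sub>0\<close> of bidegree \<open>(d\<^sub>1, d\<^sub>2)\<close> have intersection
  number \<open>2 d\<^sub>1 d\<^sub>2\<close>. They meet in the base locus, where the \<open>f\<^sub>i\<close> vanish, and in the generic fibre,
  a single point with residue field \<open>L\<close>. The generic fibre counts \<open>[L : M]\<close> times and the base locus
  at least \<open>dim (R/I\<^sup>s\<^sup>a\<^sup>t)\<^sub>d\<close> times, because the Hilbert function of \<open>R\<close> modulo a
  saturated ideal does not decrease.
  Therefore
  \<open>[L : M] + dim (R/I\<^sup>s\<^sup>a\<^sup>t)\<^sub>d \<le> 2 d\<^sub>1 d\<^sub>2\<close>. As \<open>R\<^sub>d\<close> has dimension \<open>(d\<^sub>1 + 1)(d\<^sub>2 + 1)\<close> and \<open>I\<^sub>d\<close> is spanned by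
  three elements, this is the asserted bound.

  The inequality is proved without intersection theory, by counting the unknowns and the equations
  of one linear system over \<open>M\<close> (\<open>independent_count_le\<close>). Take \<open>e\<^sub>1, \<dots>, e\<^sub>D \<in> L\<close> independent over \<open>M\<close>
  and \<open>q\<^sub>1, \<dots>, q\<^sub>r\<close> independent modulo \<open>I\<^sup>s\<^sup>a\<^sup>t\<close> in a large bidegree, write \<open>e\<^sub>i = P\<^sub>i/Q\<close> with a common
  denominator, and look for relations
  \<open>\<Sum> c\<^sub>i P\<^sub>i f\<^sub>0 + \<Sum> b\<^sub>j q\<^sub>j + A h\<^sub>1 + B h\<^sub>2 = 0\<close> with coefficients in \<open>M\<close>. Linear functionals that vanish on
  \<open>I\<close> show that all \<open>b\<^sub>j\<close> are zero, and substituting the generic point of \<open>P\<^sup>1 \<times> P\<^sup>1\<close>, at which \<open>h\<^sub>1\<close>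
  and \<open>h\<^sub>2\<close> vanish, shows that all \<open>c\<^sub>i\<close> are zero. The remaining relations between \<open>h\<^sub>1\<close> and \<open>h\<^sub>2\<close> are
  the trivial ones, because the two polynomials are coprime (\<open>coprime_generic_fibre\<close>). If \<open>D + r\<close>
  exceeded \<open>2 d\<^sub>1 d\<^sub>2\<close>, there would be more relations than trivial ones.

  Two ingredients go into this. The number \<open>r\<close> may be taken in bidegree \<open>(d\<^sub>1, d\<^sub>2)\<close>, because a family
  that is independent modulo a saturated ideal can be moved to any larger bidegree
  (\<open>independent_mod_growth\<close>); the argument works over finite fields too, where a linear form that is
  a nonzerodivisor need not exist. And \<open>h\<^sub>1, h\<^sub>2\<close> are coprime for two reasons: the affine coordinates
  of \<open>P\<^sup>1 \<times> P\<^sup>1\<close> are algebraic over \<open>M\<close>, again by counting, and the finiteness of the base locus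
  excludes a common divisor of the \<open>f\<^sub>i\<close>.
\<close>

section \<open>Linear algebra over a subfield\<close>

text \<open>
  For the multiplication of a ring as an action on itself this rule reassociates products and
  loops with \<open>mult.assoc\<close>.
\<close>

declare ideal.scale_scale [simp del]

text \<open>
  The field \<open>M\<close> and the larger field \<open>L\<close> have to share one type, since elements of \<open>L\<close> are tested for
  independence over \<open>M\<close>. So \<open>M\<close> is a set, and linear systems are solved with coefficients and
  solutions in that set.
\<close>

definition subfield :: "'f::field set \<Rightarrow> bool" where
  "subfield M \<longleftrightarrow> 1 \<in> M \<and> (\<forall>a\<in>M. \<forall>b\<in>M. a - b \<in> M \<and> a * b \<in> M) \<and> (\<forall>a\<in>M. inverse a \<in> M)"

lemma subfield_UNIV: "subfield UNIV"
  by (simp add: subfield_def)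

context
  fixes M :: "'f::field set"
  assumes M: "subfield M"
begin

lemma subfield_1: "1 \<in> M"
  and subfield_diff: "a \<in> M \<Longrightarrow> b \<in> M \<Longrightarrow> a - b \<in> M"
  and subfield_mult: "a \<in> M \<Longrightarrow> b \<in> M \<Longrightarrow> a * b \<in> M"
  and subfield_inverse: "a \<in> M \<Longrightarrow> inverse a \<in> M"
  using M by (auto simp: subfield_def)

lemma subfield_0: "0 \<in> M"
  using subfield_diff[OF subfield_1 subfield_1] by simp

lemma subfield_uminus: "a \<in> M \<Longrightarrow> - a \<in> M"
  using subfield_diff[OF subfield_0] by fastforce

lemma subfield_add: "a \<in> M \<Longrightarrow> b \<in> M \<Longrightarrow> a + b \<in> M"
  using subfield_diff[of a "- b"] subfield_uminus by simp

lemma subfield_divide: "a \<in> M \<Longrightarrow> b \<in> M \<Longrightarrow> a / b \<in> M"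
  by (simp add: divide_inverse subfield_mult subfield_inverse)

lemma subfield_sum: "(\<And>u. u \<in> U \<Longrightarrow> a u \<in> M) \<Longrightarrow> sum a U \<in> M"
  by (induction U rule: infinite_finite_induct) (auto simp: subfield_0 subfield_add)

text \<open>
  Gaussian elimination, one equation at a time: an equation with a nonzero coefficient determines
  one unknown through the others, and an equation without one can be dropped.
\<close>

lemma underdetermined_system_solvable:
  fixes A :: "'e \<Rightarrow> 'u \<Rightarrow> 'f"
  assumes "finite E" "finite U" "card E < card U"
    and "\<And>e u. e \<in> E \<Longrightarrow> u \<in> U \<Longrightarrow> A e u \<in> M"
  shows "\<exists>x. (\<forall>u. x u \<in> M) \<and> (\<exists>u\<in>U. x u \<noteq> 0) \<and> (\<forall>e\<in>E. (\<Sum>u\<in>U. A e u * x u) = 0)"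
  using assms
proof (induction E arbitrary: U A rule: finite_induct)
  case empty
  then have "U \<noteq> {}" by auto
  then show ?case by (intro exI[of _ "\<lambda>_. 1"]) (auto simp: subfield_1)
next
  case (insert e E)
  show ?case
  proof (cases "\<exists>u\<in>U. A e u \<noteq> 0")
    case False
    have "card E < card U" using insert by simp
    then obtain x where "\<forall>u. x u \<in> M" "\<exists>u\<in>U. x u \<noteq> 0" "\<forall>e\<in>E. (\<Sum>u\<in>U. A e u * x u) = 0"
      using insert.IH[of U A] insert.prems by auto
    with False show ?thesis by (intro exI[of _ x]) auto
  next
    case True
    then obtain v where v: "v \<in> U" "A e v \<noteq> 0" by auto
    define U' where "U' = U - {v}"
    have U: "U = insert v U'" "v \<notin> U'" "finite U'" using v insert.prems by (auto simp: U'_def)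
    define A' where "A' = (\<lambda>f u. A f u - A f v * (A e u / A e v))"
    have "card E < card U'" using insert U by simp
    moreover have "\<And>f u. f \<in> E \<Longrightarrow> u \<in> U' \<Longrightarrow> A' f u \<in> M"
      unfolding A'_def using insert.prems v U
      by (intro subfield_diff subfield_mult subfield_divide) auto
    ultimately obtain x where x: "\<forall>u. x u \<in> M" "\<exists>u\<in>U'. x u \<noteq> 0"
        "\<forall>f\<in>E. (\<Sum>u\<in>U'. A' f u * x u) = 0"
      using insert.IH[of U' A'] U by auto
    define y where "y = x(v := - (\<Sum>u\<in>U'. A e u / A e v * x u))"
    have y: "y u = x u" if "u \<in> U'" for u using that U by (auto simp: y_def)
    have sums: "(\<Sum>u\<in>U. A f u * y u) = (\<Sum>u\<in>U'. A' f u * x u)" for f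
    proof -
      have "(\<Sum>u\<in>U. A f u * y u) = A f v * y v + (\<Sum>u\<in>U'. A f u * x u)"
        unfolding U(1) sum.insert[OF U(3,2)]
        by (intro arg_cong2[where f = "(+)"] refl sum.cong) (simp_all add: y)
      also have "A f v * y v = - (\<Sum>u\<in>U'. A f v * (A e u / A e v) * x u)"
        unfolding y_def fun_upd_same mult_minus_right by (simp only: sum_distrib_left mult.assoc)
      finally show ?thesis
        by (simp only: A'_def sum_subtractf left_diff_distrib uminus_add_conv_diff)
    qed
    have "A' e u = 0" for u using v by (simp add: A'_def)
    then have "\<forall>f\<in>insert e E. (\<Sum>u\<in>U. A f u * y u) = 0"
      using x(3) by (auto simp: sums)
    moreover have "\<exists>u\<in>U. y u \<noteq> 0" using x(2) y U by auto
    moreover have "y u \<in> M" for u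
      using x(1) U v insert.prems unfolding y_def
      by (auto intro!: subfield_uminus subfield_sum subfield_mult subfield_divide)
    ultimately show ?thesis by auto
  qed
qed

end

text \<open>
  An independent set of maximal size spans: a vector outside it satisfies a nontrivial relation with
  it, and the coefficient of that vector can be inverted in \<open>F\<close>.
\<close>

lemma quotient_basis_exists:
  fixes F :: "'f::field set" and scale :: "'f \<Rightarrow> 'v::ab_group_add \<Rightarrow> 'v"
  assumes F: "subfield F" and vs: "vector_space scale"
    and W: "\<And>a x. a \<in> F \<Longrightarrow> x \<in> W \<Longrightarrow> scale a x \<in> W"
    and bound: "\<And>B. finite B \<Longrightarrow> B \<subseteq> V \<Longrightarrow>
      (\<And>c. c ` B \<subseteq> F \<Longrightarrow> (\<Sum>b\<in>B. scale (c b) b) \<in> W \<Longrightarrow> \<forall>b\<in>B. c b = 0) \<Longrightarrow> card B \<le> n"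
    and W0: "0 \<in> W"
  shows "\<exists>B. quotient_basis F scale V W B"
proof -
  interpret vector_space scale by (fact vs)
  define indep where "indep = (\<lambda>B. finite B \<and> B \<subseteq> V \<and>
    (\<forall>c. c ` B \<subseteq> F \<and> (\<Sum>b\<in>B. scale (c b) b) \<in> W \<longrightarrow> (\<forall>b\<in>B. c b = 0)))"
  have "indep {}" by (simp add: indep_def)
  moreover have "\<forall>B. indep B \<longrightarrow> card B \<le> n" using bound by (auto simp: indep_def)
  ultimately obtain B where B: "indep B" and max: "\<And>B'. indep B' \<Longrightarrow> card B' \<le> card B"
    using ex_has_greatest_nat[of indep "{}" card "Suc n"] by (force simp: less_Suc_eq_le)
  have fin: "finite B" using B by (simp add: indep_def)
  have "\<exists>c. c ` B \<subseteq> F \<and> v - (\<Sum>b\<in>B. scale (c b) b) \<in> W" if v: "v \<in> V" for v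
  proof (cases "v \<in> B")
    case True
    have "(\<Sum>b\<in>B. scale (if b = v then 1 else 0) b) = (\<Sum>b\<in>B. if b = v then b else 0)"
      by (rule sum.cong) auto
    also have "\<dots> = v" using True fin by simp
    finally show ?thesis
      using W0 subfield_0[OF F] subfield_1[OF F]
      by (intro exI[of _ "\<lambda>b. if b = v then 1 else 0"]) auto
  next
    case False
    have "\<not> indep (insert v B)" using max[of "insert v B"] False fin by auto
    then obtain c where c: "c ` insert v B \<subseteq> F" "(\<Sum>b\<in>insert v B. scale (c b) b) \<in> W"
        "\<exists>b\<in>insert v B. c b \<noteq> 0"
      using B v unfolding indep_def by auto
    have cv: "c v \<noteq> 0"
    proof
      assume "c v = 0"
      with c False fin have "(\<Sum>b\<in>B. scale (c b) b) \<in> W" by simp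
      with B c \<open>c v = 0\<close> show False unfolding indep_def by auto
    qed
    define d where "d b = - (inverse (c v) * c b)" for b
    have "d ` B \<subseteq> F" using c(1) F
      by (auto simp: d_def intro!: subfield_uminus subfield_mult subfield_inverse)
    moreover have "v - (\<Sum>b\<in>B. scale (d b) b) = scale (inverse (c v)) (\<Sum>b\<in>insert v B. scale (c b) b)"
      using False fin cv
      by (simp add: scale_right_distrib scale_sum_right d_def sum_negf)
    moreover have "\<dots> \<in> W" using W c F by (auto intro!: subfield_inverse)
    ultimately show ?thesis by (intro exI[of _ d]) simp
  qed
  with B show ?thesis unfolding quotient_basis_def indep_def by blast
qed

section \<open>Substitution into polynomials\<close>

definition evaluate :: "('c \<Rightarrow> 'r) \<Rightarrow> ('m \<Rightarrow> 'r) \<Rightarrow> ('m \<Rightarrow>\<^sub>0 'c::zero) \<Rightarrow> 'r::comm_ring_1" where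
  "evaluate \<phi> \<mu> p = (\<Sum>m\<in>Poly_Mapping.keys p. \<phi> (Poly_Mapping.lookup p m) * \<mu> m)"

lemma poly_mapping_sum_monomials:
  fixes p :: "'m \<Rightarrow>\<^sub>0 'c::comm_monoid_add"
  assumes "finite S" "Poly_Mapping.keys p \<subseteq> S"
  shows "p = (\<Sum>m\<in>S. Poly_Mapping.single m (Poly_Mapping.lookup p m))"
proof (rule poly_mapping_eqI)
  fix k
  have "Poly_Mapping.lookup (\<Sum>m\<in>S. Poly_Mapping.single m (Poly_Mapping.lookup p m)) k
      = (\<Sum>m\<in>S. if m = k then Poly_Mapping.lookup p m else 0)"
    by (simp add: lookup_sum lookup_single when_def)
  also have "\<dots> = (if k \<in> S then Poly_Mapping.lookup p k else 0)"
    using assms(1) by simp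
  also have "\<dots> = Poly_Mapping.lookup p k"
    using assms(2) by (auto simp: in_keys_iff)
  finally show "Poly_Mapping.lookup p k = Poly_Mapping.lookup
      (\<Sum>m\<in>S. Poly_Mapping.single m (Poly_Mapping.lookup p m)) k" by simp
qed

text \<open>
  Several ring homomorphisms out of polynomial rings are needed, with the coefficients mapped along:
  the substitution of the \<open>f\<^sub>i\<close> for the variables of \<open>P\<^sup>2\<close>, and dehomogenization. They share the proof
  that they are homomorphisms.
\<close>

locale evaluation =
  fixes \<phi> :: "'c::comm_ring_1 \<Rightarrow> 'r::comm_ring_1" and \<mu> :: "'m::comm_monoid_add \<Rightarrow> 'r"
  assumes coeff_0: "\<phi> 0 = 0" and coeff_1: "\<phi> 1 = 1"
    and coeff_add: "\<phi> (a + b) = \<phi> a + \<phi> b" and coeff_mult: "\<phi> (a * b) = \<phi> a * \<phi> b"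
    and mon_0: "\<mu> 0 = 1" and mon_add: "\<mu> (m + n) = \<mu> m * \<mu> n"
begin

abbreviation ev :: "('m \<Rightarrow>\<^sub>0 'c) \<Rightarrow> 'r" where "ev \<equiv> evaluate \<phi> \<mu>"

lemma evaluate_superset:
  assumes "finite S" "Poly_Mapping.keys p \<subseteq> S"
  shows "ev p = (\<Sum>m\<in>S. \<phi> (Poly_Mapping.lookup p m) * \<mu> m)"
  unfolding evaluate_def using assms
  by (intro sum.mono_neutral_left) (auto simp: in_keys_iff coeff_0)

lemma evaluate_0: "ev 0 = 0"
  by (simp add: evaluate_def)

lemma evaluate_single: "ev (Poly_Mapping.single m c) = \<phi> c * \<mu> m"
  using evaluate_superset[of "{m}" "Poly_Mapping.single m c"] by (simp add: keys_single)

lemma evaluate_1: "ev 1 = 1"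
  using evaluate_single[of 0 1] by (simp add: coeff_1 mon_0)

lemma evaluate_add: "ev (p + q) = ev p + ev q"
proof -
  let ?S = "Poly_Mapping.keys p \<union> Poly_Mapping.keys q"
  have "Poly_Mapping.keys (p + q) \<subseteq> ?S" by (rule Poly_Mapping.keys_add)
  then show ?thesis
    by (simp add: evaluate_superset[of ?S] lookup_add coeff_add distrib_right sum.distrib)
qed

lemma evaluate_sum: "ev (sum f A) = (\<Sum>a\<in>A. ev (f a))"
  by (induction A rule: infinite_finite_induct) (simp_all add: evaluate_0 evaluate_add)

lemma evaluate_mult: "ev (p * q) = ev p * ev q"
proof -
  let ?P = "Poly_Mapping.keys p" and ?Q = "Poly_Mapping.keys q"
  have "p * q = (\<Sum>m\<in>?P. \<Sum>n\<in>?Q. Poly_Mapping.single (m + n)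
      (Poly_Mapping.lookup p m * Poly_Mapping.lookup q n))"
  proof -
    have "p * q = (\<Sum>m\<in>?P. Poly_Mapping.single m (Poly_Mapping.lookup p m)) *
        (\<Sum>n\<in>?Q. Poly_Mapping.single n (Poly_Mapping.lookup q n))"
      by (intro arg_cong2[where f = "(*)"] poly_mapping_sum_monomials) auto
    then show ?thesis unfolding sum_product mult_single .
  qed
  then have "ev (p * q) = (\<Sum>m\<in>?P. \<Sum>n\<in>?Q.
      \<phi> (Poly_Mapping.lookup p m * Poly_Mapping.lookup q n) * \<mu> (m + n))"
    by (simp add: evaluate_sum evaluate_single)
  also have "\<dots> = ev p * ev q"
    unfolding evaluate_def sum_product coeff_mult mon_add
    by (intro sum.cong refl) (simp only: mult_ac)
  finally show ?thesis .
qed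

lemma evaluate_uminus: "ev (- p) = - ev p"
proof -
  have "ev p + ev (- p) = 0" using evaluate_add[of p "- p"] by (simp add: evaluate_0)
  then show ?thesis by (rule minus_unique[symmetric])
qed

lemma evaluate_diff: "ev (p - q) = ev p - ev q"
  using evaluate_add[of p "- q"] by (simp add: evaluate_uminus)

lemma evaluate_power: "ev (p ^ n) = ev p ^ n"
  by (induction n) (simp_all add: evaluate_1 evaluate_mult)

end


lemma Const_0 [simp]: "Const 0 = 0"
  and Const_1 [simp]: "Const 1 = 1"
  and Const_add: "Const (a + b) = Const a + Const b"
  and Const_mult: "Const (a * b) = Const a * Const b"
  by (simp_all add: Const_def single_add mult_single)

interpretation xpoly: vector_space "\<lambda>(c::'k::field) (p::'k xpoly). Const c * p"
  by standard (simp_all only: Const_add Const_mult Const_1 distrib_left distrib_right mult.assoc mult_1)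

lemma lookup_Const_mult [simp]:
  fixes p :: "'k::field xpoly"
  shows "Poly_Mapping.lookup (Const c * p) m = c * Poly_Mapping.lookup p m"
proof -
  have "Poly_Mapping.lookup (Const c * p) m
      = (\<Sum>n\<in>Poly_Mapping.keys p. Poly_Mapping.lookup (Poly_Mapping.single n (c * Poly_Mapping.lookup p n)) m)"
    by (subst poly_mapping_sum_monomials[OF finite_keys subset_refl, of p])
      (simp only: Const_def sum_distrib_left mult_single lookup_sum add_0)
  also have "\<dots> = (\<Sum>n\<in>Poly_Mapping.keys p. if n = m then c * Poly_Mapping.lookup p n else 0)"
    by (intro sum.cong refl) (simp add: lookup_single when_def)
  also have "\<dots> = c * Poly_Mapping.lookup p m"
    by (auto simp: in_keys_iff)
  finally show ?thesis .
qed

section \<open>Bihomogeneous polynomials\<close>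

lemma deg_add: "deg1 (m + n) = deg1 m + deg1 n" "deg2 (m + n) = deg2 m + deg2 n"
  by (simp_all add: deg1_def deg2_def lookup_add)

lemma bihomogeneous_0: "bihomogeneous a b 0"
  by (simp add: bihomogeneous_def)

lemma bihomogeneous_add: "bihomogeneous a b p \<Longrightarrow> bihomogeneous a b q \<Longrightarrow> bihomogeneous a b (p + q)"
  unfolding bihomogeneous_def using Poly_Mapping.keys_add[of p q] by blast

lemma bihomogeneous_sum: "(\<And>i. i \<in> S \<Longrightarrow> bihomogeneous a b (f i)) \<Longrightarrow> bihomogeneous a b (sum f S)"
  by (induction S rule: infinite_finite_induct) (simp_all add: bihomogeneous_0 bihomogeneous_add)

lemma bihomogeneous_mult:
  assumes "bihomogeneous a b p" "bihomogeneous a' b' q"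
  shows "bihomogeneous (a + a') (b + b') (p * q)"
  unfolding bihomogeneous_def
proof
  fix m assume "m \<in> Poly_Mapping.keys (p * q)"
  then obtain k l where "m = k + l" "k \<in> Poly_Mapping.keys p" "l \<in> Poly_Mapping.keys q"
    using keys_mult[of p q] by blast
  with assms show "deg1 m = a + a' \<and> deg2 m = b + b'"
    by (simp add: bihomogeneous_def deg_add)
qed

lemma bihomogeneous_Const: "bihomogeneous 0 0 (Const c)"
  by (simp add: bihomogeneous_def Const_def deg1_def deg2_def)

lemma bihomogeneous_1: "bihomogeneous 0 0 1"
  using bihomogeneous_Const[of 1] by simp

lemma bihomogeneous_Const_mult: "bihomogeneous a b p \<Longrightarrow> bihomogeneous a b (Const c * p)"
  using bihomogeneous_mult[OF bihomogeneous_Const] by fastforce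

lemma bihomogeneous_power: "bihomogeneous a b p \<Longrightarrow> bihomogeneous (n * a) (n * b) (p ^ n)"
proof (induction n)
  case (Suc n)
  then show ?case using bihomogeneous_mult[of a b p "n * a" "n * b" "p ^ n"] by simp
qed (simp add: bihomogeneous_1)

lemma bihomogeneous_Var:
  "bihomogeneous 1 0 (Var X10)" "bihomogeneous 1 0 (Var X11)"
  "bihomogeneous 0 1 (Var X20)" "bihomogeneous 0 1 (Var X21)"
  by (simp_all add: bihomogeneous_def Var_def deg1_def deg2_def lookup_single)

lemma Var_nonzero [simp]: "(Var v :: 'k::field xpoly) \<noteq> 0"
proof
  assume "(Var v :: 'k xpoly) = 0"
  then have "Poly_Mapping.lookup (Var v :: 'k xpoly) (Poly_Mapping.single v 1) = 0" by simp
  then show False by (simp add: Var_def)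
qed

definition bidegree_monomials :: "nat \<Rightarrow> nat \<Rightarrow> (xvar \<Rightarrow>\<^sub>0 nat) set" where
  "bidegree_monomials a b = {m. deg1 m = a \<and> deg2 m = b}"

text \<open>
  The monomial of bidegree \<open>(a, b)\<close> that becomes \<open>x\<^sup>i y\<^sup>j\<close> in the affine coordinates
  \<open>x = x\<^sub>1\<^sub>,\<^sub>1/x\<^sub>1\<^sub>,\<^sub>0\<close> and \<open>y = x\<^sub>2\<^sub>,\<^sub>1/x\<^sub>2\<^sub>,\<^sub>0\<close>.
\<close>

definition affine_monomial :: "nat \<Rightarrow> nat \<Rightarrow> nat \<Rightarrow> nat \<Rightarrow> xvar \<Rightarrow>\<^sub>0 nat" where
  "affine_monomial a b i j = Poly_Mapping.single X10 (a - i) + Poly_Mapping.single X11 i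
     + Poly_Mapping.single X20 (b - j) + Poly_Mapping.single X21 j"

lemma lookup_affine_monomial [simp]:
  "Poly_Mapping.lookup (affine_monomial a b i j) X10 = a - i"
  "Poly_Mapping.lookup (affine_monomial a b i j) X11 = i"
  "Poly_Mapping.lookup (affine_monomial a b i j) X20 = b - j"
  "Poly_Mapping.lookup (affine_monomial a b i j) X21 = j"
  by (simp_all add: affine_monomial_def lookup_add lookup_single)

lemma affine_monomial_in: "i \<le> a \<Longrightarrow> j \<le> b \<Longrightarrow> affine_monomial a b i j \<in> bidegree_monomials a b"
  by (simp add: bidegree_monomials_def deg1_def deg2_def)

lemma affine_monomial_lookup:
  assumes "m \<in> bidegree_monomials a b"
  shows "affine_monomial a b (Poly_Mapping.lookup m X11) (Poly_Mapping.lookup m X21) = m"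
    and "Poly_Mapping.lookup m X11 \<le> a" "Poly_Mapping.lookup m X21 \<le> b"
proof -
  show "affine_monomial a b (Poly_Mapping.lookup m X11) (Poly_Mapping.lookup m X21) = m"
  proof (rule poly_mapping_eqI)
    fix v show "Poly_Mapping.lookup (affine_monomial a b (Poly_Mapping.lookup m X11)
        (Poly_Mapping.lookup m X21)) v = Poly_Mapping.lookup m v"
      using assms by (cases v) (auto simp: bidegree_monomials_def deg1_def deg2_def)
  qed
qed (use assms in \<open>auto simp: bidegree_monomials_def deg1_def deg2_def\<close>)

lemma bij_bidegree_monomials:
  "bij_betw (\<lambda>(i, j). affine_monomial a b i j) ({..a} \<times> {..b}) (bidegree_monomials a b)"
  by (rule bij_betw_byWitness[where f' = "\<lambda>m. (Poly_Mapping.lookup m X11, Poly_Mapping.lookup m X21)"])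
    (auto simp: affine_monomial_lookup affine_monomial_in)

lemma finite_bidegree_monomials: "finite (bidegree_monomials a b)"
  and card_bidegree_monomials: "card (bidegree_monomials a b) = (a + 1) * (b + 1)"
  using bij_betw_finite[OF bij_bidegree_monomials] bij_betw_same_card[OF bij_bidegree_monomials, of a b]
  by (simp_all add: card_cartesian_product)

lemma bihomogeneous_iff_keys: "bihomogeneous a b p \<longleftrightarrow> Poly_Mapping.keys p \<subseteq> bidegree_monomials a b"
  by (auto simp: bihomogeneous_def bidegree_monomials_def)

lemma bihomogeneous_dependent:
  fixes g :: "'u \<Rightarrow> 'k::field xpoly"
  assumes "finite U" "card U > (a + 1) * (b + 1)" "\<And>u. u \<in> U \<Longrightarrow> bihomogeneous a b (g u)"
  shows "\<exists>x. (\<exists>u\<in>U. x u \<noteq> 0) \<and> (\<Sum>u\<in>U. Const (x u) * g u) = 0"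
proof -
  obtain x where x: "\<exists>u\<in>U. x u \<noteq> 0"
    "\<forall>m\<in>bidegree_monomials a b. (\<Sum>u\<in>U. Poly_Mapping.lookup (g u) m * x u) = 0"
    using underdetermined_system_solvable[OF subfield_UNIV finite_bidegree_monomials[of a b] assms(1),
        where A = "\<lambda>m u. Poly_Mapping.lookup (g u) m"] assms(2)
    unfolding card_bidegree_monomials by auto
  have "(\<Sum>u\<in>U. Const (x u) * g u) = 0"
  proof (rule poly_mapping_eqI)
    fix m
    have "(\<Sum>u\<in>U. x u * Poly_Mapping.lookup (g u) m) = 0"
    proof (cases "m \<in> bidegree_monomials a b")
      case True
      then show ?thesis using x(2) by (simp only: mult.commute)
    next
      case False
      then have "Poly_Mapping.lookup (g u) m = 0" if "u \<in> U" for u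
        using assms(3)[OF that] by (auto simp: bihomogeneous_iff_keys in_keys_iff)
      then show ?thesis by simp
    qed
    then show "Poly_Mapping.lookup (\<Sum>u\<in>U. Const (x u) * g u) m = Poly_Mapping.lookup 0 m"
      by (simp add: lookup_sum)
  qed
  with x(1) show ?thesis by blast
qed

lemma subspace_bihomogeneous: "xpoly.subspace {p. bihomogeneous a b p}"
  by (rule xpoly.subspaceI) (auto simp: bihomogeneous_0 bihomogeneous_add bihomogeneous_Const_mult)

lemma dim_bihomogeneous_ge:
  assumes "xpoly.independent B" "{p. bihomogeneous a b p} \<subseteq> xpoly.span (B :: 'k::field xpoly set)" "finite B"
  shows "(a + 1) * (b + 1) \<le> card B"
proof -
  let ?s = "\<lambda>m. Poly_Mapping.single m (1::'k)"
  let ?S = "?s ` bidegree_monomials a b"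
  have inj: "inj_on ?s (bidegree_monomials a b)"
    by (rule inj_onI) (metis lookup_single_eq lookup_single_not_eq zero_neq_one)
  have "xpoly.independent ?S"
  proof (rule xpoly.independent_if_scalars_zero)
    show "finite ?S" by (simp add: finite_bidegree_monomials)
    fix c x assume sum: "(\<Sum>x\<in>?S. Const (c x) * x) = 0" and x: "x \<in> ?S"
    then obtain m where m: "m \<in> bidegree_monomials a b" "x = ?s m" by auto
    have "0 = Poly_Mapping.lookup (\<Sum>x\<in>?S. Const (c x) * x) m" using sum by simp
    also have "\<dots> = (\<Sum>n\<in>bidegree_monomials a b. if n = m then c (?s n) else 0)"
      unfolding sum.reindex[OF inj] lookup_sum o_def lookup_Const_mult
      by (intro sum.cong refl) (auto simp: lookup_single when_def)
    also have "\<dots> = c x" using m by (simp add: finite_bidegree_monomials)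
    finally show "c x = 0" by simp
  qed
  moreover have "?S \<subseteq> xpoly.span B"
    using assms(2) by (auto simp: bihomogeneous_iff_keys)
  ultimately have "card ?S \<le> card B"
    using xpoly.independent_span_bound[OF assms(3)] by blast
  then show ?thesis by (simp add: card_image[OF inj] card_bidegree_monomials)
qed

section \<open>Ideals and saturation\<close>

lemma ideal_closed:
  assumes "ideal.subspace J"
  shows "0 \<in> J" "p \<in> J \<Longrightarrow> q \<in> J \<Longrightarrow> p + q \<in> J" "p \<in> J \<Longrightarrow> r * p \<in> J"
    "p \<in> J \<Longrightarrow> p * r \<in> J" "p \<in> J \<Longrightarrow> q \<in> J \<Longrightarrow> p - q \<in> J"
    "(\<And>i. i \<in> S \<Longrightarrow> f i \<in> J) \<Longrightarrow> sum f S \<in> J"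
  using assms ideal.subspace_0 ideal.subspace_add ideal.subspace_scale[of J p] ideal.subspace_diff
     ideal.subspace_sum[of J S f]
  by (auto simp: mult.commute[of p])

lemma ideal_span3:
  fixes f0 f1 f2 :: "'a::comm_ring_1"
  shows "p \<in> ideal.span {f0, f1, f2} \<longleftrightarrow> (\<exists>a b c. p = a * f0 + b * f1 + c * f2)"
proof
  have "ideal.subspace {a * f0 + b * f1 + c * f2 | a b c. True}"
  proof (rule ideal.subspaceI)
    show "0 \<in> {a * f0 + b * f1 + c * f2 | a b c. True}"
      by (intro CollectI exI[of _ 0]) simp
  next
    fix x y assume "x \<in> {a * f0 + b * f1 + c * f2 | a b c. True}" "y \<in> {a * f0 + b * f1 + c * f2 | a b c. True}"
    then obtain a b c a' b' c' where "x = a * f0 + b * f1 + c * f2" "y = a' * f0 + b' * f1 + c' * f2"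
      by blast
    then have "x + y = (a + a') * f0 + (b + b') * f1 + (c + c') * f2" by (simp add: algebra_simps)
    then show "x + y \<in> {a * f0 + b * f1 + c * f2 | a b c. True}" by blast
  next
    fix r x assume "x \<in> {a * f0 + b * f1 + c * f2 | a b c. True}"
    then obtain a b c where "x = a * f0 + b * f1 + c * f2" by blast
    then have "r * x = (r * a) * f0 + (r * b) * f1 + (r * c) * f2" by (simp add: algebra_simps)
    then show "r * x \<in> {a * f0 + b * f1 + c * f2 | a b c. True}" by blast
  qed
  moreover have "f0 = 1 * f0 + 0 * f1 + 0 * f2" "f1 = 0 * f0 + 1 * f1 + 0 * f2" "f2 = 0 * f0 + 0 * f1 + 1 * f2"
    by simp_all
  then have "{f0, f1, f2} \<subseteq> {a * f0 + b * f1 + c * f2 | a b c. True}" by blast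
  ultimately have "ideal.span {f0, f1, f2} \<subseteq> {a * f0 + b * f1 + c * f2 | a b c. True}"
    by (rule ideal.span_minimal[rotated])
  then show "p \<in> ideal.span {f0, f1, f2} \<Longrightarrow> \<exists>a b c. p = a * f0 + b * f1 + c * f2" by blast
next
  assume "\<exists>a b c. p = a * f0 + b * f1 + c * f2"
  then show "p \<in> ideal.span {f0, f1, f2}"
    by (metis ideal.span_add ideal.span_scale ideal.span_base insertCI)
qed

lemma ideal_power_subspace: "ideal.subspace (ideal_power J n)"
  by (cases n) (simp_all add: ideal.subspace_UNIV ideal.subspace_span)

lemma ideal_power_add: "ideal_power J (n + k) \<subseteq> ideal_power J n"
proof (induction k)
  case (Suc k)
  have "ideal_power J (Suc (n + k)) \<subseteq> ideal_power J (n + k)"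
    unfolding ideal_power.simps
    by (rule ideal.span_minimal) (auto simp: ideal_power_subspace ideal_closed(3))
  with Suc show ?case by simp
qed simp

lemma ideal_subset_saturation:
  assumes "ideal.subspace I" shows "I \<subseteq> saturation I"
  using ideal_closed(4)[OF assms] by (auto simp: saturation_def)

lemma saturation_subspace:
  assumes I: "ideal.subspace I"
  shows "ideal.subspace (saturation I)"
proof (rule ideal.subspaceI)
  show "0 \<in> saturation I" using ideal_subset_saturation[OF I] ideal_closed(1)[OF I] by blast
next
  fix x y assume "x \<in> saturation I" "y \<in> saturation I"
  then obtain n k where n: "\<forall>q\<in>ideal_power irrelevant n. x * q \<in> I" "\<forall>q\<in>ideal_power irrelevant k. y * q \<in> I"
    by (auto simp: saturation_def)
  have "(x + y) * q \<in> I" if "q \<in> ideal_power irrelevant (n + k)" for q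
    using that n ideal_power_add[of irrelevant n k] ideal_power_add[of irrelevant k n]
    by (auto simp: distrib_right add.commute[of n k] intro!: ideal_closed(2)[OF I])
  then show "x + y \<in> saturation I" by (auto simp: saturation_def)
next
  fix r x assume "x \<in> saturation I"
  then show "r * x \<in> saturation I"
    using ideal_closed(3)[OF I] by (auto simp: saturation_def mult.assoc)
qed

text \<open>
  A saturated ideal has no torsion with respect to either pair of variables: if \<open>z p\<close> and \<open>w p\<close> are
  killed by a power of the irrelevant ideal modulo \<open>I\<close>, then one more factor from that ideal, which
  is a combination of \<open>z\<close> and \<open>w\<close>, kills \<open>p\<close>.
\<close>

lemma saturation_torsion_free:
  fixes I :: "'k::field xpoly set"
  assumes I: "ideal.subspace I"
    and irr: "\<And>q. q \<in> irrelevant \<Longrightarrow> \<exists>q1 q2. q = z * q1 + w * q2"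
    and p: "z * p \<in> saturation I" "w * p \<in> saturation I"
  shows "p \<in> saturation I"
proof -
  obtain n k where n: "\<forall>q\<in>ideal_power irrelevant n. z * p * q \<in> I" "\<forall>q\<in>ideal_power irrelevant k. w * p * q \<in> I"
    using p by (auto simp: saturation_def)
  have "ideal_power irrelevant (Suc (n + k)) \<subseteq> {q. p * q \<in> I}"
    unfolding ideal_power.simps
  proof (rule ideal.span_minimal)
    show "ideal.subspace {q. p * q \<in> I}"
      using ideal_closed[OF I]
      by (intro ideal.subspaceI) (auto simp: distrib_left mult.left_commute)
    show "{a * b |a b. a \<in> irrelevant \<and> b \<in> ideal_power irrelevant (n + k)} \<subseteq> {q. p * q \<in> I}"
    proof clarify
      fix a b :: "'k xpoly" assume a: "a \<in> irrelevant" and b: "b \<in> ideal_power irrelevant (n + k)"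
      obtain q1 q2 where q: "a = z * q1 + w * q2" using irr[OF a] by blast
      have "b \<in> ideal_power irrelevant n" "b \<in> ideal_power irrelevant k"
        using b ideal_power_add[of irrelevant n k] ideal_power_add[of irrelevant k n]
        by (auto simp: add.commute)
      then have "q1 * (z * p * b) + q2 * (w * p * b) \<in> I"
        using n by (auto intro!: ideal_closed(2)[OF I ideal_closed(3)[OF I] ideal_closed(3)[OF I]])
      then show "p * (a * b) \<in> I" by (simp add: q algebra_simps)
    qed
  qed
  then show ?thesis unfolding saturation_def by blast
qed

lemma Var_dvd_iff_keys:
  fixes p :: "'k::field xpoly"
  assumes "\<And>m. m \<in> Poly_Mapping.keys p \<Longrightarrow> Poly_Mapping.lookup m v > 0"
  shows "\<exists>q. p = Var v * q"
proof -
  have *: "m = Poly_Mapping.single v 1 + (m - Poly_Mapping.single v 1)"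
    if "m \<in> Poly_Mapping.keys p" for m
    using assms[OF that]
    by (intro poly_mapping_eqI) (auto simp: lookup_add lookup_minus lookup_single when_def)
  have "p = (\<Sum>m\<in>Poly_Mapping.keys p. Poly_Mapping.single m (Poly_Mapping.lookup p m))"
    by (rule poly_mapping_sum_monomials) auto
  also have "\<dots> = (\<Sum>m\<in>Poly_Mapping.keys p. Var v * Poly_Mapping.single (m - Poly_Mapping.single v 1) (Poly_Mapping.lookup p m))"
    using * by (intro sum.cong refl) (simp add: Var_def mult_single)
  also have "\<dots> = Var v * (\<Sum>m\<in>Poly_Mapping.keys p. Poly_Mapping.single (m - Poly_Mapping.single v 1) (Poly_Mapping.lookup p m))"
    by (simp only: sum_distrib_left)
  finally show ?thesis by blast
qed

lemma two_Var_split: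
  fixes p :: "'k::field xpoly"
  assumes "\<And>m. m \<in> Poly_Mapping.keys p \<Longrightarrow> Poly_Mapping.lookup m v + Poly_Mapping.lookup m w > 0"
  shows "\<exists>q1 q2. p = Var v * q1 + Var w * q2"
proof -
  let ?A = "{m \<in> Poly_Mapping.keys p. Poly_Mapping.lookup m v > 0}"
  let ?B = "Poly_Mapping.keys p - ?A"
  let ?s = "\<lambda>m. Poly_Mapping.single m (Poly_Mapping.lookup p m)"
  have keys: "Poly_Mapping.keys (sum ?s S) \<subseteq> S" for S
    using keys_sum[of ?s S] by (auto split: if_splits)
  have "\<exists>q. sum ?s ?A = Var v * q"
    by (rule Var_dvd_iff_keys) (use keys[of ?A] in blast)
  moreover have "\<exists>q. sum ?s ?B = Var w * q"
    by (rule Var_dvd_iff_keys) (use keys[of ?B] assms in fastforce)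
  moreover have "p = sum ?s (Poly_Mapping.keys p)"
    by (rule poly_mapping_sum_monomials) auto
  then have "p = sum ?s ?B + sum ?s ?A"
    by (subst (asm) sum.subset_diff[of ?A]) auto
  ultimately show ?thesis by (metis add.commute)
qed

lemma irrelevant_split:
  assumes "p \<in> irrelevant"
  shows "\<exists>q1 q2. p = Var X10 * q1 + Var X11 * q2" "\<exists>q1 q2. p = Var X20 * q1 + Var X21 * q2"
  using assms by (auto simp: irrelevant_def deg1_def deg2_def intro!: two_Var_split)


section \<open>Growth of the Hilbert function modulo a saturated ideal\<close>

definition independent_mod :: "'k::field xpoly set \<Rightarrow> ('i \<Rightarrow> 'k xpoly) \<Rightarrow> 'i set \<Rightarrow> bool" where
  "independent_mod J q S \<longleftrightarrow> (\<forall>c. (\<Sum>s\<in>S. Const (c s) * q s) \<in> J \<longrightarrow> (\<forall>s\<in>S. c s = 0))"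

lemma independent_mod_mono: "independent_mod J q S \<Longrightarrow> I \<subseteq> J \<Longrightarrow> independent_mod I q S"
  by (auto simp: independent_mod_def)

lemma independent_mod_inj_independent:
  assumes "finite S" "independent_mod J q S" "0 \<in> J"
  shows "inj_on q S" "xpoly.independent (q ` S)"
proof -
  show inj: "inj_on q S"
  proof (rule inj_onI, rule ccontr)
    fix s t assume st: "s \<in> S" "t \<in> S" "q s = q t" "s \<noteq> t"
    define c :: "'a \<Rightarrow> 'b" where "c = (\<lambda>u. if u = s then 1 else if u = t then - 1 else 0)"
    have "(\<Sum>u\<in>S. Const (c u) * q u) = (\<Sum>u\<in>{s, t}. Const (c u) * q u)"
      using st assms(1) by (intro sum.mono_neutral_right) (auto simp: c_def)
    also have "\<dots> = 0" using st by (simp add: c_def flip: distrib_right Const_add)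
    finally have "c s = 0" using assms(2,3) st by (auto simp: independent_mod_def)
    then show False by (simp add: c_def)
  qed
  show "xpoly.independent (q ` S)"
  proof (rule xpoly.independent_if_scalars_zero)
    show "finite (q ` S)" using assms by simp
    fix c x assume sum: "(\<Sum>x\<in>q ` S. Const (c x) * x) = 0" and x: "x \<in> q ` S"
    have "(\<Sum>s\<in>S. Const ((c \<circ> q) s) * q s) \<in> J"
      using sum assms(3) by (simp add: sum.reindex[OF inj])
    then have "\<forall>s\<in>S. (c \<circ> q) s = 0"
      using assms(2) unfolding independent_mod_def by blast
    then show "c x = 0" using x by auto
  qed
qed

lemma span_image_finite:
  assumes "finite S" "x \<in> xpoly.span (q ` S)"
  shows "\<exists>c. x = (\<Sum>s\<in>S. Const (c s) * q s)"
  using assms(2)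
proof (induction rule: xpoly.span_induct_alt)
  case base
  show ?case by (intro exI[of _ "\<lambda>_. 0"]) simp
next
  case (step a x y)
  then obtain c s where "y = (\<Sum>s\<in>S. Const (c s) * q s)" "s \<in> S" "x = q s" by auto
  moreover have "(\<Sum>u\<in>S. Const (if u = s then a else 0) * q u) = Const a * q s"
  proof -
    have "(\<Sum>u\<in>S. Const (if u = s then a else 0) * q u) = (\<Sum>u\<in>S. if u = s then Const a * q s else 0)"
      by (intro sum.cong refl) auto
    then show ?thesis using \<open>s \<in> S\<close> assms(1) by simp
  qed
  ultimately have "Const a * x + y = (\<Sum>u\<in>S. Const ((if u = s then a else 0) + c u) * q u)"
    by (simp add: Const_add distrib_right sum.distrib)
  then show ?case by (rule exI[of "\<lambda>c. Const a * x + y = (\<Sum>s\<in>S. Const (c s) * q s)"])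
qed

text \<open>
  If \<open>z\<close> or \<open>w\<close>, or a combination of them, were a nonzerodivisor modulo \<open>J\<close>, multiplication by it would
  do. In general let \<open>\<Gamma>\<close> be the elements that a power of \<open>w\<close> moves into \<open>J\<close>. Multiplication by \<open>z\<close> is
  injective on \<open>\<Gamma>/J\<close>, since an element of its kernel is torsion for both \<open>z\<close> and \<open>w\<close>, and
  multiplication by \<open>w\<close> is injective modulo \<open>\<Gamma>\<close>. So a basis is adapted to \<open>\<Gamma>\<close>, and its part inside \<open>\<Gamma>\<close>
  is multiplied by \<open>z\<close>, the rest by \<open>w\<close>.
\<close>

lemma independent_mod_growth:
  fixes z w :: "'k::field xpoly"
  assumes J: "ideal.subspace J"
    and torsion_free: "\<And>p. z * p \<in> J \<Longrightarrow> w * p \<in> J \<Longrightarrow> p \<in> J"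
    and V: "xpoly.subspace V"
    and q: "independent_mod J q {..<r}" "\<And>i. i < (r::nat) \<Longrightarrow> q i \<in> V"
  shows "\<exists>q'. independent_mod J q' {..<r} \<and> (\<forall>i<r. \<exists>v\<in>V. q' i = z * v \<or> q' i = w * v)"
proof -
  define T where "T = xpoly.span (q ` {..<r})"
  define \<Gamma> where "\<Gamma> = {p. \<exists>n. w ^ n * p \<in> J}"
  note closed = ideal_closed[OF J]
  have T_V: "T \<subseteq> V" unfolding T_def using q(2) V by (intro xpoly.span_minimal) auto
  have T_J: "x = 0" if xT: "x \<in> T" and xJ: "x \<in> J" for x
  proof -
    obtain c where c: "x = (\<Sum>i<r. Const (c i) * q i)"
      using span_image_finite[OF finite_lessThan xT[unfolded T_def]] by blast
    then have "c i = 0" if "i < r" for i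
      using q(1) \<open>x \<in> J\<close> that unfolding independent_mod_def by auto
    then show "x = 0" using c by simp
  qed
  have \<Gamma>_torsion: "p \<in> J" if p: "p \<in> \<Gamma>" and zp: "z * p \<in> J" for p
  proof -
    obtain n where "w ^ n * p \<in> J" using p by (auto simp: \<Gamma>_def)
    then show ?thesis
    proof (induction n)
      case (Suc n)
      have "z * (w ^ n * p) \<in> J" using closed(3)[OF zp, of "w ^ n"] by (simp add: mult_ac)
      moreover have "w * (w ^ n * p) \<in> J" using Suc.prems by (simp add: mult_ac)
      ultimately have "w ^ n * p \<in> J" by (rule torsion_free)
      then show ?case by (rule Suc.IH)
    qed simp
  qed
  have \<Gamma>_subspace: "xpoly.subspace \<Gamma>"
  proof (rule xpoly.subspaceI)
    show "0 \<in> \<Gamma>" using closed(1) by (auto simp: \<Gamma>_def)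
    fix x y assume "x \<in> \<Gamma>" "y \<in> \<Gamma>"
    then obtain n k where "w ^ n * x \<in> J" "w ^ k * y \<in> J" by (auto simp: \<Gamma>_def)
    then have "w ^ k * (w ^ n * x) + w ^ n * (w ^ k * y) \<in> J" 
      by (auto intro!: closed(2)[OF closed(3) closed(3)])
    then have "w ^ (n + k) * (x + y) \<in> J" by (simp add: power_add algebra_simps)
    then show "x + y \<in> \<Gamma>" by (auto simp: \<Gamma>_def)
  next
    fix c x assume "x \<in> \<Gamma>"
    then obtain n where "w ^ n * x \<in> J" by (auto simp: \<Gamma>_def)
    then have "w ^ n * (Const c * x) \<in> J" using closed(3)[of "w ^ n * x" "Const c"] by (simp add: mult_ac)
    then show "Const c * x \<in> \<Gamma>" by (auto simp: \<Gamma>_def)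
  qed
  obtain B1 where B1: "B1 \<subseteq> T \<inter> \<Gamma>" "xpoly.independent B1" "T \<inter> \<Gamma> \<subseteq> xpoly.span B1"
    by (rule xpoly.maximal_independent_subset)
  obtain B where B: "B1 \<subseteq> B" "B \<subseteq> T" "xpoly.independent B" "T \<subseteq> xpoly.span B"
    using xpoly.maximal_independent_subset_extend[of B1 T] B1 by auto
  have fin: "finite B"
    using xpoly.independent_span_bound[of "q ` {..<r}" B] B by (auto simp: T_def)
  have "card B = xpoly.dim T"
    using B by (intro xpoly.basis_card_eq_dim) auto
  also have "\<dots> = card (q ` {..<r})"
    unfolding T_def
    using independent_mod_inj_independent[of "{..<r}" J q] q closed(1)
    by (subst xpoly.dim_span_eq_card_independent) auto
  also have "\<dots> = r"
    using independent_mod_inj_independent[of "{..<r}" J q] q closed(1) by (simp add: card_image)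
  finally obtain h where h: "bij_betw h {..<r} B"
    using ex_bij_betw_nat_finite[OF fin] by (auto simp: atLeast0LessThan)
  define g where "g b = (if b \<in> B1 then z * b else w * b)" for b
  have "independent_mod J (g \<circ> h) {..<r}"
    unfolding independent_mod_def
  proof (intro allI impI)
    fix c assume c: "(\<Sum>s<r. Const (c s) * (g \<circ> h) s) \<in> J"
    define d where "d = c \<circ> inv_into {..<r} h"
    have dh: "d (h s) = c s" if "s < r" for s
      using h that by (simp add: d_def bij_betw_inv_into_left)
    have "(\<Sum>b\<in>B. Const (d b) * g b) = (\<Sum>s<r. Const (c s) * (g \<circ> h) s)"
      using dh by (subst sum.reindex_bij_betw[OF h, symmetric]) auto
    with c have dJ: "(\<Sum>b\<in>B. Const (d b) * g b) \<in> J" by simp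
    define u where "u = (\<Sum>b\<in>B1. Const (d b) * b)"
    define v where "v = (\<Sum>b\<in>B - B1. Const (d b) * b)"
    have split: "(\<Sum>b\<in>B. f b) = (\<Sum>b\<in>B1. f b) + (\<Sum>b\<in>B - B1. f b)" for f :: "_ \<Rightarrow> 'k xpoly"
      using sum.subset_diff[OF B(1) fin, of f] by (simp add: add.commute)
    have "(\<Sum>b\<in>B. Const (d b) * g b) = z * u + w * v"
      unfolding split u_def v_def sum_distrib_left
      by (intro arg_cong2[where f = "(+)"] sum.cong refl) (auto simp: g_def mult_ac)
    with dJ have zw: "z * u + w * v \<in> J" by simp
    have uT: "u \<in> T" and vT: "v \<in> T" and u\<Gamma>: "u \<in> \<Gamma>"
      unfolding u_def v_def using B B1 \<Gamma>_subspace unfolding T_def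
      by (auto intro!: xpoly.span_sum xpoly.span_scale xpoly.subspace_sum xpoly.subspace_scale)
    then obtain n where n: "w ^ n * u \<in> J" by (auto simp: \<Gamma>_def)
    have "w ^ n * (z * u + w * v) - z * (w ^ n * u) \<in> J"
      using n zw by (intro closed(5)[OF closed(3) closed(3)])
    then have "w ^ Suc n * v \<in> J" by (simp add: algebra_simps)
    then have "v \<in> \<Gamma>" unfolding \<Gamma>_def by blast
    then have "v \<in> xpoly.span B1" using vT B1 by auto
    then obtain e where e: "v = (\<Sum>b\<in>B1. Const (e b) * b)"
      using span_image_finite[of B1 v "\<lambda>b. b"] finite_subset[OF B(1) fin] by auto
    have "(\<Sum>b\<in>B. Const (if b \<in> B1 then e b else - d b) * b) = 0"
    proof -
      have "Const (- d b) = - Const (d b)" for b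
        by (simp add: Const_def single_uminus)
      then have "(\<Sum>b\<in>B. Const (if b \<in> B1 then e b else - d b) * b) = v - v"
        unfolding split by (subst (2) v_def, subst e) (simp add: sum_negf)
      then show ?thesis by simp
    qed
    then have "(if b \<in> B1 then e b else - d b) = 0" if "b \<in> B" for b
      using xpoly.independentD[OF B(3) fin subset_refl _ that, of "\<lambda>b. if b \<in> B1 then e b else - d b"]
      by blast
    then have d2: "d b = 0" if "b \<in> B - B1" for b using that by fastforce
    then have "v = 0" unfolding v_def by simp
    then have "u \<in> J" using \<Gamma>_torsion[OF u\<Gamma>] zw by simp
    then have "u = 0" using T_J uT by blast
    then have d1: "d b = 0" if "b \<in> B1" for b
      using xpoly.independentD[OF B1(2) finite_subset[OF B(1) fin] subset_refl _ that, of d]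
      unfolding u_def by blast
    have "d (h s) = 0" if "s < r" for s
      using d1 d2 h that by (metis DiffI bij_betwE lessThan_iff)
    then show "\<forall>s\<in>{..<r}. c s = 0" using dh by auto
  qed
  moreover have "h i \<in> V" if "i < r" for i
    using h that B(2) T_V by (auto dest: bij_betwE)
  ultimately show ?thesis
    by (intro exI[of _ "g \<circ> h"]) (auto simp: g_def)
qed

lemma independent_mod_saturation_growth:
  fixes I :: "'k::field xpoly set"
  assumes I: "ideal.subspace I"
    and q: "independent_mod (saturation I) q {..<r}" "\<And>i. i < (r::nat) \<Longrightarrow> bihomogeneous a b (q i)"
  shows "\<exists>q'. independent_mod (saturation I) q' {..<r} \<and> (\<forall>i<r. bihomogeneous (a + k) (b + l) (q' i))"
proof -
  note J = saturation_subspace[OF I]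
  have step1: "\<exists>q'. independent_mod (saturation I) q' {..<r} \<and> (\<forall>i<r. bihomogeneous (Suc a) b (q' i))"
    if q: "independent_mod (saturation I) q {..<r}" "\<forall>i<r. bihomogeneous a b (q i)" for a b q
  proof -
    have "bihomogeneous (Suc a) b (Var X10 * v)" "bihomogeneous (Suc a) b (Var X11 * v)"
      if "bihomogeneous a b v" for v :: "'k xpoly"
      using bihomogeneous_mult[OF bihomogeneous_Var(1) that] bihomogeneous_mult[OF bihomogeneous_Var(2) that]
      by simp_all
    moreover have "\<exists>q'. independent_mod (saturation I) q' {..<r} \<and>
      (\<forall>i<r. \<exists>v\<in>{p. bihomogeneous a b p}. q' i = Var X10 * v \<or> q' i = Var X11 * v)"
      by (rule independent_mod_growth[OF J saturation_torsion_free[OF I irrelevant_split(1)]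
            subspace_bihomogeneous q(1)]) (use q in auto)
    ultimately show ?thesis by (metis mem_Collect_eq)
  qed
  have step2: "\<exists>q'. independent_mod (saturation I) q' {..<r} \<and> (\<forall>i<r. bihomogeneous a (Suc b) (q' i))"
    if q: "independent_mod (saturation I) q {..<r}" "\<forall>i<r. bihomogeneous a b (q i)" for a b q
  proof -
    have "bihomogeneous a (Suc b) (Var X20 * v)" "bihomogeneous a (Suc b) (Var X21 * v)"
      if "bihomogeneous a b v" for v :: "'k xpoly"
      using bihomogeneous_mult[OF bihomogeneous_Var(3) that] bihomogeneous_mult[OF bihomogeneous_Var(4) that]
      by simp_all
    moreover have "\<exists>q'. independent_mod (saturation I) q' {..<r} \<and>
      (\<forall>i<r. \<exists>v\<in>{p. bihomogeneous a b p}. q' i = Var X20 * v \<or> q' i = Var X21 * v)"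
      by (rule independent_mod_growth[OF J saturation_torsion_free[OF I irrelevant_split(2)]
            subspace_bihomogeneous q(1)]) (use q in auto)
    ultimately show ?thesis by (metis mem_Collect_eq)
  qed
  have "\<exists>q'. independent_mod (saturation I) q' {..<r} \<and> (\<forall>i<r. bihomogeneous (a + k) b (q' i))"
  proof (induction k)
    case 0
    show ?case using q by auto
  next
    case (Suc k)
    then show ?case using step1[of _ "a + k" b] by (metis add_Suc_right)
  qed
  then show ?thesis
  proof (induction l)
    case 0
    then show ?case by simp
  next
    case (Suc l)
    then show ?case using step2[of _ "a + k" "b + l"] by (metis add_Suc_right)
  qed
qed

text \<open>
  Independence modulo \<open>J\<close> over the ground field is turned into linear functionals because those
  extend to polynomials with coefficients in a larger field.
\<close>

lemma functional_dual_mod: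
  fixes J :: "'k::field xpoly set"
  assumes J: "ideal.subspace J" and S: "finite S" "independent_mod J q S" and s: "s \<in> S"
  shows "\<exists>\<psi>. (\<forall>x y. \<psi> (x + y) = \<psi> x + \<psi> y) \<and> (\<forall>c x. \<psi> (Const c * x) = c * \<psi> x) \<and>
    (\<forall>x\<in>J. \<psi> x = (0::'k)) \<and> (\<forall>t\<in>S. \<psi> (q t) = (if t = s then 1 else 0))"
proof -
  interpret pair: vector_space_pair "\<lambda>(c::'k) (p::'k xpoly). Const c * p" "(*) :: 'k \<Rightarrow> 'k \<Rightarrow> 'k"
    by (unfold_locales) (simp_all add: algebra_simps)
  have Jsub: "xpoly.subspace J"
    using ideal_closed[OF J] by (intro xpoly.subspaceI) auto
  obtain BJ where BJ: "BJ \<subseteq> J" "xpoly.independent BJ" "J \<subseteq> xpoly.span BJ"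
    by (rule xpoly.maximal_independent_subset)
  note inj = independent_mod_inj_independent[OF S ideal_closed(1)[OF J]]
  have disj: "q t \<notin> BJ" if "t \<in> S" for t
  proof
    assume "q t \<in> BJ"
    have "(\<Sum>u\<in>S. Const (if u = t then 1 else 0) * q u) = (\<Sum>u\<in>S. if u = t then q t else 0)"
      by (intro sum.cong refl) auto
    also have "\<dots> = q t" using that S(1) by simp
    finally have "(\<Sum>u\<in>S. Const (if u = t then 1 else 0) * q u) \<in> J" 
      using \<open>q t \<in> BJ\<close> BJ by auto
    then have "\<forall>u\<in>S. (if u = t then 1 else (0::'k)) = 0" 
      using S(2)[unfolded independent_mod_def, rule_format, of "\<lambda>u. if u = t then 1 else 0"] by blast
    with that show False by auto
  qed
  have "xpoly.independent (BJ \<union> q ` S)"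
    unfolding xpoly.independent_explicit_finite_subsets
  proof (intro allI impI ballI)
    fix A c x assume A: "A \<subseteq> BJ \<union> q ` S" "finite A" "(\<Sum>v\<in>A. Const (c v) * v) = 0" and x: "x \<in> A"
    define d where "d t = (if q t \<in> A then c (q t) else 0)" for t
    have Asplit: "(\<Sum>v\<in>A. Const (c v) * v) = (\<Sum>v\<in>A \<inter> BJ. Const (c v) * v) + (\<Sum>v\<in>A \<inter> q ` S. Const (c v) * v)"
    proof -
      have "A = (A \<inter> BJ) \<union> (A \<inter> q ` S)" using A(1) by blast
      then have "(\<Sum>v\<in>A. Const (c v) * v) = (\<Sum>v\<in>(A \<inter> BJ) \<union> (A \<inter> q ` S). Const (c v) * v)"
        by (rule arg_cong)
      also have "\<dots> = (\<Sum>v\<in>A \<inter> BJ. Const (c v) * v) + (\<Sum>v\<in>A \<inter> q ` S. Const (c v) * v)"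
        using disj A(2) by (intro sum.union_disjoint) auto
      finally show ?thesis .
    qed
    have "(\<Sum>t\<in>S. Const (d t) * q t) = (\<Sum>v\<in>q ` S. Const (if v \<in> A then c v else 0) * v)"
      by (simp add: sum.reindex[OF inj(1)] d_def)
    also have "\<dots> = (\<Sum>v\<in>A \<inter> q ` S. Const (c v) * v)"
      using S(1) by (intro sum.mono_neutral_cong_right) auto
    also have "\<dots> = - (\<Sum>v\<in>A \<inter> BJ. Const (c v) * v)"
      using A(3) Asplit by (simp add: eq_neg_iff_add_eq_0 add.commute)
    also have "\<dots> \<in> J"
      using BJ(1) by (intro xpoly.subspace_neg[OF Jsub] xpoly.subspace_sum[OF Jsub] xpoly.subspace_scale[OF Jsub]) auto
    finally have "\<forall>t\<in>S. d t = 0"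
      using S(2) unfolding independent_mod_def by blast
    then have c1: "c v = 0" if "v \<in> A \<inter> q ` S" for v
      using that by (auto simp: d_def)
    then have "(\<Sum>v\<in>A \<inter> BJ. Const (c v) * v) = 0"
      using A(3) Asplit by simp
    then have "c v = 0" if "v \<in> A \<inter> BJ" for v
      using xpoly.independentD[OF BJ(2) _ _ _ that] A(2) by blast
    with c1 A(1) x show "c x = 0" by blast
  qed
  then obtain \<psi> where \<psi>: "Vector_Spaces.linear (\<lambda>(c::'k) (p::'k xpoly). Const c * p) (*) \<psi>"
    "\<forall>x\<in>BJ \<union> q ` S. \<psi> x = (if x = q s then 1 else 0)"
    using pair.linear_independent_extend[of "BJ \<union> q ` S" "\<lambda>x. if x = q s then 1 else 0"] by auto
  interpret \<psi>: Vector_Spaces.linear "\<lambda>(c::'k) (p::'k xpoly). Const c * p" "(*)" \<psi> by fact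
  have "\<psi> x = 0" if "x \<in> J" for x
  proof -
    have "x \<in> xpoly.span BJ" using that BJ by blast
    then show ?thesis
    proof (induction rule: xpoly.span_induct_alt)
      case (step c x y)
      then have "\<psi> x = 0" using \<psi>(2) disj s by auto
      with step show ?case by (simp add: \<psi>.add \<psi>.scale)
    qed (simp add: \<psi>.zero)
  qed
  moreover have "\<psi> (q t) = (if t = s then 1 else 0)" if "t \<in> S" for t
    using \<psi>(2) inj(1) that s by (auto dest: inj_onD)
  ultimately show ?thesis
    using \<psi>.add \<psi>.scale by (intro exI[of _ \<psi>]) auto
qed


section \<open>Dehomogenization and the generic point\<close>

abbreviation scalar :: "'k::field \<Rightarrow> 'k xpoly fract" where
  "scalar c \<equiv> to_fract (Const c)"

lemma scalar_simps: "scalar 0 = 0" "scalar 1 = 1" "scalar (a + b) = scalar a + scalar b"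
  "scalar (a * b) = scalar a * scalar b"
  by (simp_all add: Const_add Const_mult)

lemma scalar_eq_0_iff [simp]: "scalar c = 0 \<longleftrightarrow> c = 0"
  by (simp add: Const_def) (metis lookup_single_eq lookup_zero single_zero)

text \<open>
  Setting \<open>x\<^sub>1\<^sub>,\<^sub>0 = x\<^sub>2\<^sub>,\<^sub>0 = 1\<close> and extending the coefficients to the fraction field of \<open>R\<close>, which
  contains the function field \<open>L\<close>. The inner variable of the result is \<open>x = x\<^sub>1\<^sub>,\<^sub>1/x\<^sub>1\<^sub>,\<^sub>0\<close>, the outer one
  \<open>y = x\<^sub>2\<^sub>,\<^sub>1/x\<^sub>2\<^sub>,\<^sub>0\<close>. The bidegree becomes a bound for the two degrees. In this form the polynomials
  have leading coefficients and unique factorization.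
\<close>

definition dehom :: "'k::field xpoly \<Rightarrow> 'k xpoly fract poly poly" where
  "dehom = evaluate (\<lambda>c. [:[:scalar c:]:])
     (\<lambda>m. monom (monom 1 (Poly_Mapping.lookup m X11)) (Poly_Mapping.lookup m X21))"

lemma evaluation_dehom: "evaluation (\<lambda>c. [:[:scalar (c::'k::field):]:])
    (\<lambda>m. monom (monom 1 (Poly_Mapping.lookup m X11)) (Poly_Mapping.lookup m X21))"
  by unfold_locales (simp_all add: scalar_simps lookup_add mult_monom monom_0)

lemmas dehom_simps =
  evaluation.evaluate_0[OF evaluation_dehom, folded dehom_def]
  evaluation.evaluate_1[OF evaluation_dehom, folded dehom_def]
  evaluation.evaluate_add[OF evaluation_dehom, folded dehom_def]
  evaluation.evaluate_mult[OF evaluation_dehom, folded dehom_def]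
  evaluation.evaluate_power[OF evaluation_dehom, folded dehom_def]
  evaluation.evaluate_sum[OF evaluation_dehom, folded dehom_def]
  evaluation.evaluate_single[OF evaluation_dehom, folded dehom_def]

lemma dehom_Const: "dehom (Const c) = [:[:scalar c:]:]"
  using dehom_simps(7)[of 0 c] by (simp add: Const_def monom_0)

lemma coeff_dehom:
  "coeff (coeff (dehom p) j) i = (\<Sum>m\<in>Poly_Mapping.keys p.
     if Poly_Mapping.lookup m X21 = j \<and> Poly_Mapping.lookup m X11 = i
     then scalar (Poly_Mapping.lookup p m) else 0)"
  unfolding dehom_def evaluate_def
  by (auto simp: coeff_sum smult_monom if_distrib[of "\<lambda>q. coeff q i"] intro!: sum.cong)

lemma coeff_dehom_bihomogeneous:
  assumes p: "bihomogeneous a b p" and "i \<le> a" "j \<le> b"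
  shows "coeff (coeff (dehom p) j) i = scalar (Poly_Mapping.lookup p (affine_monomial a b i j))"
proof -
  have "coeff (coeff (dehom p) j) i = (\<Sum>m\<in>Poly_Mapping.keys p.
     if m = affine_monomial a b i j then scalar (Poly_Mapping.lookup p m) else 0)"
    unfolding coeff_dehom
  proof (intro sum.cong refl)
    fix m assume "m \<in> Poly_Mapping.keys p"
    then have m: "m \<in> bidegree_monomials a b" using p by (auto simp: bihomogeneous_iff_keys)
    have "Poly_Mapping.lookup m X21 = j \<and> Poly_Mapping.lookup m X11 = i \<longleftrightarrow> m = affine_monomial a b i j"
      using affine_monomial_lookup(1)[OF m] by auto
    then show "(if Poly_Mapping.lookup m X21 = j \<and> Poly_Mapping.lookup m X11 = i
        then scalar (Poly_Mapping.lookup p m) else 0)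
      = (if m = affine_monomial a b i j then scalar (Poly_Mapping.lookup p m) else 0)" by simp
  qed
  also have "\<dots> = scalar (Poly_Mapping.lookup p (affine_monomial a b i j))"
    by (auto simp: in_keys_iff)
  finally show ?thesis .
qed

definition bidegree_le :: "nat \<Rightarrow> nat \<Rightarrow> 'f::zero poly poly \<Rightarrow> bool" where
  "bidegree_le a b P \<longleftrightarrow> (\<forall>i j. i > a \<or> j > b \<longrightarrow> coeff (coeff P j) i = 0)"

lemma bidegree_le_0: "bidegree_le a b 0" by (simp add: bidegree_le_def)

lemma bidegree_le_add: "bidegree_le a b P \<Longrightarrow> bidegree_le a b Q \<Longrightarrow> bidegree_le a b (P + Q)" for P :: "'f::comm_ring_1 poly poly"
  by (simp add: bidegree_le_def)

lemma bidegree_le_diff: "bidegree_le a b P \<Longrightarrow> bidegree_le a b Q \<Longrightarrow> bidegree_le a b (P - Q)" for P :: "'f::comm_ring_1 poly poly"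
  by (simp add: bidegree_le_def)

lemma bidegree_le_smult: "bidegree_le a b P \<Longrightarrow> bidegree_le a b ([:[:c:]:] * P)" for P :: "'f::comm_ring_1 poly poly"
  by (simp add: bidegree_le_def)

lemma bidegree_le_sum: "(\<And>u. u \<in> U \<Longrightarrow> bidegree_le a b (P u)) \<Longrightarrow> bidegree_le a b (sum P U)"
  for P :: "'u \<Rightarrow> 'f::comm_ring_1 poly poly"
  by (induction U rule: infinite_finite_induct) (simp_all add: bidegree_le_0 bidegree_le_add)

lemma bidegree_le_eqI:
  assumes "bidegree_le a b P" "\<And>i j. i \<le> a \<Longrightarrow> j \<le> b \<Longrightarrow> coeff (coeff P j) i = 0"
  shows "P = 0"
  using assms by (intro poly_eqI) (metis bidegree_le_def coeff_0 not_less)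

lemma bidegree_le_dehom: "bihomogeneous a b p \<Longrightarrow> bidegree_le a b (dehom p)"
  unfolding bidegree_le_def coeff_dehom
proof (intro allI impI sum.neutral ballI)
  fix i j m
  assume "bihomogeneous a b p" "i > a \<or> j > b" and m: "m \<in> Poly_Mapping.keys p"
  then have "m \<in> bidegree_monomials a b" by (auto simp: bihomogeneous_iff_keys)
  from affine_monomial_lookup(2,3)[OF this] \<open>i > a \<or> j > b\<close>
  show "(if Poly_Mapping.lookup m X21 = j \<and> Poly_Mapping.lookup m X11 = i
      then scalar (Poly_Mapping.lookup p m) else 0) = 0" by auto
qed

text \<open>
  The coefficients are already in the fraction field of \<open>R\<close>, and the two variables are given the values
  that they have there. For a polynomial over the ground field this undoes the dehomogenization, up to
  a monomial.
\<close>

definition at_generic_point :: "'k::field xpoly fract poly poly \<Rightarrow> 'k xpoly fract" where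
  "at_generic_point P = poly (poly P [:to_fract (Var X21) / to_fract (Var X20):])
     (to_fract (Var X11) / to_fract (Var X10))"

lemma at_generic_point_simps:
  "at_generic_point 0 = 0"
  "at_generic_point (P + Q) = at_generic_point P + at_generic_point Q"
  "at_generic_point (P - Q) = at_generic_point P - at_generic_point Q"
  "at_generic_point (P * Q) = at_generic_point P * at_generic_point Q"
  "at_generic_point [:[:c:]:] = c"
  "at_generic_point (sum f A) = (\<Sum>a\<in>A. at_generic_point (f a))"
  by (simp_all add: at_generic_point_def poly_sum)

lemma Var_power: "Var v ^ n = Poly_Mapping.single (Poly_Mapping.single v n) 1"
  by (induction n) (simp_all add: Var_def mult_single flip: single_add)

lemma single_eq_Var_powers:
  "Poly_Mapping.single m c = Const c * Var X10 ^ Poly_Mapping.lookup m X10 * Var X11 ^ Poly_Mapping.lookup m X11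
     * Var X20 ^ Poly_Mapping.lookup m X20 * Var X21 ^ Poly_Mapping.lookup m X21"
proof -
  have m: "m = Poly_Mapping.single X10 (Poly_Mapping.lookup m X10) + Poly_Mapping.single X11 (Poly_Mapping.lookup m X11)
     + Poly_Mapping.single X20 (Poly_Mapping.lookup m X20) + Poly_Mapping.single X21 (Poly_Mapping.lookup m X21)"
  proof (rule poly_mapping_eqI)
    fix v show "Poly_Mapping.lookup m v = Poly_Mapping.lookup (Poly_Mapping.single X10 (Poly_Mapping.lookup m X10) + Poly_Mapping.single X11 (Poly_Mapping.lookup m X11)
     + Poly_Mapping.single X20 (Poly_Mapping.lookup m X20) + Poly_Mapping.single X21 (Poly_Mapping.lookup m X21)) v"
      by (cases v) (simp_all add: lookup_add lookup_single)
  qed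
  show ?thesis
    unfolding Var_power Const_def mult_single by (simp flip: m)
qed

lemma to_fract_power: "to_fract (p ^ n) = to_fract p ^ n"
  by (induction n) simp_all

lemma to_fract_sum: "to_fract (sum f A) = (\<Sum>a\<in>A. to_fract (f a))"
  by (induction A rule: infinite_finite_induct) simp_all

lemma dehom_at_generic_point:
  assumes p: "bihomogeneous a b (p :: 'k::field xpoly)"
  shows "at_generic_point (dehom p) * to_fract (Var X10 ^ a * Var X20 ^ b) = to_fract p"
proof -
  let ?t = "to_fract :: 'k xpoly \<Rightarrow> _"
  have "at_generic_point (monom (monom 1 i) j) = (?t (Var X11) / ?t (Var X10)) ^ i * (?t (Var X21) / ?t (Var X20)) ^ j" for i j
    by (simp add: at_generic_point_def poly_monom)
  then have "at_generic_point (dehom p) * ?t (Var X10 ^ a * Var X20 ^ b) = (\<Sum>m\<in>Poly_Mapping.keys p.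
      scalar (Poly_Mapping.lookup p m) * ((?t (Var X11) / ?t (Var X10)) ^ Poly_Mapping.lookup m X11
        * (?t (Var X21) / ?t (Var X20)) ^ Poly_Mapping.lookup m X21) * ?t (Var X10 ^ a * Var X20 ^ b))"
    unfolding dehom_def evaluate_def by (simp add: at_generic_point_simps sum_distrib_right del: mult_pCons_left)
  also have "\<dots> = (\<Sum>m\<in>Poly_Mapping.keys p. ?t (Poly_Mapping.single m (Poly_Mapping.lookup p m)))"
  proof (intro sum.cong refl)
    fix m assume "m \<in> Poly_Mapping.keys p"
    with p have "a = Poly_Mapping.lookup m X10 + Poly_Mapping.lookup m X11"
      "b = Poly_Mapping.lookup m X20 + Poly_Mapping.lookup m X21"
      by (auto simp: bihomogeneous_def deg1_def deg2_def)
    moreover have "?t (Var v) \<noteq> 0" for v by simp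
    ultimately show "scalar (Poly_Mapping.lookup p m) * ((?t (Var X11) / ?t (Var X10)) ^ Poly_Mapping.lookup m X11
        * (?t (Var X21) / ?t (Var X20)) ^ Poly_Mapping.lookup m X21) * ?t (Var X10 ^ a * Var X20 ^ b)
        = ?t (Poly_Mapping.single m (Poly_Mapping.lookup p m))"
      by (subst single_eq_Var_powers) (simp add: to_fract_power power_divide power_add)
  qed
  also have "\<dots> = ?t p"
    using poly_mapping_sum_monomials[OF finite_keys subset_refl, of p] by (simp flip: to_fract_sum)
  finally show ?thesis .
qed

section \<open>The two function fields\<close>

lemma homogeneous_mult:
  assumes "homogeneous n g" "homogeneous k h"
  shows "homogeneous (n + k) (g * h)"
  unfolding homogeneous_def
proof
  fix m assume "m \<in> Poly_Mapping.keys (g * h)"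
  then obtain u v where "m = u + v" "u \<in> Poly_Mapping.keys g" "v \<in> Poly_Mapping.keys h"
    using keys_mult[of g h] by blast
  moreover from this assms have
    "Poly_Mapping.lookup u Y0 + Poly_Mapping.lookup u Y1 + Poly_Mapping.lookup u Y2 = n"
    "Poly_Mapping.lookup v Y0 + Poly_Mapping.lookup v Y1 + Poly_Mapping.lookup v Y2 = k"
    unfolding homogeneous_def by blast+
  ultimately show "Poly_Mapping.lookup m Y0 + Poly_Mapping.lookup m Y1 + Poly_Mapping.lookup m Y2 = n + k"
    by (simp add: lookup_add)
qed

lemma homogeneous_diff: "homogeneous n g \<Longrightarrow> homogeneous n h \<Longrightarrow> homogeneous n (g - h)"
  unfolding homogeneous_def using keys_diff[of g h] by blast

lemma homogeneous_0: "homogeneous n 0" by (simp add: homogeneous_def)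

lemma homogeneous_single:
  "Poly_Mapping.lookup m Y0 + Poly_Mapping.lookup m Y1 + Poly_Mapping.lookup m Y2 = n \<Longrightarrow>
    homogeneous n (Poly_Mapping.single m c)"
  by (simp add: homogeneous_def)

lemma homogeneous_sum: "(\<And>u. u \<in> U \<Longrightarrow> homogeneous n (g u)) \<Longrightarrow> homogeneous n (sum g U)"
  unfolding homogeneous_def using keys_sum[of g U] by blast

lemma evaluation_subst3:
  "evaluation Const (\<lambda>m. f0 ^ Poly_Mapping.lookup m Y0 * f1 ^ Poly_Mapping.lookup m Y1 * f2 ^ Poly_Mapping.lookup m Y2)"
  by standard (simp_all add: Const_add Const_mult lookup_add power_add mult_ac)

lemma subst3_evaluate:
  "subst3 f0 f1 f2 = evaluate Const (\<lambda>m. f0 ^ Poly_Mapping.lookup m Y0 * f1 ^ Poly_Mapping.lookup m Y1 * f2 ^ Poly_Mapping.lookup m Y2)"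
  by (rule ext) (simp add: subst3_def evaluate_def mult.assoc)

lemmas subst3_simps =
  evaluation.evaluate_0[OF evaluation_subst3, folded subst3_evaluate]
  evaluation.evaluate_1[OF evaluation_subst3, folded subst3_evaluate]
  evaluation.evaluate_diff[OF evaluation_subst3, folded subst3_evaluate]
  evaluation.evaluate_mult[OF evaluation_subst3, folded subst3_evaluate]
  evaluation.evaluate_sum[OF evaluation_subst3, folded subst3_evaluate]
  evaluation.evaluate_single[OF evaluation_subst3, folded subst3_evaluate]

lemma dominant_subst3_nonzero:
  assumes "dominant f0 f1 f2" "homogeneous n g" "g \<noteq> 0"
  shows "subst3 f0 f1 f2 g \<noteq> 0"
proof -
  obtain P where "P \<in> biproj_points" "subst3 f0 f1 f2 g \<notin> P"
    using assms unfolding dominant_def by blast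
  moreover from this have "0 \<in> P" by (auto simp: biproj_points_def intro: ideal.subspace_0)
  ultimately show ?thesis by auto
qed

lemma pullback_fieldI:
  "homogeneous n g \<Longrightarrow> homogeneous n h \<Longrightarrow> h \<noteq> 0 \<Longrightarrow>
    to_fract (subst3 f0 f1 f2 g) / to_fract (subst3 f0 f1 f2 h) \<in> pullback_field f0 f1 f2"
  unfolding pullback_field_def by (auto simp flip: Fract_conv_to_fract)

text \<open>
  Dominance keeps products of admissible denominators nonzero, and it makes the nonzero elements
  invertible.
\<close>

lemma subfield_pullback_field:
  assumes dom: "dominant f0 f1 f2"
  shows "subfield (pullback_field f0 f1 f2)"
proof -
  let ?M = "pullback_field f0 f1 f2" and ?s = "subst3 f0 f1 f2"
  note nz = dominant_subst3_nonzero[OF dom]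
  have cases: "\<exists>n g h. homogeneous n g \<and> homogeneous n h \<and> h \<noteq> 0 \<and> x = to_fract (?s g) / to_fract (?s h)"
    if "x \<in> ?M" for x
    using that by (auto simp: pullback_field_def Fract_conv_to_fract)
  have hom1: "homogeneous 0 1" by (simp add: homogeneous_def)
  have one: "1 \<in> ?M" using pullback_fieldI[OF hom1 hom1] by (simp add: subst3_simps)
  have zero: "0 \<in> ?M" using pullback_fieldI[OF homogeneous_0 hom1] by (simp add: subst3_simps)
  have "x - y \<in> ?M \<and> x * y \<in> ?M" if xy: "x \<in> ?M" "y \<in> ?M" for x y
  proof -
    obtain n g h where g: "homogeneous n g" "homogeneous n h" "h \<noteq> 0" "x = to_fract (?s g) / to_fract (?s h)"
      using cases[OF xy(1)] by blast
    obtain k u v where u: "homogeneous k u" "homogeneous k v" "v \<noteq> 0" "y = to_fract (?s u) / to_fract (?s v)"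
      using cases[OF xy(2)] by blast
    have s: "?s h \<noteq> 0" "?s v \<noteq> 0" using nz g u by blast+
    then have "?s (h * v) \<noteq> 0" by (simp add: subst3_simps)
    then have hv: "h * v \<noteq> 0" by (metis subst3_simps(1))
    have hom: "homogeneous (n + k) (g * v - u * h)" "homogeneous (n + k) (g * u)" "homogeneous (n + k) (h * v)"
      using homogeneous_diff[OF homogeneous_mult[OF g(1) u(2)], of "u * h"] homogeneous_mult[OF u(1) g(2)]
        homogeneous_mult[OF g(1) u(1)] homogeneous_mult[OF g(2) u(2)] by (simp_all add: add.commute)
    have "x - y = to_fract (?s (g * v - u * h)) / to_fract (?s (h * v))"
      using s by (simp add: g(4) u(4) subst3_simps diff_frac_eq)
    moreover have "x * y = to_fract (?s (g * u)) / to_fract (?s (h * v))"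
      by (simp add: g(4) u(4) subst3_simps)
    ultimately show ?thesis using pullback_fieldI hom hv by metis
  qed
  moreover have "inverse x \<in> ?M" if x: "x \<in> ?M" for x
  proof -
    obtain n g h where g: "homogeneous n g" "homogeneous n h" "h \<noteq> 0" "x = to_fract (?s g) / to_fract (?s h)"
      using cases[OF x] by blast
    show ?thesis
    proof (cases "g = 0")
      case True
      then show ?thesis using zero g by (simp add: subst3_simps)
    next
      case False
      then show ?thesis using pullback_fieldI[OF g(2,1)] g(4) by simp
    qed
  qed
  ultimately show ?thesis using one by (auto simp: subfield_def)
qed

lemma pullback_field_elements:
  fixes f0 f1 f2 :: "'k::field xpoly"
  shows "scalar c \<in> pullback_field f0 f1 f2"
    "to_fract f1 / to_fract f0 \<in> pullback_field f0 f1 f2"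
    "to_fract f2 / to_fract f0 \<in> pullback_field f0 f1 f2"
proof -
  have hom1: "homogeneous 0 1" by (simp add: homogeneous_def)
  have homc: "homogeneous 0 (Poly_Mapping.single 0 c)" by (simp add: homogeneous_single)
  show "scalar c \<in> pullback_field f0 f1 f2"
    using pullback_fieldI[OF homc hom1, of f0 f1 f2] by (simp add: subst3_simps)
  have hom: "homogeneous 1 (Poly_Mapping.single (Poly_Mapping.single v 1) (1::'k))" for v
    by (cases v) (simp_all add: homogeneous_single lookup_single)
  have nz: "Poly_Mapping.single (Poly_Mapping.single v 1) (1::'k) \<noteq> 0" for v :: yvar
    by (metis lookup_single_eq lookup_zero one_neq_zero)
  show "to_fract f1 / to_fract f0 \<in> pullback_field f0 f1 f2"
    using pullback_fieldI[OF hom[of Y1] hom[of Y0] nz, of f0 f1 f2] by (simp add: subst3_simps lookup_single)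
  show "to_fract f2 / to_fract f0 \<in> pullback_field f0 f1 f2"
    using pullback_fieldI[OF hom[of Y2] hom[of Y0] nz, of f0 f1 f2] by (simp add: subst3_simps lookup_single)
qed

lemma function_field_common_denominator:
  fixes e :: "'i \<Rightarrow> 'k::field xpoly fract"
  assumes "finite S" "\<And>i. i \<in> S \<Longrightarrow> e i \<in> function_field"
  shows "\<exists>a b P Q. Q \<noteq> 0 \<and> bihomogeneous a b Q \<and>
    (\<forall>i\<in>S. bihomogeneous a b (P i) \<and> e i = to_fract (P i) / to_fract Q)"
  using assms
proof (induction S rule: finite_induct)
  case empty
  show ?case using bihomogeneous_1 by (intro exI[of _ 0] exI[of _ "\<lambda>_. 0"] exI[of _ 1]) auto
next
  case (insert s S)
  then have "\<exists>a b P Q. Q \<noteq> 0 \<and> bihomogeneous a b Q \<and>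
    (\<forall>i\<in>S. bihomogeneous a b (P i) \<and> e i = to_fract (P i) / to_fract Q)" by blast
  then obtain a b P Q where Q: "Q \<noteq> 0" "bihomogeneous a b Q"
    "\<And>i. i \<in> S \<Longrightarrow> bihomogeneous a b (P i) \<and> e i = to_fract (P i) / to_fract Q" by blast
  obtain p q a' b' where q: "bihomogeneous a' b' p" "bihomogeneous a' b' q" "q \<noteq> 0" "e s = to_fract p / to_fract q"
    using insert.prems[of s] by (auto simp: function_field_def Fract_conv_to_fract)
  define P' where "P' = (\<lambda>i. if i = s then Q * p else P i * q)"
  have "bihomogeneous (a + a') (b + b') (Q * q)" "Q * q \<noteq> 0"
    using Q q bihomogeneous_mult by auto
  moreover have "bihomogeneous (a + a') (b + b') (P' i) \<and> e i = to_fract (P' i) / to_fract (Q * q)"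
    if "i \<in> insert s S" for i
    using that insert.hyps Q q by (auto simp: P'_def intro: bihomogeneous_mult)
  ultimately show ?case by blast
qed

section \<open>Equations of a finite base locus\<close>

text \<open>
  In a chart the powers of the ratio \<open>z/w\<close> of two variables are linearly dependent modulo \<open>I\<close>, because
  the coordinate ring of the base locus has finite dimension there. Clearing denominators turns the
  dependence into a form in \<open>z\<close> and \<open>w\<close> that lies in \<open>I\<close> up to a monomial that is invertible in the chart.
\<close>

lemma chart_relation:
  fixes I :: "'k::field xpoly set"
  assumes fin: "quotient_finite_dim (UNIV :: 'k set) (\<lambda>c z. Fraction_Field.Fract (Const c) 1 * z) (chart x y UNIV) (chart x y I)"
    and I: "ideal.subspace I" and x: "bihomogeneous 1 0 (Var x :: 'k xpoly)" and y: "bihomogeneous 0 1 (Var y :: 'k xpoly)"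
    and v: "\<And>i. to_fract (Var z ^ i) / to_fract (Var w ^ i) \<in> chart x y (UNIV :: 'k xpoly set)"
  shows "\<exists>k c n l. (\<exists>i\<le>k. c i \<noteq> 0) \<and>
    (\<Sum>i\<le>k. Const (c i) * (Var z ^ i * Var w ^ (k - i))) * (Var x ^ n * Var y ^ l) \<in> I"
proof -
  let ?W = "chart x y I" and ?v = "\<lambda>i. to_fract (Var z ^ i) / to_fract (Var w ^ i) :: 'k xpoly fract"
  obtain B where B: "finite B" "\<forall>u\<in>chart x y (UNIV :: 'k xpoly set). \<exists>c. u - (\<Sum>b\<in>B. scalar (c b) * b) \<in> ?W"
    using fin unfolding quotient_finite_dim_def quotient_basis_def to_fract_def by auto
  define k where "k = card B"
  have "\<forall>i. \<exists>c. ?v i - (\<Sum>b\<in>B. scalar (c b) * b) \<in> ?W"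
  proof
    fix i show "\<exists>c. ?v i - (\<Sum>b\<in>B. scalar (c b) * b) \<in> ?W"
      by (rule bspec[OF B(2) v[of i]])
  qed
  from choice[OF this]
  obtain c where c: "\<forall>i. ?v i - (\<Sum>b\<in>B. scalar (c i b) * b) \<in> ?W" ..
  \<comment> \<open>More powers than basis elements: some combination of the powers has coordinates zero.\<close>
  obtain d where d: "\<exists>i\<in>{..k}. d i \<noteq> 0" "\<forall>b\<in>B. (\<Sum>i\<le>k. c i b * d i) = 0"
    using underdetermined_system_solvable[OF subfield_UNIV B(1), of "{..k}" "\<lambda>b i. c i b"]
    by (auto simp: k_def)
  have W_repr: "\<exists>p a b. u = to_fract p / to_fract (Var x ^ a * Var y ^ b) \<and> p \<in> I \<and> bihomogeneous a b p"
    if u: "u \<in> ?W" for u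
    using u unfolding chart_def Fract_conv_to_fract by blast
  have W_I: "to_fract p / to_fract (Var x ^ a * Var y ^ b) \<in> ?W" if "p \<in> I" "bihomogeneous a b p" for p a b
    using that unfolding chart_def Fract_conv_to_fract[symmetric] by blast
  have W_add: "u + u' \<in> ?W" if u: "u \<in> ?W" "u' \<in> ?W" for u u'
  proof -
    obtain p a b where p: "u = to_fract p / to_fract (Var x ^ a * Var y ^ b)" "p \<in> I" "bihomogeneous a b p"
      using W_repr[OF u(1)] by blast
    obtain p' a' b' where p': "u' = to_fract p' / to_fract (Var x ^ a' * Var y ^ b')" "p' \<in> I" "bihomogeneous a' b' p'"
      using W_repr[OF u(2)] by blast
    have mon: "bihomogeneous a b (Var x ^ a * Var y ^ b :: 'k xpoly)" for a b
      using bihomogeneous_mult[OF bihomogeneous_power[OF x, of a] bihomogeneous_power[OF y, of b]] by simp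
    have "p * (Var x ^ a' * Var y ^ b') + p' * (Var x ^ a * Var y ^ b) \<in> I"
      using p p' by (auto intro!: ideal_closed(2)[OF I ideal_closed(4)[OF I] ideal_closed(4)[OF I]])
    moreover have "bihomogeneous (a + a') (b + b') (p * (Var x ^ a' * Var y ^ b') + p' * (Var x ^ a * Var y ^ b))"
      using bihomogeneous_mult[OF p(3) mon[of a' b']] bihomogeneous_mult[OF p'(3) mon[of a b]]
      by (intro bihomogeneous_add) (simp_all add: add.commute)
    moreover have "u + u' = to_fract (p * (Var x ^ a' * Var y ^ b') + p' * (Var x ^ a * Var y ^ b))
        / to_fract (Var x ^ (a + a') * Var y ^ (b + b'))"
      unfolding p(1) p'(1) by (subst add_frac_eq) (simp_all add: power_add to_fract_power mult_ac)
    ultimately show ?thesis using W_I by metis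
  qed
  have W_0: "0 \<in> ?W"
    using W_I[of 0 0 0] ideal_closed(1)[OF I] by (simp add: bihomogeneous_0)
  have W_scalar: "scalar r * u \<in> ?W" if u: "u \<in> ?W" for r u
  proof -
    obtain p a b where p: "u = to_fract p / to_fract (Var x ^ a * Var y ^ b)" "p \<in> I" "bihomogeneous a b p"
      using W_repr[OF u] by blast
    have "scalar r * u = to_fract (Const r * p) / to_fract (Var x ^ a * Var y ^ b)"
      by (simp add: p(1))
    then show ?thesis using W_I[of "Const r * p" a b] p ideal_closed(3)[OF I] bihomogeneous_Const_mult by metis
  qed
  have W_sum: "sum h S \<in> ?W" if "\<And>i. i \<in> S \<Longrightarrow> h i \<in> ?W" for h and S :: "nat set"
    using that by (induction S rule: infinite_finite_induct) (simp_all add: W_0 W_add)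
  have "(\<Sum>i\<le>k. scalar (d i) * (?v i - (\<Sum>b\<in>B. scalar (c i b) * b))) \<in> ?W"
    by (intro W_sum W_scalar c[rule_format])
  also have "(\<Sum>i\<le>k. scalar (d i) * (?v i - (\<Sum>b\<in>B. scalar (c i b) * b)))
      = (\<Sum>i\<le>k. scalar (d i) * ?v i) - (\<Sum>b\<in>B. scalar (\<Sum>i\<le>k. c i b * d i) * b)"
  proof -
    have "(\<Sum>i\<le>k. scalar (d i) * (\<Sum>b\<in>B. scalar (c i b) * b)) = (\<Sum>i\<le>k. \<Sum>b\<in>B. scalar (c i b * d i) * b)"
      by (simp add: sum_distrib_left Const_mult mult_ac)
    also have "\<dots> = (\<Sum>b\<in>B. \<Sum>i\<le>k. scalar (c i b * d i) * b)" by (rule sum.swap)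
    also have "\<dots> = (\<Sum>b\<in>B. scalar (\<Sum>i\<le>k. c i b * d i) * b)"
    proof -
      have "scalar (sum h S) = (\<Sum>i\<in>S. scalar (h i))" for h :: "nat \<Rightarrow> 'k" and S
        by (induction S rule: infinite_finite_induct) (simp_all add: scalar_simps)
      then show ?thesis by (simp add: sum_distrib_right)
    qed
    finally show ?thesis by (simp add: right_diff_distrib sum_subtractf)
  qed
  finally have "(\<Sum>i\<le>k. scalar (d i) * ?v i) \<in> ?W" using d(2) by simp
  then obtain p n l where p: "(\<Sum>i\<le>k. scalar (d i) * ?v i) = to_fract p / to_fract (Var x ^ n * Var y ^ l)" "p \<in> I"
    using W_repr by blast
  have "to_fract ((\<Sum>i\<le>k. Const (d i) * (Var z ^ i * Var w ^ (k - i))) * (Var x ^ n * Var y ^ l))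
      = (\<Sum>i\<le>k. scalar (d i) * ?v i) * to_fract (Var w ^ k) * to_fract (Var x ^ n * Var y ^ l)"
  proof -
    have "(\<Sum>i\<le>k. scalar (d i) * ?v i) * to_fract (Var w ^ k)
      = (\<Sum>i\<le>k. to_fract (Const (d i) * (Var z ^ i * Var w ^ (k - i))))"
      unfolding sum_distrib_right
    proof (intro sum.cong refl)
      fix i assume "i \<in> {..k}"
      then have "(Var w :: 'k xpoly) ^ k = Var w ^ i * Var w ^ (k - i)" by (simp flip: power_add)
      then show "scalar (d i) * ?v i * to_fract (Var w ^ k) = to_fract (Const (d i) * (Var z ^ i * Var w ^ (k - i)))"
        by (simp add: to_fract_power)
    qed
    then show ?thesis by (simp add: to_fract_sum)
  qed
  also have "\<dots> = to_fract (p * Var w ^ k)"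
    unfolding p(1) by (simp add: to_fract_power)
  finally have eq: "(\<Sum>i\<le>k. Const (d i) * (Var z ^ i * Var w ^ (k - i))) * (Var x ^ n * Var y ^ l) = p * Var w ^ k"
    by (simp only: to_fract_eq_iff)
  show ?thesis
  proof (rule exI[of _ k], rule exI[of _ d], rule exI[of _ n], rule exI[of _ l], rule conjI)
    show "\<exists>i\<le>k. d i \<noteq> 0" using d(1) by auto
    show "(\<Sum>i\<le>k. Const (d i) * (Var z ^ i * Var w ^ (k - i))) * (Var x ^ n * Var y ^ l) \<in> I"
      unfolding eq by (rule ideal_closed(4)[OF I p(2)])
  qed
qed


section \<open>Polynomials in two variables over a field\<close>

lemma coeff_mult_top:
  fixes p q :: "'a::idom poly"
  assumes "degree p \<le> n" "degree q \<le> d"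
  shows "coeff (p * q) (n + d) = coeff p n * coeff q d"
proof (cases "degree p = n \<and> degree q = d")
  case True
  then show ?thesis using coeff_mult_degree_sum[of p q] by auto
next
  case False
  then have "degree p + degree q < n + d" using assms by auto
  then have "coeff (p * q) (n + d) = 0"
    using degree_mult_le[of p q] by (intro coeff_eq_0) linarith
  moreover have "coeff p n = 0 \<or> coeff q d = 0"
    using False assms by (metis coeff_eq_0 le_neq_implies_less)
  ultimately show ?thesis by auto
qed

lemma degrees_le_of_bidegree: "bidegree_le a b P \<Longrightarrow> degree P \<le> b" "bidegree_le a b P \<Longrightarrow> degree (coeff P j) \<le> a"
  for P :: "'f::zero poly poly"
  by (auto simp: bidegree_le_def intro!: degree_le poly_eqI)

text \<open>
  The degree in the inner variable is additive, but it is not the degree of any coefficient in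
  particular. The coefficients of the top power of the inner variable form polynomials \<open>U\<close> and \<open>W\<close> in the
  outer variable, and their product is nonzero.
\<close>

lemma inner_degree_quotient:
  fixes C H :: "'f::field poly poly"
  assumes H: "bidegree_le d b' H" "coeff (coeff H l) d \<noteq> 0" and CH: "bidegree_le a b (C * H)" and C: "C \<noteq> 0"
  shows "degree (coeff C j) + d \<le> a"
proof -
  define n where "n = Max ((\<lambda>j. degree (coeff C j)) ` {..degree C})"
  have le: "degree (coeff C j) \<le> n" for j
  proof (cases "j \<le> degree C")
    case True
    then show ?thesis unfolding n_def by (intro Max_ge) auto
  qed (simp add: coeff_eq_0)
  have "n \<in> (\<lambda>j. degree (coeff C j)) ` {..degree C}"
    unfolding n_def by (intro Max_in) auto
  then obtain k where k: "n = degree (coeff C k)" by blast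
  have "\<exists>k. coeff (coeff C k) n \<noteq> 0"
  proof (cases "n = 0")
    case True
    then have "degree (lead_coeff C) = 0" using le[of "degree C"] by simp
    then show ?thesis using C True by (intro exI[of _ "degree C"]) (metis leading_coeff_0_iff)
  next
    case False
    then show ?thesis using k by (intro exI[of _ k]) (metis degree_0 leading_coeff_0_iff)
  qed
  then obtain k where k: "coeff (coeff C k) n \<noteq> 0" by blast
  define U where "U = map_poly (\<lambda>q. coeff q n) C"
  define W where "W = map_poly (\<lambda>q. coeff q d) H"
  have U: "coeff U i = coeff (coeff C i) n" for i by (simp add: U_def coeff_map_poly)
  have W: "coeff W i = coeff (coeff H i) d" for i by (simp add: W_def coeff_map_poly)
  have "U \<noteq> 0" "W \<noteq> 0" using k H(2) U W by (metis coeff_0)+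
  then have "U * W \<noteq> 0" by simp
  then obtain m where "coeff (U * W) m \<noteq> 0" by (metis leading_coeff_0_iff)
  moreover have "coeff (U * W) m = coeff (coeff (C * H) m) (n + d)"
    unfolding coeff_mult[of U W] coeff_mult[of C H] U W coeff_sum
    by (intro sum.cong refl coeff_mult_top[symmetric] le degrees_le_of_bidegree(2)[OF H(1)])
  ultimately have "n + d \<le> a" using CH unfolding bidegree_le_def by (metis not_less)
  then show ?thesis using le[of j] by simp
qed

lemma outer_degree_quotient:
  fixes C H :: "'f::field poly poly"
  assumes H: "bidegree_le a' d H" "coeff H d \<noteq> 0" and CH: "bidegree_le a b (C * H)" and C: "C \<noteq> 0"
  shows "degree C + d \<le> b"
proof -
  have "degree H = d" using degrees_le_of_bidegree(1)[OF H(1)] le_degree[OF H(2)] by simp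
  moreover have "H \<noteq> 0" using H(2) by auto
  ultimately show ?thesis using degrees_le_of_bidegree(1)[OF CH] C by (simp add: degree_mult_eq)
qed

lemma const_poly_sum: "[:sum f S:] = (\<Sum>i\<in>S. [:f i:])"
  by (rule poly_eqI) (simp add: coeff_sum coeff_pCons split: nat.split)

text \<open>
  A divisor of a nonzero polynomial in the inner variable has degree zero in the outer one, and
  therefore divides every coefficient of a nonzero polynomial in the outer variable.
\<close>

lemma unit_if_dvd_inner_and_outer:
  fixes g :: "'f::field poly poly"
  assumes x: "g dvd (\<Sum>i\<le>k. [:[:\<theta> i:]:] * [:[:0, 1:]:] ^ i)" "\<exists>i\<le>k. \<theta> i \<noteq> 0"
    and y: "g dvd (\<Sum>i\<le>l. [:[:\<eta> i:]:] * [:0, 1:] ^ i)" "\<exists>i\<le>l. \<eta> i \<noteq> 0"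
  shows "is_unit g"
proof -
  define \<Phi> where "\<Phi> = (\<Sum>i\<le>k. monom (\<theta> i) i)"
  have const: "[:\<Phi>:] = (\<Sum>i\<le>k. [:[:\<theta> i:]:] * [:[:0, 1:]:] ^ i)"
  proof -
    have "[:monom (\<theta> i) i:] = [:[:\<theta> i:]:] * [:[:0, 1:]:] ^ i" for i
      by (simp add: poly_const_pow monom_altdef)
    then show ?thesis by (simp add: \<Phi>_def const_poly_sum)
  qed
  obtain i where i: "i \<le> k" "\<theta> i \<noteq> 0" using x(2) by blast
  have "coeff \<Phi> i = \<theta> i" using i by (simp add: \<Phi>_def coeff_sum)
  then have "[:\<Phi>:] \<noteq> 0" using i by auto
  moreover have "g dvd [:\<Phi>:]" using x(1) const by simp
  ultimately have "degree g \<le> degree [:\<Phi>:]" by (intro dvd_imp_degree_le)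
  then obtain g0 where g0: "g = [:g0:]" by (metis degree_pCons_0 degree_0_id le_zero_eq degree_eq_zeroE)
  obtain j where j: "j \<le> l" "\<eta> j \<noteq> 0" using y(2) by blast
  have "[:0, 1 :: 'f poly:] ^ i = monom 1 i" for i by (simp add: monom_altdef)
  then have "coeff (\<Sum>i\<le>l. [:[:\<eta> i:]:] * [:0, 1:] ^ i) j = (\<Sum>i\<le>l. if i = j then [:\<eta> j:] else 0)"
    unfolding coeff_sum by (intro sum.cong refl) simp
  also have "\<dots> = [:\<eta> j:]" using j by simp
  finally have coeff_j: "coeff (\<Sum>i\<le>l. [:[:\<eta> i:]:] * [:0, 1:] ^ i) j = [:\<eta> j:]" .
  have "\<forall>n. g0 dvd coeff (\<Sum>i\<le>l. [:[:\<eta> i:]:] * [:0, 1:] ^ i) n"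
    using y(1) unfolding g0 const_poly_dvd_iff .
  from this[rule_format, of j] have "g0 dvd [:\<eta> j:]" unfolding coeff_j .
  moreover have "is_unit [:\<eta> j:]" using j(2) by (rule is_unit_triv)
  ultimately have "is_unit g0" by (rule dvd_trans)
  then show ?thesis unfolding g0 by (simp add: is_unit_const_poly_iff)
qed

lemma dvd_diff_mult:
  fixes g :: "'r::comm_ring_1"
  assumes "g dvd a - b" "g dvd c - d" shows "g dvd a * c - b * d"
proof -
  have "a * c - b * d = (a - b) * c + b * (c - d)" by (simp add: algebra_simps)
  then show ?thesis using assms by simp
qed

lemma dvd_diff_power:
  fixes g :: "'r::comm_ring_1"
  assumes "g dvd a - b" shows "g dvd a ^ n - b ^ n"
  by (induction n) (simp_all add: dvd_diff_mult assms)

section \<open>The equations of the generic fibre\<close>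

locale dominant_map =
  fixes f0 f1 f2 :: "'k::field xpoly" and d1 d2 :: nat
  assumes f_hom: "bihomogeneous d1 d2 f0" "bihomogeneous d1 d2 f1" "bihomogeneous d1 d2 f2"
    and dom: "dominant f0 f1 f2"
begin

text \<open>
  The affine coordinates of the generic point of \<open>P\<^sup>2\<close>, and two curves that meet in its fibre and in
  the base locus.
\<close>

definition "lam = to_fract f1 / to_fract f0"
definition "mu = to_fract f2 / to_fract f0"
definition "h1 = dehom f1 - [:[:lam:]:] * dehom f0"
definition "h2 = dehom f2 - [:[:mu:]:] * dehom f0"

text \<open>
  Dominance in the form used below: the \<open>f\<^sub>i\<close> satisfy no homogeneous algebraic relation.
\<close>

lemma homogeneous_relation:
  assumes "finite S" "\<And>m. m \<in> S \<Longrightarrow> fst m + snd m \<le> n"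
    and "m \<in> S" "\<gamma> m \<noteq> 0"
  shows "(\<Sum>m\<in>S. Const (\<gamma> m) * (f0 ^ (n - fst m - snd m) * f1 ^ fst m * f2 ^ snd m)) \<noteq> 0"
proof -
  define Y where "Y m = Poly_Mapping.single Y0 (n - fst m - snd m) + Poly_Mapping.single Y1 (fst m)
    + Poly_Mapping.single Y2 (snd m)" for m
  have Y: "Poly_Mapping.lookup (Y m) Y0 = n - fst m - snd m" "Poly_Mapping.lookup (Y m) Y1 = fst m"
    "Poly_Mapping.lookup (Y m) Y2 = snd m" for m
    by (simp_all add: Y_def lookup_add lookup_single)
  have Y_inj: "Y k = Y m \<longleftrightarrow> k = m" for k m by (metis Y(2,3) prod_eqI)
  define g where "g = (\<Sum>m\<in>S. Poly_Mapping.single (Y m) (\<gamma> m))"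
  have "homogeneous n g"
    unfolding g_def using assms(2) by (intro homogeneous_sum homogeneous_single) (fastforce simp: Y)
  moreover have "Poly_Mapping.lookup g (Y m) = \<gamma> m"
  proof -
    have "Poly_Mapping.lookup g (Y m) = (\<Sum>k\<in>S. if k = m then \<gamma> m else 0)"
      unfolding g_def lookup_sum by (intro sum.cong refl) (auto simp: lookup_single Y_inj)
    then show ?thesis using assms by simp
  qed
  then have "g \<noteq> 0" using assms(4) by auto
  ultimately have "subst3 f0 f1 f2 g \<noteq> 0" by (rule dominant_subst3_nonzero[OF dom])
  then show ?thesis by (simp add: g_def subst3_simps Y mult.assoc)
qed

lemma f0_nonzero: "f0 \<noteq> 0"
  using homogeneous_relation[of "{(0, 0)}" 1 "(0, 0)" "\<lambda>_. 1"] by auto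

lemma lam_not_scalar: "lam \<noteq> scalar c"
proof
  assume "lam = scalar c"
  then have "to_fract f1 = to_fract (Const c * f0)" using f0_nonzero by (simp add: lam_def field_simps)
  then have "f1 = Const c * f0" by (simp only: to_fract_eq_iff)
  moreover have "(\<Sum>m\<in>{(0, 0), (1, 0)}. Const (if m = (0, 0) then - c else 1) * (f0 ^ (1 - fst m - snd m) * f1 ^ fst m * f2 ^ snd m)) \<noteq> 0"
    by (rule homogeneous_relation[of _ _ "(1, 0)"]) auto
  ultimately show False by (simp add: Const_def single_uminus flip: Const_def)
qed

text \<open>
  The ratio \<open>z/w\<close> is algebraic over \<open>K(f\<^sub>1/f\<^sub>0, f\<^sub>2/f\<^sub>0)\<close>, as the transcendence degree suggests. There are
  \<open>(\<kappa> + 1)(n + 1)\<^sup>2\<close> products \<open>z\<^sup>k w\<^sup>\<kappa>\<^sup>-\<^sup>k f\<^sub>0\<^sup>l f\<^sub>1\<^sup>i f\<^sub>2\<^sup>j\<close> with \<open>i, j \<le> n\<close> and \<open>l = 2n - i - j\<close>, in a space whose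
  dimension is about \<open>4 d\<^sub>1 d\<^sub>2 n\<^sup>2\<close>. Thus \<open>\<kappa> = 4 d\<^sub>1 d\<^sub>2\<close> is enough once \<open>n\<close> is large.
\<close>

lemma algebraic_relation:
  assumes z: "bihomogeneous s1 s2 z" and w: "bihomogeneous s1 s2 w" and s: "s1 + s2 = 1"
  shows "\<exists>\<kappa> n \<gamma>. (\<exists>k\<le>\<kappa>. \<exists>m\<in>{..n} \<times> {..n}. \<gamma> k m \<noteq> 0) \<and>
    (\<Sum>k\<le>\<kappa>. \<Sum>m\<in>{..n} \<times> {..n}. Const (\<gamma> k m) * (z ^ k * w ^ (\<kappa> - k)
       * (f0 ^ (2 * n - fst m - snd m) * f1 ^ fst m * f2 ^ snd m))) = 0"
proof -
  define \<kappa> where "\<kappa> = 4 * d1 * d2"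
  \<comment> \<open>Large enough for \<open>n\<^sup>2\<close> to exceed the part of the dimension that is linear in \<open>n\<close>.\<close>
  define n where "n = 2 * (\<kappa> + 1) * (d1 + d2) + 1"
  let ?U = "{..\<kappa>} \<times> ({..n} \<times> {..n})"
  define g where "g = (\<lambda>(k, m). z ^ k * w ^ (\<kappa> - k) * (f0 ^ (2 * n - fst m - snd m) * f1 ^ fst m * f2 ^ snd m))"
  have hom: "bihomogeneous (\<kappa> * s1 + 2 * n * d1) (\<kappa> * s2 + 2 * n * d2) (g u)" if u: "u \<in> ?U" for u
  proof -
    obtain k i j where u: "u = (k, i, j)" "k \<le> \<kappa>" "i \<le> n" "j \<le> n" using u by auto
    have "(k + (\<kappa> - k)) * s = \<kappa> * s" "((2 * n - i - j) + i + j) * s = 2 * n * s" for s using u by auto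
    then show ?thesis
      using bihomogeneous_mult[OF bihomogeneous_mult[OF bihomogeneous_power[OF z, of k] bihomogeneous_power[OF w, of "\<kappa> - k"]]
        bihomogeneous_mult[OF bihomogeneous_mult[OF bihomogeneous_power[OF f_hom(1), of "2 * n - i - j"]
           bihomogeneous_power[OF f_hom(2), of i]] bihomogeneous_power[OF f_hom(3), of j]]]
      unfolding u g_def prod.case fst_conv snd_conv by (simp only: distrib_right)
  qed
  have card: "(\<kappa> * s1 + 2 * n * d1 + 1) * (\<kappa> * s2 + 2 * n * d2 + 1) < card ?U"
  proof -
    have main: "(\<kappa> + 2 * n * d + 1) * (2 * n * e + 1) < (\<kappa> + 1) * ((n + 1) * (n + 1))"
      if de: "\<kappa> = 4 * d * e" "n = 2 * (\<kappa> + 1) * (d + e) + 1" for d e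
    proof -
      have "(\<kappa> + 2 * n * d + 1) * (2 * n * e + 1) = \<kappa> * (n * n) + n * (2 * (\<kappa> + 1) * e + 2 * d) + (\<kappa> + 1)"
        unfolding de(1) by (simp add: algebra_simps)
      also have "n * (2 * (\<kappa> + 1) * e + 2 * d) \<le> n * n"
        by (intro mult_le_mono2) (simp add: de(2) algebra_simps)
      also have "\<kappa> * (n * n) + n * n + (\<kappa> + 1) < (\<kappa> + 1) * ((n + 1) * (n + 1))"
        using de(2) by (simp add: algebra_simps)
      finally show ?thesis by simp
    qed
    have "card ?U = (\<kappa> + 1) * ((n + 1) * (n + 1))" by (simp add: card_cartesian_product)
    moreover from s consider "s1 = 1" "s2 = 0" | "s1 = 0" "s2 = 1" by linarith
    then have "(\<kappa> * s1 + 2 * n * d1 + 1) * (\<kappa> * s2 + 2 * n * d2 + 1) < (\<kappa> + 1) * ((n + 1) * (n + 1))"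
    proof cases
      case 1
      then show ?thesis using main[of d1 d2] by (simp add: \<kappa>_def n_def)
    next
      case 2
      then show ?thesis using main[of d2 d1] by (simp add: \<kappa>_def n_def ac_simps)
    qed
    ultimately show ?thesis by simp
  qed
  have "\<exists>x. (\<exists>u\<in>?U. x u \<noteq> 0) \<and> (\<Sum>u\<in>?U. Const (x u) * g u) = 0"
  proof (rule bihomogeneous_dependent[OF _ card])
    show "finite ?U" by simp
  qed (rule hom)
  then obtain x where x: "\<exists>u\<in>?U. x u \<noteq> 0" "(\<Sum>u\<in>?U. Const (x u) * g u) = 0"
    by (elim exE conjE)
  obtain k m where km: "k \<le> \<kappa>" "m \<in> {..n} \<times> {..n}" "x (k, m) \<noteq> 0" using x(1) by blast
  show ?thesis
  proof (rule exI[of _ \<kappa>], rule exI[of _ n], rule exI[of _ "\<lambda>k m. x (k, m)"], rule conjI)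
    show "\<exists>k\<le>\<kappa>. \<exists>m\<in>{..n} \<times> {..n}. x (k, m) \<noteq> 0" using km by blast
    have "(\<Sum>k\<le>\<kappa>. \<Sum>m\<in>{..n} \<times> {..n}. Const (x (k, m)) * g (k, m)) = 0"
      unfolding sum.cartesian_product using x(2) by (simp only: split_def prod.collapse)
    then show "(\<Sum>k\<le>\<kappa>. \<Sum>m\<in>{..n} \<times> {..n}. Const (x (k, m)) * (z ^ k * w ^ (\<kappa> - k)
       * (f0 ^ (2 * n - fst m - snd m) * f1 ^ fst m * f2 ^ snd m))) = 0"
      by (simp only: g_def prod.case)
  qed
qed

text \<open>
  Modulo a common divisor of \<open>h\<^sub>1\<close> and \<open>h\<^sub>2\<close> one may replace \<open>f\<^sub>1\<close> by \<open>\<lambda> f\<^sub>0\<close> and \<open>f\<^sub>2\<close> by \<open>\<mu> f\<^sub>0\<close> in the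
  algebraic relation. What remains is a power of \<open>f\<^sub>0\<close> times a polynomial in the dehomogenized \<open>z\<close>. Its
  coefficients are the values at \<open>(\<lambda>, \<mu>)\<close> of the polynomials in the relation, and by dominance they are
  not all zero.
\<close>

lemma generic_fibre_relation:
  fixes z w :: "'k xpoly"
  assumes z: "bihomogeneous s1 s2 z" and w: "bihomogeneous s1 s2 w" and s: "s1 + s2 = 1"
    and w1: "dehom w = 1"
  shows "\<exists>k n \<theta>. (\<exists>i\<le>k. \<theta> i \<noteq> 0) \<and>
    (\<forall>g. g dvd h1 \<longrightarrow> g dvd h2 \<longrightarrow> g dvd dehom f0 ^ n * (\<Sum>i\<le>k. [:[:\<theta> i:]:] * dehom z ^ i))"
proof -
  obtain \<kappa> n \<gamma> where \<gamma>: "\<exists>k\<le>\<kappa>. \<exists>m\<in>{..n} \<times> {..n}. \<gamma> k m \<noteq> 0"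
    and rel: "(\<Sum>k\<le>\<kappa>. \<Sum>m\<in>{..n} \<times> {..n}. Const (\<gamma> k m) * (z ^ k * w ^ (\<kappa> - k)
       * (f0 ^ (2 * n - fst m - snd m) * f1 ^ fst m * f2 ^ snd m))) = 0"
    using algebraic_relation[OF z w s] by (elim exE) (erule conjE, rule that)
  let ?S = "{..n} \<times> {..n}"
  define \<theta> where "\<theta> k = (\<Sum>m\<in>?S. scalar (\<gamma> k m) * lam ^ fst m * mu ^ snd m)" for k
  have f0_powers: "a ^ (2 * n) = a ^ (2 * n - fst m - snd m) * a ^ fst m * a ^ snd m"
    if "m \<in> ?S" for m and a :: "'b::comm_monoid_mult"
  proof -
    have "2 * n = (2 * n - fst m - snd m) + fst m + snd m" using that by auto
    then show ?thesis by (metis power_add)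
  qed
  have \<theta>_f0: "to_fract f0 ^ (2 * n) * \<theta> k
      = to_fract (\<Sum>m\<in>?S. Const (\<gamma> k m) * (f0 ^ (2 * n - fst m - snd m) * f1 ^ fst m * f2 ^ snd m))" for k
    unfolding \<theta>_def sum_distrib_left to_fract_sum
  proof (intro sum.cong refl)
    fix m assume m: "m \<in> ?S"
    show "to_fract f0 ^ (2 * n) * (scalar (\<gamma> k m) * lam ^ fst m * mu ^ snd m)
      = to_fract (Const (\<gamma> k m) * (f0 ^ (2 * n - fst m - snd m) * f1 ^ fst m * f2 ^ snd m))"
      unfolding f0_powers[OF m] using f0_nonzero
      by (simp add: lam_def mu_def to_fract_power power_divide)
  qed
  obtain k where k: "k \<le> \<kappa>" "\<exists>m\<in>?S. \<gamma> k m \<noteq> 0" using \<gamma> by blast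
  then obtain m where m: "m \<in> ?S" "\<gamma> k m \<noteq> 0" by blast
  have "(\<Sum>m\<in>?S. Const (\<gamma> k m) * (f0 ^ (2 * n - fst m - snd m) * f1 ^ fst m * f2 ^ snd m)) \<noteq> 0"
    by (rule homogeneous_relation[where \<gamma> = "\<gamma> k" and m = m]) (use m in auto)
  then have "to_fract f0 ^ (2 * n) * \<theta> k \<noteq> 0" unfolding \<theta>_f0 to_fract_eq_0_iff .
  then have \<theta>_nonzero: "\<theta> k \<noteq> 0" by (rule contrapos_nn) (simp only: mult_zero_right)
  have dvd: "g dvd dehom f0 ^ (2 * n) * (\<Sum>i\<le>\<kappa>. [:[:\<theta> i:]:] * dehom z ^ i)"
    if g: "g dvd h1" "g dvd h2" for g
  proof -
    let ?A = "\<lambda>k m. [:[:scalar (\<gamma> k m):]:] * (dehom z ^ k * (dehom f0 ^ (2 * n - fst m - snd m)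
        * dehom f1 ^ fst m * dehom f2 ^ snd m))"
    let ?B = "\<lambda>k m. [:[:scalar (\<gamma> k m):]:] * (dehom z ^ k * (dehom f0 ^ (2 * n - fst m - snd m)
        * ([:[:lam:]:] * dehom f0) ^ fst m * ([:[:mu:]:] * dehom f0) ^ snd m))"
    have zero: "(\<Sum>k\<le>\<kappa>. \<Sum>m\<in>?S. ?A k m) = 0"
      using arg_cong[OF rel, of dehom] by (simp only: dehom_simps dehom_Const w1 power_one mult_1_right)
    have eq: "dehom f0 ^ (2 * n) * (\<Sum>k\<le>\<kappa>. [:[:\<theta> k:]:] * dehom z ^ k) = (\<Sum>k\<le>\<kappa>. \<Sum>m\<in>?S. ?B k m)"
      unfolding sum_distrib_left
    proof (intro sum.cong refl)
      fix k
      have CC: "[:[:sum f S:]:] = (\<Sum>i\<in>S. [:[:f i:]:])" for f :: "nat \<times> nat \<Rightarrow> 'k xpoly fract" and S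
        by (simp add: const_poly_sum)
      have CM: "[:[:a * b:]:] = [:[:a:]:] * [:[:b:]:]" "[:[:a ^ i:]:] = [:[:a:]:] ^ i" for a b :: "'k xpoly fract" and i
        by (simp_all add: poly_const_pow)
      have "dehom f0 ^ (2 * n) * ([:[:\<theta> k:]:] * dehom z ^ k)
          = (\<Sum>m\<in>?S. dehom f0 ^ (2 * n) * ([:[:scalar (\<gamma> k m) * lam ^ fst m * mu ^ snd m:]:] * dehom z ^ k))"
        unfolding \<theta>_def CC sum_distrib_left sum_distrib_right ..
      also have "\<dots> = (\<Sum>m\<in>?S. ?B k m)"
      proof (intro sum.cong refl)
        fix m assume m: "m \<in> ?S"
        show "dehom f0 ^ (2 * n) * ([:[:scalar (\<gamma> k m) * lam ^ fst m * mu ^ snd m:]:] * dehom z ^ k) = ?B k m"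
          unfolding f0_powers[OF m] CM power_mult_distrib by (simp only: mult_ac)
      qed
      finally show "dehom f0 ^ (2 * n) * ([:[:\<theta> k:]:] * dehom z ^ k) = (\<Sum>m\<in>?S. ?B k m)" .
    qed
    have "g dvd (\<Sum>k\<le>\<kappa>. \<Sum>m\<in>?S. ?B k m) - (\<Sum>k\<le>\<kappa>. \<Sum>m\<in>?S. ?A k m)"
    proof -
      have "g dvd - h1" "g dvd - h2" using g by simp_all
      then have l: "g dvd [:[:lam:]:] * dehom f0 - dehom f1" "g dvd [:[:mu:]:] * dehom f0 - dehom f2"
        by (simp_all only: h1_def h2_def minus_diff_eq)
      have r: "g dvd x - x" for x by simp
      have "g dvd ?B k m - ?A k m" if "k \<in> {..\<kappa>}" "m \<in> ?S" for k m
        by (rule dvd_diff_mult[OF r dvd_diff_mult[OF r dvd_diff_mult[OF dvd_diff_mult[OF r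
            dvd_diff_power[OF l(1)]] dvd_diff_power[OF l(2)]]]])
      then have "g dvd (\<Sum>k\<le>\<kappa>. \<Sum>m\<in>?S. ?B k m - ?A k m)"
        by (rule dvd_sum[OF dvd_sum]) assumption
      then show ?thesis unfolding sum_subtractf .
    qed
    then show ?thesis unfolding zero eq diff_zero .
  qed
  show ?thesis
  proof (rule exI[of _ \<kappa>], rule exI[of _ "2 * n"], rule exI[of _ \<theta>], intro conjI allI impI)
    show "\<exists>i\<le>\<kappa>. \<theta> i \<noteq> 0" using k(1) \<theta>_nonzero by blast
  qed (rule dvd)
qed

end


lemma Const_eq_0_iff [simp]: "Const c = 0 \<longleftrightarrow> c = 0"
  using scalar_eq_0_iff[of c] by (simp only: to_fract_eq_0_iff)

section \<open>Coprimality over a finite base locus\<close>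

lemma dehom_Var:
  "dehom (Var X10) = 1" "dehom (Var X20) = 1" "dehom (Var X11) = [:[:0, 1:]:]" "dehom (Var X21) = [:0, 1:]"
  by (simp_all add: Var_def dehom_simps(7) lookup_single monom_0 monom_Suc)

lemma keys_Var_positive_ideal:
  "ideal.subspace {p :: 'k::field xpoly. \<forall>m\<in>Poly_Mapping.keys p. Poly_Mapping.lookup m v > 0}"
proof (rule ideal.subspaceI)
  fix x y :: "'k xpoly"
  assume "x \<in> {p. \<forall>m\<in>Poly_Mapping.keys p. Poly_Mapping.lookup m v > 0}"
    "y \<in> {p. \<forall>m\<in>Poly_Mapping.keys p. Poly_Mapping.lookup m v > 0}"
  then show "x + y \<in> {p. \<forall>m\<in>Poly_Mapping.keys p. Poly_Mapping.lookup m v > 0}"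
    using Poly_Mapping.keys_add[of x y] by blast
next
  fix c x :: "'k xpoly"
  assume x: "x \<in> {p. \<forall>m\<in>Poly_Mapping.keys p. Poly_Mapping.lookup m v > 0}"
  show "c * x \<in> {p. \<forall>m\<in>Poly_Mapping.keys p. Poly_Mapping.lookup m v > 0}"
  proof (intro CollectI ballI)
    fix m assume "m \<in> Poly_Mapping.keys (c * x)"
    then obtain k l where "m = k + l" "l \<in> Poly_Mapping.keys x"
      using keys_mult[of c x] by blast
    with x show "Poly_Mapping.lookup m v > 0" by (simp add: lookup_add)
  qed
qed simp

text \<open>
  The monomials of such a form are distinguished by their power of \<open>z\<close>, so none of them cancels.
\<close>

lemma chart_form_not_divisible:
  fixes c :: "nat \<Rightarrow> 'k::field"
  assumes "z \<noteq> w" "z \<noteq> x" "z \<noteq> y" "v \<notin> {z, w, x, y}" and c: "i \<le> k" "c i \<noteq> 0"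
  shows "\<exists>m\<in>Poly_Mapping.keys ((\<Sum>i\<le>k. Const (c i) * (Var z ^ i * Var w ^ (k - i))) * (Var x ^ n * Var y ^ l)).
    Poly_Mapping.lookup m v = 0"
proof -
  define m where "m i = Poly_Mapping.single z i + Poly_Mapping.single w (k - i)
    + Poly_Mapping.single x n + Poly_Mapping.single y l" for i
  have m: "Poly_Mapping.lookup (m j) z = j" "Poly_Mapping.lookup (m j) v = 0" for j
    using assms by (auto simp: m_def lookup_add lookup_single when_def)
  have "(\<Sum>i\<le>k. Const (c i) * (Var z ^ i * Var w ^ (k - i))) * (Var x ^ n * Var y ^ l)
      = (\<Sum>i\<le>k. Poly_Mapping.single (m i) (c i))"
    unfolding sum_distrib_right Var_power Const_def mult_single
    by (intro sum.cong refl) (simp add: m_def add.assoc)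
  moreover have "Poly_Mapping.lookup (\<Sum>i\<le>k. Poly_Mapping.single (m i) (c i)) (m i) = c i"
  proof -
    have "m j = m i \<longleftrightarrow> j = i" for j using m(1) by metis
    then have "Poly_Mapping.lookup (\<Sum>i\<le>k. Poly_Mapping.single (m i) (c i)) (m i) = (\<Sum>j\<le>k. if j = i then c i else 0)"
      unfolding lookup_sum by (intro sum.cong refl) (auto simp: lookup_single)
    then show ?thesis using c by simp
  qed
  ultimately show ?thesis using c m(2)[of i] by (intro bexI[of _ "m i"]) (simp_all add: in_keys_iff)
qed

lemma chart_ratio:
  assumes "bihomogeneous 1 0 (Var z :: 'k::field xpoly)"
  shows "to_fract (Var z ^ i) / to_fract (Var x ^ i) \<in> chart x y (UNIV :: 'k xpoly set)"
proof -
  have "bihomogeneous i 0 (Var z ^ i :: 'k xpoly)"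
    using bihomogeneous_power[OF assms, of i] by simp
  then show ?thesis unfolding chart_def Fract_conv_to_fract[symmetric]
    by (intro CollectI exI[of _ "Var z ^ i"] exI[of _ i] exI[of _ 0]) simp
qed

lemma chart_ratio':
  assumes "bihomogeneous 0 1 (Var z :: 'k::field xpoly)"
  shows "to_fract (Var z ^ i) / to_fract (Var y ^ i) \<in> chart x y (UNIV :: 'k xpoly set)"
proof -
  have "bihomogeneous 0 i (Var z ^ i :: 'k xpoly)"
    using bihomogeneous_power[OF assms, of i] by simp
  then show ?thesis unfolding chart_def Fract_conv_to_fract[symmetric]
    by (intro CollectI exI[of _ "Var z ^ i"] exI[of _ 0] exI[of _ i]) simp
qed

locale dominant_map_finite = dominant_map f0 f1 f2 d1 d2
  for f0 f1 f2 :: "'k::field xpoly" and d1 d2 :: nat +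
  assumes fin: "finite_base_locus (ideal.span {f0, f1, f2})"
begin

abbreviation "I \<equiv> ideal.span {f0, f1, f2}"

lemma base_locus_relation:
  assumes xy: "x \<in> {X10, X11}" "y \<in> {X20, X21}"
    and v: "\<And>i. to_fract (Var z ^ i) / to_fract (Var w ^ i) \<in> chart x y (UNIV :: 'k xpoly set)"
  shows "\<exists>k c n l. (\<exists>i\<le>k. c i \<noteq> 0) \<and>
    (\<Sum>i\<le>k. Const (c i) * (Var z ^ i * Var w ^ (k - i))) * (Var x ^ n * Var y ^ l) \<in> I"
proof (rule chart_relation[OF _ ideal.subspace_span _ _ v])
  show "quotient_finite_dim (UNIV :: 'k set) (\<lambda>c z. Fraction_Field.Fract (Const c) 1 * z) (chart x y UNIV) (chart x y I)"
    using fin xy unfolding finite_base_locus_def by blast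
qed (use xy bihomogeneous_Var in auto)

lemma common_divisor_base_ideal:
  assumes "g dvd dehom f0" "g dvd dehom f1" "g dvd dehom f2" "p \<in> I"
  shows "g dvd dehom p"
proof -
  obtain a b c where "p = a * f0 + b * f1 + c * f2" using assms(4) unfolding ideal_span3 by blast
  then show ?thesis using assms(1-3) by (simp add: dehom_simps)
qed

text \<open>
  Besides the \<open>f\<^sub>i\<close>, a common divisor divides the relations of the base locus in the chart
  \<open>x\<^sub>1\<^sub>,\<^sub>0 x\<^sub>2\<^sub>,\<^sub>0 \<noteq> 0\<close>, one of which is a polynomial in \<open>x\<close> and the other a polynomial in \<open>y\<close>.
\<close>

lemma no_common_divisor:
  assumes g: "g dvd dehom f0" "g dvd dehom f1" "g dvd dehom f2"
  shows "is_unit g"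
proof -
  have "\<exists>k c n l. (\<exists>i\<le>k. c i \<noteq> 0) \<and>
    (\<Sum>i\<le>k. Const (c i) * (Var X11 ^ i * Var X10 ^ (k - i))) * (Var X10 ^ n * Var X20 ^ l) \<in> I"
    by (rule base_locus_relation[OF _ _ chart_ratio[OF bihomogeneous_Var(2)]]) auto
  then obtain k c n l where k: "\<exists>i\<le>k. c i \<noteq> 0"
    "(\<Sum>i\<le>k. Const (c i) * (Var X11 ^ i * Var X10 ^ (k - i))) * (Var X10 ^ n * Var X20 ^ l) \<in> I"
    by (elim exE) (erule conjE, rule that)
  have "\<exists>k c n l. (\<exists>i\<le>k. c i \<noteq> 0) \<and>
    (\<Sum>i\<le>k. Const (c i) * (Var X21 ^ i * Var X20 ^ (k - i))) * (Var X10 ^ n * Var X20 ^ l) \<in> I"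
    by (rule base_locus_relation[OF _ _ chart_ratio'[OF bihomogeneous_Var(4)]]) auto
  then obtain k' c' n' l' where k': "\<exists>i\<le>k'. c' i \<noteq> 0"
    "(\<Sum>i\<le>k'. Const (c' i) * (Var X21 ^ i * Var X20 ^ (k' - i))) * (Var X10 ^ n' * Var X20 ^ l') \<in> I"
    by (elim exE) (erule conjE, rule that)
  have "g dvd (\<Sum>i\<le>k. [:[:scalar (c i):]:] * [:[:0, 1:]:] ^ i)"
    using common_divisor_base_ideal[OF g k(2)]
    by (simp only: dehom_simps dehom_Var dehom_Const power_one mult_1_right)
  moreover have "g dvd (\<Sum>i\<le>k'. [:[:scalar (c' i):]:] * [:0, 1:] ^ i)"
    using common_divisor_base_ideal[OF g k'(2)]
    by (simp only: dehom_simps dehom_Var dehom_Const power_one mult_1_right)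
  ultimately show ?thesis
    using k(1) k'(1) by (intro unit_if_dvd_inner_and_outer) auto
qed

text \<open>
  The coordinates \<open>x\<close> and \<open>y\<close> are algebraic over \<open>M\<close>, so a common divisor of \<open>h\<^sub>1\<close> and \<open>h\<^sub>2\<close> divides
  \<open>f\<^sub>0\<^sup>n\<close> times a polynomial in \<open>x\<close> and likewise for \<open>y\<close>. It is coprime to \<open>f\<^sub>0\<close>, because what it shares with
  \<open>f\<^sub>0\<close> it shares with \<open>f\<^sub>1\<close> and \<open>f\<^sub>2\<close>.
\<close>

lemma coprime_generic_fibre: "algebraic_semidom_class.coprime h1 h2"
proof (rule algebraic_semidom_class.coprimeI)
  fix g assume g: "g dvd h1" "g dvd h2"
  have cop: "algebraic_semidom_class.coprime g (dehom f0)"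
  proof (rule algebraic_semidom_class.coprimeI)
    fix k assume k: "k dvd g" "k dvd dehom f0"
    have "k dvd h1 + [:[:lam:]:] * dehom f0" "k dvd h2 + [:[:mu:]:] * dehom f0"
      using k g by (blast intro: dvd_add dvd_mult dvd_trans)+
    then show "is_unit k" using k(2) by (intro no_common_divisor) (simp_all only: h1_def h2_def diff_add_cancel)
  qed
  have "\<exists>k n \<theta>. (\<exists>i\<le>k. \<theta> i \<noteq> 0) \<and>
    (\<forall>g. g dvd h1 \<longrightarrow> g dvd h2 \<longrightarrow> g dvd dehom f0 ^ n * (\<Sum>i\<le>k. [:[:\<theta> i:]:] * dehom (Var X11) ^ i))"
    by (rule generic_fibre_relation[OF bihomogeneous_Var(2) bihomogeneous_Var(1) _ dehom_Var(1)]) simp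
  then obtain k n \<theta> where x: "\<exists>i\<le>k. \<theta> i \<noteq> 0"
    "\<forall>g. g dvd h1 \<longrightarrow> g dvd h2 \<longrightarrow> g dvd dehom f0 ^ n * (\<Sum>i\<le>k. [:[:\<theta> i:]:] * dehom (Var X11) ^ i)"
    by (elim exE) (erule conjE, rule that)
  have "\<exists>k n \<theta>. (\<exists>i\<le>k. \<theta> i \<noteq> 0) \<and>
    (\<forall>g. g dvd h1 \<longrightarrow> g dvd h2 \<longrightarrow> g dvd dehom f0 ^ n * (\<Sum>i\<le>k. [:[:\<theta> i:]:] * dehom (Var X21) ^ i))"
    by (rule generic_fibre_relation[OF bihomogeneous_Var(4) bihomogeneous_Var(3) _ dehom_Var(2)]) simp
  then obtain k' n' \<theta>' where y: "\<exists>i\<le>k'. \<theta>' i \<noteq> 0"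
    "\<forall>g. g dvd h1 \<longrightarrow> g dvd h2 \<longrightarrow> g dvd dehom f0 ^ n' * (\<Sum>i\<le>k'. [:[:\<theta>' i:]:] * dehom (Var X21) ^ i)"
    by (elim exE) (erule conjE, rule that)
  have "algebraic_semidom_class.coprime g (dehom f0 ^ n)" "algebraic_semidom_class.coprime g (dehom f0 ^ n')" using cop by simp_all
  note this[THEN coprime_dvd_mult_right_iff, THEN iffD1]
  from this(1)[OF x(2)[rule_format, OF g]] this(2)[OF y(2)[rule_format, OF g]]
  have "g dvd (\<Sum>i\<le>k. [:[:\<theta> i:]:] * dehom (Var X11) ^ i)"
    "g dvd (\<Sum>i\<le>k'. [:[:\<theta>' i:]:] * dehom (Var X21) ^ i)" .
  then show "is_unit g" using x(1) y(1) unfolding dehom_Var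
    by (intro unit_if_dvd_inner_and_outer[of g \<theta> k \<theta>' k'])
qed

lemma coeff_dehom_scalar: "\<exists>c. coeff (coeff (dehom p) j) i = scalar c" if "bihomogeneous a b p"
  for p :: "'k xpoly"
proof (cases "i \<le> a \<and> j \<le> b")
  case True
  then show ?thesis using coeff_dehom_bihomogeneous[OF that] by blast
next
  case False
  then have "coeff (coeff (dehom p) j) i = scalar 0"
    using bidegree_le_dehom[OF that] by (auto simp: bidegree_le_def not_le)
  then show ?thesis by blast
qed

lemma coeff_smult_dehom: "coeff (coeff ([:[:c:]:] * P) j) i = c * coeff (coeff P j) i"
  by simp

lemma coeff_h:
  "coeff (coeff h1 j) i = coeff (coeff (dehom f1) j) i - lam * coeff (coeff (dehom f0) j) i"
  "coeff (coeff h2 j) i = coeff (coeff (dehom f2) j) i - mu * coeff (coeff (dehom f0) j) i"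
  by (simp_all add: h1_def h2_def)

text \<open>
  No cancellation takes place in \<open>f\<^sub>1 - \<lambda> f\<^sub>0\<close>, because \<open>\<lambda>\<close> is not in the ground field while the
  coefficients of \<open>f\<^sub>0\<close> and \<open>f\<^sub>1\<close> are.
\<close>

lemma coeff_h1_nonzero:
  assumes "coeff (coeff (dehom f0) j) i \<noteq> 0" shows "coeff (coeff h1 j) i \<noteq> 0"
proof
  assume zero: "coeff (coeff h1 j) i = 0"
  obtain a b where ab: "coeff (coeff (dehom f0) j) i = scalar a" "coeff (coeff (dehom f1) j) i = scalar b"
    using coeff_dehom_scalar f_hom(1,2) by metis
  then have "lam = scalar b / scalar a" using zero assms by (simp add: coeff_h field_simps)
  also have "\<dots> = scalar (b / a)"
    using assms ab(1) by (simp add: divide_eq_eq flip: scalar_simps(4))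
  finally show False using lam_not_scalar by blast
qed

lemma coeff_h_nonzero:
  assumes "f \<in> {f0, f1, f2}" "coeff (coeff (dehom f) j) i \<noteq> 0"
  shows "coeff (coeff h1 j) i \<noteq> 0 \<or> coeff (coeff h2 j) i \<noteq> 0"
  using assms coeff_h1_nonzero[of j i] by (auto simp: coeff_h)

lemma bidegree_le_h: "bidegree_le d1 d2 h1" "bidegree_le d1 d2 h2"
  unfolding h1_def h2_def by (intro bidegree_le_diff bidegree_le_smult bidegree_le_dehom f_hom)+

lemma h1_nonzero: "h1 \<noteq> 0"
proof -
  obtain m where m: "m \<in> Poly_Mapping.keys f0" using f0_nonzero by fastforce
  then have m': "m \<in> bidegree_monomials d1 d2" using f_hom(1) by (auto simp: bihomogeneous_iff_keys)
  have "coeff (coeff (dehom f0) (Poly_Mapping.lookup m X21)) (Poly_Mapping.lookup m X11) \<noteq> 0"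
    using coeff_dehom_bihomogeneous[OF f_hom(1) affine_monomial_lookup(2,3)[OF m']] m
    by (simp add: affine_monomial_lookup(1)[OF m'] in_keys_iff)
  from coeff_h1_nonzero[OF this] show ?thesis by auto
qed

text \<open>
  If a variable divided all \<open>f\<^sub>i\<close>, its zero set, a line, would lie in the base locus. The chart to look at
  is one that meets this line, with \<open>z/w\<close> a coordinate on the line.
\<close>

lemma exists_key_without:
  assumes "x \<in> {X10, X11}" "y \<in> {X20, X21}" and v: "z \<noteq> w" "z \<noteq> x" "z \<noteq> y" "v \<notin> {z, w, x, y}"
    and "\<And>i. to_fract (Var z ^ i) / to_fract (Var w ^ i) \<in> chart x y (UNIV :: 'k xpoly set)"
  shows "\<exists>f\<in>{f0, f1, f2}. \<exists>m\<in>Poly_Mapping.keys f. Poly_Mapping.lookup m v = 0"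
proof (rule ccontr)
  assume none: "\<not> ?thesis"
  let ?V = "{p :: 'k xpoly. \<forall>m\<in>Poly_Mapping.keys p. Poly_Mapping.lookup m v > 0}"
  have "{f0, f1, f2} \<subseteq> ?V" using none by auto
  then have I: "I \<subseteq> ?V" by (rule ideal.span_minimal[OF _ keys_Var_positive_ideal])
  have "\<exists>k c n l. (\<exists>i\<le>k. c i \<noteq> 0) \<and>
    (\<Sum>i\<le>k. Const (c i) * (Var z ^ i * Var w ^ (k - i))) * (Var x ^ n * Var y ^ l) \<in> I"
    by (rule base_locus_relation) (use assms in auto)
  then obtain k c n l i where "i \<le> k" "c i \<noteq> 0"
    "(\<Sum>i\<le>k. Const (c i) * (Var z ^ i * Var w ^ (k - i))) * (Var x ^ n * Var y ^ l) \<in> I"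
    by (elim exE conjE) (rule that)
  then show False using chart_form_not_divisible[OF v, of i k c n l] I by fastforce
qed

text \<open>
  Affine coordinates do not see a common factor \<open>x\<^sub>1\<^sub>,\<^sub>0\<close> or \<open>x\<^sub>2\<^sub>,\<^sub>0\<close>. Its absence means that one of \<open>h\<^sub>1, h\<^sub>2\<close>
  attains the full degree \<open>d\<^sub>1\<close> in \<open>x\<close>, and one of them the full degree \<open>d\<^sub>2\<close> in \<open>y\<close>.
\<close>

lemma inner_top_coeff: "(\<exists>j. coeff (coeff h1 j) d1 \<noteq> 0) \<or> (\<exists>j. coeff (coeff h2 j) d1 \<noteq> 0)"
proof -
  have "\<exists>f\<in>{f0, f1, f2}. \<exists>m\<in>Poly_Mapping.keys f. Poly_Mapping.lookup m X10 = 0"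
    by (rule exists_key_without[of X11 X20 X21 X20, OF _ _ _ _ _ _ chart_ratio'[OF bihomogeneous_Var(4)]]) auto
  then obtain f m where fm: "f \<in> {f0, f1, f2}" "m \<in> Poly_Mapping.keys f" "Poly_Mapping.lookup m X10 = 0" by blast
  have f: "bihomogeneous d1 d2 f" using fm(1) f_hom by auto
  then have m: "m \<in> bidegree_monomials d1 d2" using fm(2) by (auto simp: bihomogeneous_iff_keys)
  have "Poly_Mapping.lookup m X11 = d1" using m fm(3) by (simp add: bidegree_monomials_def deg1_def)
  then have "coeff (coeff (dehom f) (Poly_Mapping.lookup m X21)) d1 \<noteq> 0"
    using coeff_dehom_bihomogeneous[OF f affine_monomial_lookup(2,3)[OF m]] fm(2)
      affine_monomial_lookup(1)[OF m]
    by (simp add: in_keys_iff)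
  from coeff_h_nonzero[OF fm(1) this] show ?thesis by blast
qed

lemma outer_top_coeff: "coeff h1 d2 \<noteq> 0 \<or> coeff h2 d2 \<noteq> 0"
proof -
  have "\<exists>f\<in>{f0, f1, f2}. \<exists>m\<in>Poly_Mapping.keys f. Poly_Mapping.lookup m X20 = 0"
    by (rule exists_key_without[of X10 X21 X11 X10, OF _ _ _ _ _ _ chart_ratio[OF bihomogeneous_Var(2)]]) auto
  then obtain f m where fm: "f \<in> {f0, f1, f2}" "m \<in> Poly_Mapping.keys f" "Poly_Mapping.lookup m X20 = 0" by blast
  have f: "bihomogeneous d1 d2 f" using fm(1) f_hom by auto
  then have m: "m \<in> bidegree_monomials d1 d2" using fm(2) by (auto simp: bihomogeneous_iff_keys)
  have "Poly_Mapping.lookup m X21 = d2" using m fm(3) by (simp add: bidegree_monomials_def deg2_def)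
  then have "coeff (coeff (dehom f) d2) (Poly_Mapping.lookup m X11) \<noteq> 0"
    using coeff_dehom_bihomogeneous[OF f affine_monomial_lookup(2,3)[OF m]] fm(2)
      affine_monomial_lookup(1)[OF m]
    by (simp add: in_keys_iff)
  from coeff_h_nonzero[OF fm(1) this] show ?thesis by auto
qed

text \<open>
  By coprimality \<open>B = C h\<^sub>1\<close> and \<open>A = - C h\<^sub>2\<close>, and as the degrees \<open>d\<^sub>1\<close> and \<open>d\<^sub>2\<close> are attained, \<open>C\<close> has
  bidegree at most \<open>(a0, b0)\<close>. If \<open>C\<close> were nonzero, the lexicographically leading term of \<open>C h\<^sub>1\<close> would
  sit at one of the positions where the coefficients of \<open>B\<close> are required to vanish. There are
  as many such positions as dimensions in the space of the \<open>C\<close>, and so this requirement costs as many equations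
  as there are trivial relations.
\<close>

lemma bounded_syzygy_trivial:
  assumes bidegree_le: "bidegree_le (a0 + d1) (b0 + d2) A" "bidegree_le (a0 + d1) (b0 + d2) B"
    and syz: "A * h1 + B * h2 = 0"
    and lead: "\<And>i j. i \<le> a0 \<Longrightarrow> j \<le> b0 \<Longrightarrow>
      coeff (coeff B (j + degree h1)) (i + degree (lead_coeff h1)) = 0"
  shows "A = 0 \<and> B = 0"
proof -
  have Ah: "A * h1 = - (B * h2)" using syz by (simp add: eq_neg_iff_add_eq_0)
  then have "h1 dvd B * h2" by (metis dvd_minus_iff dvd_triv_right)
  then have "h1 dvd B" using coprime_generic_fibre by (simp add: coprime_dvd_mult_left_iff)
  then obtain C where C: "B = C * h1" by (metis dvd_def mult.commute)
  have "A * h1 = (- (C * h2)) * h1" unfolding Ah C by (simp add: ac_simps)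
  then have A: "A = - (C * h2)" using h1_nonzero by (simp only: mult_cancel_right) simp
  have "C = 0"
  proof (rule ccontr)
    assume nz: "C \<noteq> 0"
    have bidegrees: "bidegree_le (a0 + d1) (b0 + d2) (C * h1)" "bidegree_le (a0 + d1) (b0 + d2) (C * h2)"
      using bidegree_le unfolding A C by (simp_all add: bidegree_le_def)
    have y: "degree C \<le> b0"
      using outer_top_coeff
        outer_degree_quotient[OF bidegree_le_h(1) _ bidegrees(1) nz] outer_degree_quotient[OF bidegree_le_h(2) _ bidegrees(2) nz]
      by fastforce
    have x: "degree (coeff C j) \<le> a0" for j
      using inner_top_coeff
        inner_degree_quotient[OF bidegree_le_h(1) _ bidegrees(1) nz] inner_degree_quotient[OF bidegree_le_h(2) _ bidegrees(2) nz]
      by fastforce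
    have "coeff (coeff B (degree C + degree h1)) (degree (lead_coeff C) + degree (lead_coeff h1))
       = lead_coeff (lead_coeff C) * lead_coeff (lead_coeff h1)"
      unfolding C coeff_mult_degree_sum ..
    then have "coeff (coeff B (degree C + degree h1)) (degree (lead_coeff C) + degree (lead_coeff h1)) \<noteq> 0"
      using nz h1_nonzero by simp
    then show False using lead[OF x y] by blast
  qed
  then show ?thesis using A C by simp
qed

lemma generic_point_on_fibre: "at_generic_point h1 = 0" "at_generic_point h2 = 0"
proof -
  let ?t = "to_fract (Var X10 ^ d1 * Var X20 ^ d2) :: 'k xpoly fract"
  have t: "?t \<noteq> 0" by simp
  have "at_generic_point h1 * ?t = to_fract f1 - lam * to_fract f0"
    by (simp only: h1_def at_generic_point_simps left_diff_distrib mult.assoc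
        dehom_at_generic_point[OF f_hom(1)] dehom_at_generic_point[OF f_hom(2)])
  then show "at_generic_point h1 = 0" using t f0_nonzero by (simp add: lam_def)
  have "at_generic_point h2 * ?t = to_fract f2 - mu * to_fract f0"
    by (simp only: h2_def at_generic_point_simps left_diff_distrib mult.assoc
        dehom_at_generic_point[OF f_hom(1)] dehom_at_generic_point[OF f_hom(3)])
  then show "at_generic_point h2 = 0" using t f0_nonzero by (simp add: mu_def)
qed

end

section \<open>Counting dimensions on the generic fibre\<close>

text \<open>
  The extension is read off from the coefficients of \<open>x\<^sup>i y\<^sup>j\<close> with \<open>i \<le> a\<close> and \<open>j \<le> b\<close>, weighted by the
  values of \<open>\<psi>\<close> at the corresponding monomials of bidegree \<open>(a, b)\<close>.
\<close>

lemma functional_base_change: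
  fixes \<psi> :: "'k::field xpoly \<Rightarrow> 'k"
  assumes add: "\<And>x y. \<psi> (x + y) = \<psi> x + \<psi> y" and scale: "\<And>c x. \<psi> (Const c * x) = c * \<psi> x"
  shows "\<exists>\<Psi> :: 'k xpoly fract poly poly \<Rightarrow> 'k xpoly fract. (\<forall>P Q. \<Psi> (P + Q) = \<Psi> P + \<Psi> Q) \<and>
    (\<forall>c P. \<Psi> ([:[:c:]:] * P) = c * \<Psi> P) \<and>
    (\<forall>p. bihomogeneous a b p \<longrightarrow> \<Psi> (dehom p) = scalar (\<psi> p))"
proof -
  define s where "s = (\<lambda>(i, j). \<psi> (Poly_Mapping.single (affine_monomial a b i j) 1))"
  define \<Psi> where "\<Psi> P = (\<Sum>u\<in>{..a} \<times> {..b}. coeff (coeff P (snd u)) (fst u) * scalar (s u))"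
    for P :: "'k xpoly fract poly poly"
  have \<psi>0: "\<psi> 0 = 0" using scale[of 0 0] by simp
  have \<psi>sum: "\<psi> (sum f A) = (\<Sum>u\<in>A. \<psi> (f u))" for f :: "nat \<times> nat \<Rightarrow> 'k xpoly" and A
    by (induction A rule: infinite_finite_induct) (simp_all add: \<psi>0 add)
  have tsum: "scalar (sum f A) = (\<Sum>u\<in>A. scalar (f u))" for f :: "nat \<times> nat \<Rightarrow> 'k" and A
    by (induction A rule: infinite_finite_induct) (simp_all add: scalar_simps)
  have "\<Psi> (dehom p) = scalar (\<psi> p)" if p: "bihomogeneous a b p" for p
  proof -
    have "p = (\<Sum>m\<in>bidegree_monomials a b. Poly_Mapping.single m (Poly_Mapping.lookup p m))"
      using p by (intro poly_mapping_sum_monomials finite_bidegree_monomials) (simp add: bihomogeneous_iff_keys)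
    also have "\<dots> = (\<Sum>u\<in>{..a} \<times> {..b}. Poly_Mapping.single (affine_monomial a b (fst u) (snd u))
        (Poly_Mapping.lookup p (affine_monomial a b (fst u) (snd u))))"
      by (subst sum.reindex_bij_betw[OF bij_bidegree_monomials, symmetric]) (simp add: split_def)
    also have "\<dots> = (\<Sum>u\<in>{..a} \<times> {..b}. Const (Poly_Mapping.lookup p (affine_monomial a b (fst u) (snd u)))
        * Poly_Mapping.single (affine_monomial a b (fst u) (snd u)) 1)"
      by (simp add: Const_def mult_single)
    finally have "\<psi> p = \<psi> (\<Sum>u\<in>{..a} \<times> {..b}. Const (Poly_Mapping.lookup p (affine_monomial a b (fst u) (snd u)))
        * Poly_Mapping.single (affine_monomial a b (fst u) (snd u)) 1)"
      by (rule arg_cong)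
    also have "\<dots> = (\<Sum>u\<in>{..a} \<times> {..b}. Poly_Mapping.lookup p (affine_monomial a b (fst u) (snd u)) * s u)"
      unfolding \<psi>sum scale s_def split_def ..
    finally show ?thesis unfolding \<Psi>_def
      by (simp only: tsum scalar_simps(4)) (intro sum.cong refl, auto simp: coeff_dehom_bihomogeneous[OF p])
  qed
  moreover have "\<Psi> (P + Q) = \<Psi> P + \<Psi> Q" for P Q
    by (simp add: \<Psi>_def distrib_right sum.distrib)
  moreover have "\<Psi> ([:[:c:]:] * P) = c * \<Psi> P" for c P
    by (simp add: \<Psi>_def sum_distrib_left mult.assoc)
  ultimately show ?thesis by (intro exI[of _ \<Psi>]) simp
qed


context dominant_map_finite
begin

text \<open>
  With \<open>a' = a0 + d1\<close>, \<open>a = a' + d1\<close> and likewise for \<open>b\<close>, the relations between the \<open>D + r\<close> given elements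
  and the multiples of \<open>h\<^sub>1\<close> and \<open>h\<^sub>2\<close> in bidegree \<open>(a, b)\<close> have \<open>D + r + 2 (a' + 1) (b' + 1)\<close> unknowns. They
  have to satisfy \<open>(a + 1) (b + 1)\<close> equations for the coefficients and \<open>(a0 + 1) (b0 + 1)\<close> equations that
  exclude trivial relations, which makes \<open>2 d1 d2 + 2 (a' + 1) (b' + 1)\<close> equations.
\<close>

lemma independent_count_le:
  fixes e :: "nat \<Rightarrow> 'k xpoly fract" and q :: "nat \<Rightarrow> 'k xpoly"
  assumes e: "\<And>i. i < D \<Longrightarrow> e i \<in> function_field"
    and e_indep: "\<And>c. (\<And>i. i < D \<Longrightarrow> c i \<in> pullback_field f0 f1 f2) \<Longrightarrow>
      (\<Sum>i<D. c i * e i) = 0 \<Longrightarrow> \<forall>i<D. c i = 0"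
    and q: "independent_mod (saturation I) q {..<r}" "\<And>i. i < r \<Longrightarrow> bihomogeneous d1 d2 (q i)"
  shows "D + r \<le> 2 * d1 * d2"
proof (rule ccontr)
  assume "\<not> ?thesis"
  then have gt: "2 * d1 * d2 < D + r" by simp
  let ?M = "pullback_field f0 f1 f2"
  note M = subfield_pullback_field[OF dom]
  have "\<exists>a b P Q. Q \<noteq> 0 \<and> bihomogeneous a b Q \<and>
    (\<forall>i\<in>{..<D}. bihomogeneous a b (P i) \<and> e i = to_fract (P i) / to_fract Q)"
    using e by (intro function_field_common_denominator) auto
  then obtain a0 b0 P Q where Q: "Q \<noteq> 0"
    and PQ: "\<forall>i\<in>{..<D}. bihomogeneous a0 b0 (P i) \<and> e i = to_fract (P i) / to_fract Q"
    by (elim exE conjE) (rule that)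
  then have P: "bihomogeneous a0 b0 (P i)" "e i = to_fract (P i) / to_fract Q" if "i < D" for i
    using that by auto
  define a' b' a b where "a' = a0 + d1" "b' = b0 + d2" "a = a' + d1" "b = b' + d2"
  note ab = this
  define p where "p i = P i * (Var X10 ^ d1 * Var X20 ^ d2) * f0" for i
  have X: "bihomogeneous d1 d2 (Var X10 ^ d1 * Var X20 ^ d2 :: 'k xpoly)"
    using bihomogeneous_mult[OF bihomogeneous_power[OF bihomogeneous_Var(1), of d1]
        bihomogeneous_power[OF bihomogeneous_Var(3), of d2]] by simp
  have p: "bihomogeneous a b (p i)" if "i < D" for i
    unfolding p_def ab by (intro bihomogeneous_mult P(1) that X f_hom)
  have "\<exists>q'. independent_mod (saturation I) q' {..<r} \<and> (\<forall>i<r. bihomogeneous (d1 + a') (d2 + b') (q' i))"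
    using q by (intro independent_mod_saturation_growth ideal.subspace_span) auto
  then obtain q' where q': "independent_mod (saturation I) q' {..<r}"
    "\<And>i. i < r \<Longrightarrow> bihomogeneous a b (q' i)" unfolding ab by (auto simp: add.commute)
  have q'_indep: "independent_mod I q' {..<r}"
    by (rule independent_mod_mono[OF q'(1) ideal_subset_saturation[OF ideal.subspace_span]])
  define mon :: "nat \<times> nat \<Rightarrow> 'k xpoly" where
    "mon u = Poly_Mapping.single (affine_monomial a' b' (fst u) (snd u)) 1" for u
  let ?B = "{..a'} \<times> {..b'}"
  have mon_hom: "bihomogeneous a' b' (mon u)" if "u \<in> ?B" for u
    using that affine_monomial_in[of "fst u" a' "snd u" b']
    by (auto simp: mon_def bihomogeneous_iff_keys)
  have mon_f: "bihomogeneous a b (mon u * f0)" "bihomogeneous a b (mon u * f1)" "bihomogeneous a b (mon u * f2)"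
    if "u \<in> ?B" for u
    unfolding ab(3,4) by (intro bihomogeneous_mult mon_hom that f_hom)+
  have mon_I: "mon u * f0 \<in> I" "mon u * f1 \<in> I" "mon u * f2 \<in> I" for u
    by (intro ideal.span_scale ideal.span_base; simp)+
  have dehom_mon: "dehom (mon u) = monom (monom 1 (fst u)) (snd u)" for u
    by (simp add: mon_def dehom_simps(7))
  have mon_h: "dehom (mon u) * h1 = dehom (mon u * f1) - [:[:lam:]:] * dehom (mon u * f0)"
    "dehom (mon u) * h2 = dehom (mon u * f2) - [:[:mu:]:] * dehom (mon u * f0)" for u
    unfolding h1_def h2_def dehom_simps right_diff_distrib by (simp_all only: mult.left_commute)
  define gen :: "nat + nat + (nat \<times> nat) + (nat \<times> nat) \<Rightarrow> 'k xpoly fract poly poly" where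
    "gen u = (case u of Inl i \<Rightarrow> dehom (p i) | Inr (Inl j) \<Rightarrow> dehom (q' j)
      | Inr (Inr (Inl v)) \<Rightarrow> dehom (mon v) * h1 | Inr (Inr (Inr v)) \<Rightarrow> dehom (mon v) * h2)" for u
  \<comment> \<open>The four kinds of unknowns: the coefficients of the \<open>e\<^sub>i\<close>, of the \<open>q\<^sub>j\<close>, and those of \<open>A\<close> and \<open>B\<close>.\<close>
  define U where "U = {..<D} <+> ({..<r} <+> (?B <+> ?B))"
  have gen_bidegree: "bidegree_le a b (gen u)" if "u \<in> U" for u
  proof -
    have "bidegree_le a b (dehom (mon v) * h1)" "bidegree_le a b (dehom (mon v) * h2)" if "v \<in> ?B" for v
      unfolding mon_h by (intro bidegree_le_diff bidegree_le_smult bidegree_le_dehom mon_f that)+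
    then show ?thesis using that p q'(2)
      by (auto simp: U_def gen_def bidegree_le_dehom)
  qed
  have M_dehom: "coeff (coeff (dehom x) j) i \<in> ?M" if "bihomogeneous a b x" for x i j
    using coeff_dehom_scalar[OF that, of j i] pullback_field_elements(1) by metis
  have gen_M: "coeff (coeff (gen u) j) i \<in> ?M" if u: "u \<in> U" for u i j
  proof -
    have "coeff (coeff (dehom (mon v) * h1) j) i \<in> ?M" "coeff (coeff (dehom (mon v) * h2) j) i \<in> ?M"
      if "v \<in> ?B" for v
      unfolding mon_h coeff_diff coeff_smult_dehom lam_def mu_def
      by (intro subfield_diff[OF M] subfield_mult[OF M] M_dehom mon_f that pullback_field_elements)+
    then show ?thesis using u M_dehom p q'(2)
      by (auto simp: U_def gen_def)
  qed
  define A :: "(nat \<times> nat) + (nat \<times> nat) \<Rightarrow> nat + nat + (nat \<times> nat) + (nat \<times> nat) \<Rightarrow> 'k xpoly fract" where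
    "A eq u = (case eq of Inl v \<Rightarrow> coeff (coeff (gen u) (snd v)) (fst v)
      | Inr v \<Rightarrow> (if u = Inr (Inr (Inr (fst v + degree (lead_coeff h1), snd v + degree h1))) then 1 else 0))" for eq u
  \<comment> \<open>One equation for each coefficient in bidegree \<open>(a, b)\<close>, one for each leading position of a trivial relation.\<close>
  define E where "E = ({..a} \<times> {..b}) <+> ({..a0} \<times> {..b0})"
  have cards: "card E < card U"
  proof -
    have "card E = (a + 1) * (b + 1) + (a0 + 1) * (b0 + 1)"
      by (simp add: E_def card_Plus card_cartesian_product)
    moreover have "card U = D + r + 2 * ((a' + 1) * (b' + 1))"
      by (simp add: U_def card_Plus card_cartesian_product)
    moreover have "(a + 1) * (b + 1) + (a0 + 1) * (b0 + 1) = 2 * d1 * d2 + 2 * ((a' + 1) * (b' + 1))"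
      unfolding ab by (simp add: algebra_simps)
    ultimately show ?thesis using gt by linarith
  qed
  have fin: "finite E" "finite U" by (simp_all add: E_def U_def)
  have A_M: "A eq u \<in> ?M" if "eq \<in> E" "u \<in> U" for eq u
    using that(2) gen_M subfield_0[OF M] subfield_1[OF M] by (auto simp: A_def split: sum.split)
  have "\<exists>x. (\<forall>u. x u \<in> ?M) \<and> (\<exists>u\<in>U. x u \<noteq> 0) \<and> (\<forall>eq\<in>E. (\<Sum>u\<in>U. A eq u * x u) = 0)"
    by (rule underdetermined_system_solvable[OF M fin cards]) (rule A_M)
  then obtain x where x: "\<forall>u. x u \<in> ?M" "\<exists>u\<in>U. x u \<noteq> 0" "\<forall>eq\<in>E. (\<Sum>u\<in>U. A eq u * x u) = 0"
    by (elim exE) (erule conjE, erule conjE, rule that)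
  have sumU: "sum f U = (\<Sum>i<D. f (Inl i)) + ((\<Sum>j<r. f (Inr (Inl j)))
      + ((\<Sum>v\<in>?B. f (Inr (Inr (Inl v)))) + (\<Sum>v\<in>?B. f (Inr (Inr (Inr v))))))"
    for f :: "nat + nat + (nat \<times> nat) + (nat \<times> nat) \<Rightarrow> 'z::comm_monoid_add"
    unfolding U_def by (simp add: sum.Plus)
  have total: "(\<Sum>u\<in>U. [:[:x u:]:] * gen u) = 0"
  proof (rule bidegree_le_eqI)
    show "bidegree_le a b (\<Sum>u\<in>U. [:[:x u:]:] * gen u)"
      by (intro bidegree_le_sum bidegree_le_smult gen_bidegree)
    fix i j assume "i \<le> a" "j \<le> b"
    then have "Inl (i, j) \<in> E" by (auto simp: E_def)
    from bspec[OF x(3) this] show "coeff (coeff (\<Sum>u\<in>U. [:[:x u:]:] * gen u) j) i = 0"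
      by (simp add: coeff_sum A_def mult.commute)
  qed
  have zero2: "x (Inr (Inr (Inl u))) = 0 \<and> x (Inr (Inr (Inr u))) = 0" if u: "u \<in> ?B"
    and zero1: "\<And>i. i < D \<Longrightarrow> x (Inl i) = 0" "\<And>j. j < r \<Longrightarrow> x (Inr (Inl j)) = 0" for u
  proof -
    define S where "S y = (\<Sum>v\<in>?B. [:[:y v:]:] * dehom (mon v))" for y :: "nat \<times> nat \<Rightarrow> 'k xpoly fract"
    have coeff_S: "coeff (coeff (S y) j) i = (if i \<le> a' \<and> j \<le> b' then y (i, j) else 0)" for y i j
    proof -
      have "coeff (coeff (S y) j) i = (\<Sum>v\<in>?B. if v = (i, j) then y (i, j) else 0)"
        unfolding S_def dehom_mon coeff_sum by (intro sum.cong refl) (auto simp: prod_eq_iff)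
      then show ?thesis by (auto simp: sum.delta)
    qed
    let ?y1 = "\<lambda>v. x (Inr (Inr (Inl v)))" and ?y2 = "\<lambda>v. x (Inr (Inr (Inr v)))"
    have "S ?y1 = 0 \<and> S ?y2 = 0"
    proof (rule bounded_syzygy_trivial)
      show "bidegree_le (a0 + d1) (b0 + d2) (S ?y1)" "bidegree_le (a0 + d1) (b0 + d2) (S ?y2)"
        by (simp_all add: bidegree_le_def coeff_S ab)
      show "S ?y1 * h1 + S ?y2 * h2 = 0"
        using total zero1 unfolding sumU gen_def S_def sum_distrib_right by (simp add: mult.assoc)
    next
      fix i j assume ij: "i \<le> a0" "j \<le> b0"
      let ?w = "(i + degree (lead_coeff h1), j + degree h1)"
      have "degree h1 \<le> d2" "degree (lead_coeff h1) \<le> d1" using degrees_le_of_bidegree[OF bidegree_le_h(1)] by auto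
      then have w: "?w \<in> ?B" using ij by (simp add: ab)
      have "Inr (i, j) \<in> E" using ij by (auto simp: E_def)
      from bspec[OF x(3) this] have "(\<Sum>v\<in>?B. if v = ?w then ?y2 ?w else 0) = 0"
        unfolding sumU A_def by (simp add: if_distrib[of "\<lambda>c. c * _"] cong: if_cong)
      then have "?y2 ?w = 0" using w by (simp only: sum.delta finite_cartesian_product finite_atMost if_True)
      then show "coeff (coeff (S ?y2) (j + degree h1)) (i + degree (lead_coeff h1)) = 0"
        unfolding coeff_S by simp
    qed
    then show ?thesis using coeff_S[of ?y1 "snd u" "fst u"] coeff_S[of ?y2 "snd u" "fst u"] u by auto
  qed
  \<comment> \<open>The functionals vanish on all generators of the relation except the \<open>q\<^sub>j\<close>, since the others come from \<open>I\<close>.\<close>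
  have zero_e: "x (Inr (Inl s)) = 0" if s: "s < r" for s
  proof -
    have "\<exists>\<psi>. (\<forall>x y. \<psi> (x + y) = \<psi> x + \<psi> y) \<and> (\<forall>c x. \<psi> (Const c * x) = c * \<psi> x) \<and>
      (\<forall>x\<in>I. \<psi> x = (0::'k)) \<and> (\<forall>t\<in>{..<r}. \<psi> (q' t) = (if t = s then 1 else 0))"
      using s by (intro functional_dual_mod[OF ideal.subspace_span _ q'_indep]) auto
    then obtain \<psi> where \<psi>_props: "\<forall>x y. \<psi> (x + y) = \<psi> x + \<psi> y" "\<forall>c x. \<psi> (Const c * x) = c * \<psi> x"
      "\<forall>x\<in>I. \<psi> x = (0::'k)" "\<forall>t\<in>{..<r}. \<psi> (q' t) = (if t = s then 1 else 0)"
      by (elim exE conjE) (rule that)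
    then have \<psi>: "\<And>x y. \<psi> (x + y) = \<psi> x + \<psi> y" "\<And>c x. \<psi> (Const c * x) = c * \<psi> x"
      "\<And>x. x \<in> I \<Longrightarrow> \<psi> x = (0::'k)" "\<And>t. t < r \<Longrightarrow> \<psi> (q' t) = (if t = s then 1 else 0)"
      by simp_all
    obtain \<Psi> :: "'k xpoly fract poly poly \<Rightarrow> 'k xpoly fract" where
      \<Psi>: "\<forall>P Q. \<Psi> (P + Q) = \<Psi> P + \<Psi> Q" "\<forall>c P. \<Psi> ([:[:c:]:] * P) = c * \<Psi> P"
        "\<forall>p. bihomogeneous a b p \<longrightarrow> \<Psi> (dehom p) = scalar (\<psi> p)"
      using functional_base_change[of \<psi> a b, OF \<psi>(1,2)] by (elim exE conjE) (rule that)
    have \<Psi>0: "\<Psi> 0 = 0" using \<Psi>(2)[rule_format, of 0 0] by simp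
    have \<Psi>diff: "\<Psi> (P - Q) = \<Psi> P - \<Psi> Q" for P Q
      using \<Psi>(1)[rule_format, of "P - Q" Q] by simp
    have \<Psi>sum: "\<Psi> (sum f V) = (\<Sum>u\<in>V. \<Psi> (f u))" for f :: "nat + nat + (nat \<times> nat) + (nat \<times> nat) \<Rightarrow> 'k xpoly fract poly poly" and V
      by (induction V rule: infinite_finite_induct) (simp_all add: \<Psi>0 \<Psi>(1))
    have \<Psi>I: "\<Psi> (dehom y) = 0" if "bihomogeneous a b y" "y \<in> I" for y
      using \<Psi>(3)[rule_format, OF that(1)] \<psi>(3)[OF that(2)] by simp
    have "p i \<in> I" for i unfolding p_def by (intro ideal.span_scale ideal.span_base) simp
    then have g1: "\<Psi> (gen (Inl i)) = 0" if "i < D" for i using \<Psi>I p[OF that] by (simp add: gen_def)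
    have g2: "\<Psi> (gen (Inr (Inl j))) = (if j = s then 1 else 0)" if "j < r" for j
      using \<Psi>(3)[rule_format, OF q'(2)[OF that]] \<psi>(4)[OF that] by (simp add: gen_def)
    have g3: "\<Psi> (gen (Inr (Inr (Inl v)))) = 0" "\<Psi> (gen (Inr (Inr (Inr v)))) = 0" if "v \<in> ?B" for v
      unfolding gen_def sum.case mon_h \<Psi>diff \<Psi>(2)[rule_format]
      using \<Psi>I[OF mon_f(1)[OF that] mon_I(1)] \<Psi>I[OF mon_f(2)[OF that] mon_I(2)] \<Psi>I[OF mon_f(3)[OF that] mon_I(3)]
      by simp_all
    have "0 = (\<Sum>u\<in>U. x u * \<Psi> (gen u))"
      using arg_cong[OF total, of \<Psi>] unfolding \<Psi>sum \<Psi>(2)[rule_format] \<Psi>0 by simp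
    also have "\<dots> = (\<Sum>j<r. if j = s then x (Inr (Inl s)) else 0)"
    proof -
      have "(\<Sum>i<D. x (Inl i) * \<Psi> (gen (Inl i))) = 0"
        "(\<Sum>v\<in>?B. x (Inr (Inr (Inl v))) * \<Psi> (gen (Inr (Inr (Inl v))))) = 0"
        "(\<Sum>v\<in>?B. x (Inr (Inr (Inr v))) * \<Psi> (gen (Inr (Inr (Inr v))))) = 0"
        by (intro sum.neutral ballI; simp add: g1 g3)+
      moreover have "(\<Sum>j<r. x (Inr (Inl j)) * \<Psi> (gen (Inr (Inl j)))) = (\<Sum>j<r. if j = s then x (Inr (Inl s)) else 0)"
        by (intro sum.cong refl) (auto simp: g2)
      ultimately show ?thesis by (simp only: sumU add_0_right add_0_left)
    qed
    also have "\<dots> = x (Inr (Inl s))" using s by simp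
    finally show ?thesis by simp
  qed
  \<comment> \<open>At the generic point \<open>h\<^sub>1\<close> and \<open>h\<^sub>2\<close> vanish, and up to a common factor \<open>p i\<close> takes the value \<open>e i\<close>.\<close>
  have zero_c: "\<forall>i<D. x (Inl i) = 0"
  proof (rule e_indep)
    show "x (Inl i) \<in> ?M" for i using x(1) ..
    let ?t = "to_fract (Var X10 ^ a * Var X20 ^ b) :: 'k xpoly fract"
    let ?d = "to_fract (Q * (Var X10 ^ d1 * Var X20 ^ d2) * f0)"
    have p_eval: "at_generic_point (dehom (p i)) * ?t = ?d * e i" if "i < D" for i
      using Q P(2)[OF that] unfolding dehom_at_generic_point[OF p[OF that]]
      by (simp add: p_def)
    have "at_generic_point (\<Sum>u\<in>U. [:[:x u:]:] * gen u) * ?t = (\<Sum>i<D. x (Inl i) * (at_generic_point (dehom (p i)) * ?t))"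
      unfolding at_generic_point_simps sumU
      by (simp add: zero_e gen_def at_generic_point_simps generic_point_on_fibre sum_distrib_right mult.assoc
          del: mult_pCons_left)
    also have "\<dots> = ?d * (\<Sum>i<D. x (Inl i) * e i)"
      unfolding sum_distrib_left
    proof (intro sum.cong refl)
      fix i assume "i \<in> {..<D}"
      then have "at_generic_point (dehom (p i)) * ?t = ?d * e i" by (intro p_eval) simp
      then show "x (Inl i) * (at_generic_point (dehom (p i)) * ?t) = ?d * (x (Inl i) * e i)"
        by (simp only: mult.left_commute)
    qed
    finally have "?d * (\<Sum>i<D. x (Inl i) * e i) = 0"
      unfolding total by (simp add: at_generic_point_simps)
    moreover have "?d \<noteq> 0" using Q f0_nonzero by simp
    ultimately show "(\<Sum>i<D. x (Inl i) * e i) = 0" by simp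
  qed
  have "x u = 0" if "u \<in> U" for u
    using that zero2 zero_e zero_c unfolding U_def by auto
  then show False using x(2) by blast
qed

text \<open>
  In the lowest degree of the ideal only the constant terms of the multipliers contribute.
\<close>

lemma base_ideal_degree_span:
  assumes p: "p \<in> I" "bihomogeneous d1 d2 p"
  shows "p \<in> xpoly.span {f0, f1, f2}"
proof -
  obtain g0 g1 g2 where g: "p = g0 * f0 + g1 * f1 + g2 * f2" using p(1) unfolding ideal_span3 by blast
  define c where "c g = Poly_Mapping.lookup g 0" for g :: "'k xpoly"
  define g' where "g' g = g - Const (c g)" for g :: "'k xpoly"
  have high: "m \<notin> bidegree_monomials d1 d2" 
    if mf: "m \<in> Poly_Mapping.keys (g' g * f)" and f: "bihomogeneous d1 d2 f" for m g f
  proof -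
    obtain k l where m: "m = k + l" "k \<in> Poly_Mapping.keys (g' g)" "l \<in> Poly_Mapping.keys f"
      using mf keys_mult[of "g' g" f] by blast
    have "k \<noteq> 0" using m(2) by (auto simp: g'_def c_def Const_def in_keys_iff lookup_minus)
    then obtain v where "Poly_Mapping.lookup k v \<noteq> 0" by (metis poly_mapping_eqI lookup_zero)
    then have "deg1 k > 0 \<or> deg2 k > 0" by (cases v) (auto simp: deg1_def deg2_def)
    moreover have "deg1 l = d1" "deg2 l = d2" using m(3) f by (auto simp: bihomogeneous_def)
    ultimately show ?thesis by (auto simp: m(1) bidegree_monomials_def deg_add)
  qed
  define l where "l = Const (c g0) * f0 + Const (c g1) * f1 + Const (c g2) * f2"
  have diff: "p - l = g' g0 * f0 + g' g1 * f1 + g' g2 * f2"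
    by (simp add: g l_def g'_def algebra_simps)
  have l: "bihomogeneous d1 d2 l" unfolding l_def by (intro bihomogeneous_add bihomogeneous_Const_mult f_hom)
  have "Poly_Mapping.keys (p - l) \<subseteq> bidegree_monomials d1 d2"
    using keys_diff[of p l] p(2) l unfolding bihomogeneous_iff_keys by blast
  moreover have "m \<notin> bidegree_monomials d1 d2" if "m \<in> Poly_Mapping.keys (p - l)" for m
    using that high f_hom unfolding diff
    using Poly_Mapping.keys_add[of "g' g0 * f0 + g' g1 * f1" "g' g2 * f2"]
      Poly_Mapping.keys_add[of "g' g0 * f0" "g' g1 * f1"] by blast
  ultimately have "p - l = 0" by (metis equals0I keys_eq_empty subsetD)
  then have "p = l" by simp
  then show ?thesis
    unfolding l_def by (metis xpoly.span_add xpoly.span_scale xpoly.span_base insertCI)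
qed

text \<open>
  The dimension of a quotient is the size of a basis chosen by description, so the choice has to be
  shown possible.
\<close>

lemma saturation_quotient_basis:
  "\<exists>B. quotient_basis (UNIV :: 'k set) (\<lambda>c p. Const c * p)
    {p \<in> saturation I. bihomogeneous d1 d2 p} {p \<in> I. bihomogeneous d1 d2 p} B"
proof (rule quotient_basis_exists[where n = "(d1 + 1) * (d2 + 1)"])
  show "vector_space (\<lambda>(c::'k) (p::'k xpoly). Const c * p)" by unfold_locales
  show "0 \<in> {p \<in> I. bihomogeneous d1 d2 p}" by (simp add: ideal.span_zero bihomogeneous_0)
  fix B :: "'k xpoly set"
  assume B: "finite B" "B \<subseteq> {p \<in> saturation I. bihomogeneous d1 d2 p}"
    and ind: "\<And>c. c ` B \<subseteq> UNIV \<Longrightarrow> (\<Sum>b\<in>B. Const (c b) * b) \<in> {p \<in> I. bihomogeneous d1 d2 p} \<Longrightarrow> \<forall>b\<in>B. c b = 0"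
  show "card B \<le> (d1 + 1) * (d2 + 1)"
  proof (rule ccontr)
    assume "\<not> ?thesis"
    then have "\<exists>x. (\<exists>u\<in>B. x u \<noteq> 0) \<and> (\<Sum>u\<in>B. Const (x u) * u) = 0"
      using B by (intro bihomogeneous_dependent[of B d1 d2 "\<lambda>b. b"]) auto
    then obtain x where x: "\<exists>u\<in>B. x u \<noteq> 0" "(\<Sum>u\<in>B. Const (x u) * u) = 0" by blast
    have "\<forall>b\<in>B. x b = 0" by (rule ind) (simp_all add: x(2) ideal.span_zero bihomogeneous_0)
    with x(1) show False by blast
  qed
qed (auto simp: subfield_UNIV intro: ideal.span_scale bihomogeneous_Const_mult)

text \<open>
  Three generators and the basis \<open>B\<close> span the saturation in bidegree \<open>(d1, d2)\<close>. A basis of that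
  span is extended to one of the whole graded piece, and the added elements are independent modulo the
  saturation.
\<close>

lemma independent_complement_of_saturation:
  assumes B: "quotient_basis (UNIV :: 'k set) (\<lambda>c p. Const c * p)
    {p \<in> saturation I. bihomogeneous d1 d2 p} {p \<in> I. bihomogeneous d1 d2 p} B"
  shows "\<exists>q r. independent_mod (saturation I) q {..<r::nat} \<and> (\<forall>i<r. bihomogeneous d1 d2 (q i)) \<and>
    (d1 + 1) * (d2 + 1) \<le> r + 3 + card B"
proof -
  let ?V = "{p. bihomogeneous d1 d2 (p :: 'k xpoly)}"
  let ?G = "{f0, f1, f2} \<union> B"
  have fB: "finite B" and BV: "B \<subseteq> ?V" using B by (auto simp: quotient_basis_def)
  have sat: "p \<in> xpoly.span ?G" if p: "p \<in> saturation I" "bihomogeneous d1 d2 p" for p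
  proof -
    have "p \<in> {p \<in> saturation I. bihomogeneous d1 d2 p}" using p by simp
    then have "\<exists>c. c ` B \<subseteq> UNIV \<and> p - (\<Sum>b\<in>B. Const (c b) * b) \<in> {p \<in> I. bihomogeneous d1 d2 p}"
      using B unfolding quotient_basis_def by (elim conjE) (rule bspec)
    then obtain c where "p - (\<Sum>b\<in>B. Const (c b) * b) \<in> {p \<in> I. bihomogeneous d1 d2 p}" by blast
    then have "p - (\<Sum>b\<in>B. Const (c b) * b) \<in> xpoly.span {f0, f1, f2}"
      using base_ideal_degree_span by blast
    then have "p - (\<Sum>b\<in>B. Const (c b) * b) \<in> xpoly.span ?G"
      using xpoly.span_mono[of "{f0, f1, f2}" ?G] by blast
    moreover have "(\<Sum>b\<in>B. Const (c b) * b) \<in> xpoly.span ?G"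
      by (intro xpoly.span_sum xpoly.span_scale xpoly.span_base) simp
    ultimately have "p - (\<Sum>b\<in>B. Const (c b) * b) + (\<Sum>b\<in>B. Const (c b) * b) \<in> xpoly.span ?G"
      by (rule xpoly.span_add)
    then show ?thesis by simp
  qed
  obtain B0 where B0: "B0 \<subseteq> ?G" "xpoly.independent B0" "?G \<subseteq> xpoly.span B0"
    by (rule xpoly.maximal_independent_subset)
  have GV: "?G \<subseteq> ?V" using BV f_hom by auto
  obtain B1 where B1: "B0 \<subseteq> B1" "B1 \<subseteq> ?V" "xpoly.independent B1" "?V \<subseteq> xpoly.span B1"
    using xpoly.maximal_independent_subset_extend[of B0 ?V] B0 GV by blast
  have fB1: "finite B1"
  proof (rule ccontr)
    assume "infinite B1"
    then obtain S where S: "S \<subseteq> B1" "finite S" "card S = Suc ((d1 + 1) * (d2 + 1))"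
      using infinite_arbitrarily_large by metis
    have "\<exists>x. (\<exists>u\<in>S. x u \<noteq> 0) \<and> (\<Sum>u\<in>S. Const (x u) * u) = 0"
      using S B1(2) by (intro bihomogeneous_dependent[of S d1 d2 "\<lambda>b. b"]) auto
    then obtain x u where x: "u \<in> S" "x u \<noteq> 0" "(\<Sum>u\<in>S. Const (x u) * u) = 0" by blast
    have "x u = 0" by (rule xpoly.independentD[OF B1(3) S(2,1) x(3,1)])
    with x(2) show False by simp
  qed
  have "card B0 \<le> card ?G" using B0(1) fB by (intro card_mono) auto
  also have "\<dots> \<le> card {f0, f1, f2} + card B" by (rule card_Un_le)
  also have "card {f0, f1, f2} \<le> 3" by (simp add: card_insert_if)
  finally have cB0: "card B0 \<le> 3 + card B" by simp
  define r where "r = card (B1 - B0)"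
  have "(d1 + 1) * (d2 + 1) \<le> card B1" by (rule dim_bihomogeneous_ge[OF B1(3,4) fB1])
  also have "card B1 = r + card B0"
    unfolding r_def using B1(1) fB1 finite_subset[OF B1(1) fB1]
    by (simp add: card_Diff_subset card_mono)
  finally have count: "(d1 + 1) * (d2 + 1) \<le> r + 3 + card B" using cB0 by simp
  obtain q where q: "bij_betw q {..<r} (B1 - B0)"
    using ex_bij_betw_nat_finite[of "B1 - B0"] fB1 by (auto simp: r_def atLeast0LessThan)
  have "independent_mod (saturation I) q {..<r}"
    unfolding independent_mod_def
  proof (intro allI impI ballI)
    fix c s assume c: "(\<Sum>s<r. Const (c s) * q s) \<in> saturation I" and s: "s \<in> {..<r}"
    have qV: "bihomogeneous d1 d2 (q i)" if "i < r" for i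
      using q that B1(2) by (auto dest: bij_betwE)
    have "bihomogeneous d1 d2 (\<Sum>s<r. Const (c s) * q s)"
      using qV by (intro bihomogeneous_sum bihomogeneous_Const_mult) simp
    then have "(\<Sum>s<r. Const (c s) * q s) \<in> xpoly.span ?G" using sat c by blast
    also have "xpoly.span ?G \<subseteq> xpoly.span B0"
      using B0(3) by (rule xpoly.span_minimal) (rule xpoly.subspace_span)
    finally have "\<exists>d. (\<Sum>s<r. Const (c s) * q s) = (\<Sum>b\<in>B0. Const (d b) * b)"
      using span_image_finite[of B0 "\<Sum>s<r. Const (c s) * q s" "\<lambda>b. b"] finite_subset[OF B1(1) fB1] by simp
    then obtain d where d: "(\<Sum>s<r. Const (c s) * q s) = (\<Sum>b\<in>B0. Const (d b) * b)" by blast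
    define f where "f b = (if b \<in> B0 then - d b else c (inv_into {..<r} q b))" for b
    have "(\<Sum>b\<in>B1. Const (f b) * b) = (\<Sum>b\<in>B1 - B0. Const (f b) * b) + (\<Sum>b\<in>B0. Const (f b) * b)"
      by (rule sum.subset_diff[OF B1(1) fB1])
    also have "(\<Sum>b\<in>B1 - B0. Const (f b) * b) = (\<Sum>s<r. Const (f (q s)) * q s)"
      by (rule sum.reindex_bij_betw[OF q, symmetric])
    also have "\<dots> = (\<Sum>s<r. Const (c s) * q s)"
    proof (intro sum.cong refl)
      fix t assume "t \<in> {..<r}"
      then have "q t \<notin> B0" "inv_into {..<r} q (q t) = t"
        using q by (auto dest: bij_betwE simp: bij_betw_inv_into_left)
      then show "Const (f (q t)) * q t = Const (c t) * q t" by (simp add: f_def)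
    qed
    also have "(\<Sum>b\<in>B0. Const (f b) * b) = - (\<Sum>b\<in>B0. Const (d b) * b)"
    proof -
      have "Const (- y) = - Const y" for y :: 'k by (simp add: Const_def single_uminus)
      then show ?thesis by (simp add: f_def sum_negf)
    qed
    finally have "(\<Sum>b\<in>B1. Const (f b) * b) = 0" using d by simp
    moreover have qs: "q s \<in> B1 - B0" using q s by (auto dest: bij_betwE)
    ultimately have "f (q s) = 0"
      using xpoly.independentD[OF B1(3) fB1 subset_refl, of f "q s"] by blast
    then show "c s = 0" using qs q s by (simp add: f_def bij_betw_inv_into_left)
  qed
  moreover have "\<forall>i<r. bihomogeneous d1 d2 (q i)" using q B1(2) by (auto dest: bij_betwE)
  ultimately show ?thesis using count by blast
qed

lemma card_independent_le:
  assumes B: "finite B" "B \<subseteq> function_field"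
    and indep: "\<And>c. c ` B \<subseteq> pullback_field f0 f1 f2 \<Longrightarrow> (\<Sum>b\<in>B. c b * b) \<in> {0} \<Longrightarrow> \<forall>b\<in>B. c b = 0"
    and q: "independent_mod (saturation I) q {..<r}" "\<And>i. i < r \<Longrightarrow> bihomogeneous d1 d2 (q i)"
  shows "card B + r \<le> 2 * d1 * d2"
proof -
  obtain h where h: "bij_betw h {..<card B} B"
    using ex_bij_betw_nat_finite[OF B(1)] by (auto simp: atLeast0LessThan)
  show ?thesis
  proof (rule independent_count_le[OF _ _ q])
    show "h i \<in> function_field" if "i < card B" for i
      using h that B(2) by (auto dest: bij_betwE)
    fix c assume c: "\<And>i. i < card B \<Longrightarrow> c i \<in> pullback_field f0 f1 f2" "(\<Sum>i<card B. c i * h i) = 0"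
    let ?c = "\<lambda>b. c (inv_into {..<card B} h b)"
    have inv: "?c (h i) = c i" if "i < card B" for i
      using h that by (simp add: bij_betw_inv_into_left)
    have "(\<Sum>b\<in>B. ?c b * b) = (\<Sum>i<card B. ?c (h i) * h i)"
      by (rule sum.reindex_bij_betw[OF h, symmetric])
    also have "\<dots> = 0" using c(2) inv by simp
    finally have "(\<Sum>b\<in>B. ?c b * b) \<in> {0}" by simp
    moreover have "?c b \<in> pullback_field f0 f1 f2" if "b \<in> B" for b
    proof -
      have "inv_into {..<card B} h b < card B"
        using bij_betw_inv_into[OF h] that by (auto dest: bij_betwE)
      then show ?thesis by (rule c(1))
    qed
    then have "?c ` B \<subseteq> pullback_field f0 f1 f2" by auto
    ultimately have "\<forall>b\<in>B. ?c b = 0" using indep[of ?c] by blast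
    then show "\<forall>i<card B. c i = 0" using inv h by (metis bij_betwE lessThan_iff)
  qed
qed

end

section \<open>The degree bound\<close>

theorem proposition3p15:
  fixes f0 f1 f2 :: "'k::field xpoly" and I :: "'k xpoly set" and d1 d2 :: nat
  assumes "bihomogeneous d1 d2 f0" "bihomogeneous d1 d2 f1" "bihomogeneous d1 d2 f2"
    and "dominant f0 f1 f2"
    and "I = ideal.span {f0, f1, f2}"
    and "finite_base_locus I"
  shows "generically_finite f0 f1 f2 \<and>
    int (map_degree f0 f1 f2) \<le>
      1 + (int d1 - 1) * (int d2 - 1) + int (graded_quotient_dim d1 d2 (saturation I) I)"
proof -
  interpret dominant_map_finite f0 f1 f2 d1 d2
    using assms by unfold_locales auto
  let ?M = "pullback_field f0 f1 f2"
  define B where "B = (SOME B. quotient_basis (UNIV :: 'k set) (\<lambda>c p. Const c * p)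
    {p \<in> saturation I. bihomogeneous d1 d2 p} {p \<in> I. bihomogeneous d1 d2 p} B)"
  have "quotient_basis (UNIV :: 'k set) (\<lambda>c p. Const c * p)
    {p \<in> saturation I. bihomogeneous d1 d2 p} {p \<in> I. bihomogeneous d1 d2 p} B"
    unfolding B_def assms(5) by (rule someI_ex[OF saturation_quotient_basis])
  from independent_complement_of_saturation[OF this[unfolded assms(5)]]
  obtain q r where q: "independent_mod (saturation I) q {..<r::nat}" "\<And>i. i < r \<Longrightarrow> bihomogeneous d1 d2 (q i)"
    and r: "(d1 + 1) * (d2 + 1) \<le> r + 3 + card B"
    unfolding assms(5) by blast
  have B: "graded_quotient_dim d1 d2 (saturation I) I = card B"
    by (simp add: graded_quotient_dim_def quotient_dim_def B_def)
  have bound: "card C + r \<le> 2 * d1 * d2" if "finite C" "C \<subseteq> function_field"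
    "\<And>c. c ` C \<subseteq> ?M \<Longrightarrow> (\<Sum>b\<in>C. c b * b) \<in> {0} \<Longrightarrow> \<forall>b\<in>C. c b = 0" for C
    using card_independent_le[OF that] q unfolding assms(5) by blast
  have ex: "\<exists>C. quotient_basis ?M (*) function_field {0} C"
  proof (rule quotient_basis_exists[OF subfield_pullback_field[OF assms(4)], where n = "2 * d1 * d2"])
    show "vector_space ((*) :: 'k xpoly fract \<Rightarrow> _)"
      by unfold_locales (simp_all add: algebra_simps)
    show "card C \<le> 2 * d1 * d2" if "finite C" "C \<subseteq> function_field"
      "\<And>c. c ` C \<subseteq> ?M \<Longrightarrow> (\<Sum>b\<in>C. c b * b) \<in> {0} \<Longrightarrow> \<forall>b\<in>C. c b = 0" for C
      using bound[OF that] by simp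
  qed auto
  define C where "C = (SOME C. quotient_basis ?M (*) function_field {0} C)"
  have C: "quotient_basis ?M (*) function_field {0} C"
    unfolding C_def by (rule someI_ex[OF ex])
  have "card C + r \<le> 2 * d1 * d2"
    by (rule bound) (use C in \<open>auto simp: quotient_basis_def\<close>)
  then have "card C + (d1 + 1) * (d2 + 1) \<le> 2 * d1 * d2 + 3 + card B" using r by linarith
  then have "int (card C + (d1 + 1) * (d2 + 1)) \<le> int (2 * d1 * d2 + 3 + card B)"
    by (simp only: of_nat_le_iff)
  then have "int (card C) \<le> 1 + (int d1 - 1) * (int d2 - 1) + int (card B)"
    by (simp add: algebra_simps)
  moreover have "map_degree f0 f1 f2 = card C"
    by (simp add: map_degree_def quotient_dim_def C_def)
  moreover have "generically_finite f0 f1 f2"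
    unfolding generically_finite_def quotient_finite_dim_def by (rule ex)
  ultimately show ?thesis unfolding B by simp
qed

end
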